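(* Let $\partial\Omega=\Gamma_0\cup\Gamma_3$. The saddle-point problem of finding $(u,\vec v,\vec\alpha)\in L^2(\Omega)\times H_0^{\Gamma_3}(\mathrm{div};\Omega)\times H_0^{\Gamma_3}(\mathrm{div};\Omega)$ such that $$a\big((u,\vec v),(\phi,\vec\psi)\big)+b\big((\phi,\vec\psi),\vec\alpha\big)=F(\phi),\qquad b\big((u,\vec v),\vec\beta\big)=0$$ for all $(\phi,\vec\psi,\vec\beta)\in L^2(\Omega)\times H_0^{\Gamma_3}(\mathrm{div};\Omega)\times H_0^{\Gamma_3}(\mathrm{div};\Omega)$ has a unique solution for any $c_0\ge 0$ and $c_1>0$, and for $c_1\ge 0$ if $\Gamma_0$ is nonempty.
   Context: $\Omega\subset\mathbb R^d$, $d\in\{2,3\}$, is an open, connected, bounded polytope with Lipschitz boundary and outward pointing normal $\vec n$; $c_0,c_1$ are nonnegative constants. The $\Gamma_i$ are segments of $\partial\Omega$ carrying different boundary conditions for the fourth-order problem $\Delta^2u-c_0\Delta u+c_1u=f$: $u=\Delta u=0$ on $\Gamma_0$, and $\frac{\partial(\Delta u-c_0u)}{\partial n}=\frac{\partial u}{\partial n}=0$ on $\Gamma_3$. The datum satisfies $f\in V^*$, the dual space of $V=\{v\in H^1(\Omega):\Delta v\in L^2(\Omega)\}$ (with inner product $\int_\Omega uv+\nabla u\cdot\nabla v+\Delta u\,\Delta v$). For $\Gamma\subset\partial\Omega$, $H_0^{\Gamma}(\mathrm{div};\Omega)=\{\vec v\in H(\mathrm{div};\Omega): \vec v\cdot\vec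 n=0\text{ on }\Gamma\}$. The forms are $$a\big((u,\vec v),(\phi,\vec\psi)\big)=c_0\int_\Omega\vec v\cdot\vec\psi+\int_\Omega\nabla\cdot\vec v\,\nabla\cdot\vec\psi+c_1\int_\Omega u\phi,$$ $$b\big((u,\vec v),\vec\beta\big)=\int_\Omega\vec\beta\cdot\vec v+u\,\nabla\cdot\vec\beta,\qquad F(\phi)=\int_\Omega f\phi.$$
   Formalization: For general f in V* the pairing F(φ)=∫fφ is undefined on L² (e.g. f a point evaluation) and no solution exists; f is assumed to extend to a bounded functional F on L². The segments Γ_0, Γ_3 are non-overlapping unions of flat boundary pieces, so a nonempty Γ_0 has positive measure. *)

theory Defs
  imports "HOL-Analysis.Analysis"
begin

section \<open>Domains and boundary segments\<close>

text \<open>Locally, after a rotation taking \<open>e\<close> to the last coordinate direction, the set is the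
  strict epigraph of a Lipschitz function \<open>g\<close>. Only the values of \<open>g\<close> on the hyperplane
  orthogonal to \<open>e\<close> are used.\<close>

definition lipschitz_boundary :: "(real^'d) set \<Rightarrow> bool" where
  "lipschitz_boundary \<Omega> \<longleftrightarrow>
     (\<forall>x\<in>frontier \<Omega>. \<exists>U e L (g :: real^'d \<Rightarrow> real).
        open U \<and> x \<in> U \<and> norm e = 1 \<and> L-lipschitz_on UNIV g \<and>
        \<Omega> \<inter> U = {y \<in> U. g (y - (y \<bullet> e) *\<^sub>R e) < y \<bullet> e})"

text \<open>A polytope is understood here as in finite element analysis (a polygonal or polyhedral
  domain), so it need not be convex; the library predicate \<open>polytope\<close> is the convex notion.\<close>

definition polytopal_domain :: "(real^'d) set \<Rightarrow> bool" where
  "polytopal_domain \<Omega> \<longleftrightarrow>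
     open \<Omega> \<and> connected \<Omega> \<and> bounded \<Omega> \<and> \<Omega> \<noteq> {} \<and> lipschitz_boundary \<Omega> \<and>
     (\<exists>\<P>. finite \<P> \<and> (\<forall>P\<in>\<P>. polytope P) \<and> closure \<Omega> = \<Union>\<P>)"

text \<open>A boundary segment is a finite union of flat pieces of codimension one. The pieces may or
  may not contain (part of) their relative boundaries. In particular a nonempty segment has
  positive surface measure.\<close>

definition boundary_segment :: "(real^'d) set \<Rightarrow> (real^'d) set \<Rightarrow> bool" where
  "boundary_segment \<Omega> \<Gamma> \<longleftrightarrow>
     \<Gamma> \<subseteq> frontier \<Omega> \<and>
     (\<exists>\<F>. finite \<F> \<and> (\<forall>P\<in>\<F>. polytope P \<and> aff_dim P = int CARD('d) - 1) \<and>
          (\<Union>P\<in>\<F>. rel_interior P) \<subseteq> \<Gamma> \<and> \<Gamma> \<subseteq> \<Union>\<F>)"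

definition nonoverlapping :: "(real^'d) set \<Rightarrow> (real^'d) set \<Rightarrow> (real^'d) set \<Rightarrow> bool" where
  "nonoverlapping \<Omega> \<Gamma> \<Gamma>' \<longleftrightarrow> top_of_set (frontier \<Omega>) interior_of (\<Gamma> \<inter> \<Gamma>') = {}"

section \<open>Test functions and weak derivatives\<close>

definition grad :: "(real^'d \<Rightarrow> real) \<Rightarrow> real^'d \<Rightarrow> real^'d" where
  "grad \<phi> x = (\<chi> i. frechet_derivative \<phi> (at x) (axis i 1))"

primrec Ck :: "nat \<Rightarrow> (real^'d \<Rightarrow> real) \<Rightarrow> bool" where
  "Ck 0 \<phi> \<longleftrightarrow> continuous_on UNIV \<phi>"
| "Ck (Suc k) \<phi> \<longleftrightarrow> \<phi> differentiable_on UNIV \<and> (\<forall>i. Ck k (\<lambda>x. grad \<phi> x $ i))"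

definition test_functions :: "(real^'d) set \<Rightarrow> (real^'d \<Rightarrow> real) set" where
  "test_functions U =
     {\<phi>. (\<forall>k. Ck k \<phi>) \<and> compact (closure {x. \<phi> x \<noteq> 0}) \<and> closure {x. \<phi> x \<noteq> 0} \<subseteq> U}"

text \<open>Elements of the function spaces below are functions, not classes modulo null sets;
  accordingly \<open>wdiv\<close> and \<open>wgrad\<close> are determined only almost everywhere.\<close>

definition L2 :: "(real^'d) set \<Rightarrow> (real^'d \<Rightarrow> 'b::euclidean_space) set" where
  "L2 \<Omega> = {u \<in> borel_measurable (lebesgue_on \<Omega>). integrable (lebesgue_on \<Omega>) (\<lambda>x. (norm (u x))\<^sup>2)}"

definition L2_norm :: "(real^'d) set \<Rightarrow> (real^'d \<Rightarrow> 'b::euclidean_space) \<Rightarrow> real" where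
  "L2_norm \<Omega> u = sqrt (integral\<^sup>L (lebesgue_on \<Omega>) (\<lambda>x. (norm (u x))\<^sup>2))"

definition ae_eq :: "(real^'d) set \<Rightarrow> (real^'d \<Rightarrow> 'b) \<Rightarrow> (real^'d \<Rightarrow> 'b) \<Rightarrow> bool" where
  "ae_eq \<Omega> u v \<longleftrightarrow> (AE x in lebesgue_on \<Omega>. u x = v x)"

definition is_weak_grad ::
    "(real^'d) set \<Rightarrow> (real^'d \<Rightarrow> real) \<Rightarrow> (real^'d \<Rightarrow> real^'d) \<Rightarrow> bool" where
  "is_weak_grad \<Omega> u G \<longleftrightarrow>
     (\<forall>\<phi>\<in>test_functions \<Omega>.
        integral\<^sup>L (lebesgue_on \<Omega>) (\<lambda>x. u x *\<^sub>R grad \<phi> x) =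
        - integral\<^sup>L (lebesgue_on \<Omega>) (\<lambda>x. \<phi> x *\<^sub>R G x))"

definition is_weak_div ::
    "(real^'d) set \<Rightarrow> (real^'d \<Rightarrow> real^'d) \<Rightarrow> (real^'d \<Rightarrow> real) \<Rightarrow> bool" where
  "is_weak_div \<Omega> v g \<longleftrightarrow>
     (\<forall>\<phi>\<in>test_functions \<Omega>.
        integral\<^sup>L (lebesgue_on \<Omega>) (\<lambda>x. v x \<bullet> grad \<phi> x) =
        - integral\<^sup>L (lebesgue_on \<Omega>) (\<lambda>x. g x * \<phi> x))"

definition wgrad :: "(real^'d) set \<Rightarrow> (real^'d \<Rightarrow> real) \<Rightarrow> real^'d \<Rightarrow> real^'d" where
  "wgrad \<Omega> u = (SOME G. G \<in> L2 \<Omega> \<and> is_weak_grad \<Omega> u G)"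

definition wdiv :: "(real^'d) set \<Rightarrow> (real^'d \<Rightarrow> real^'d) \<Rightarrow> real^'d \<Rightarrow> real" where
  "wdiv \<Omega> v = (SOME g. g \<in> L2 \<Omega> \<and> is_weak_div \<Omega> v g)"

definition H1 :: "(real^'d) set \<Rightarrow> (real^'d \<Rightarrow> real) set" where
  "H1 \<Omega> = {u \<in> L2 \<Omega>. \<exists>G\<in>L2 \<Omega>. is_weak_grad \<Omega> u G}"

definition H1_norm :: "(real^'d) set \<Rightarrow> (real^'d \<Rightarrow> real) \<Rightarrow> real" where
  "H1_norm \<Omega> u = sqrt ((L2_norm \<Omega> u)\<^sup>2 + (L2_norm \<Omega> (wgrad \<Omega> u))\<^sup>2)"

definition Hdiv :: "(real^'d) set \<Rightarrow> (real^'d \<Rightarrow> real^'d) set" where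
  "Hdiv \<Omega> = {v \<in> L2 \<Omega>. \<exists>g\<in>L2 \<Omega>. is_weak_div \<Omega> v g}"

section \<open>Normal traces\<close>

text \<open>The space of all \<open>w\<close> in \<open>H1 \<Omega>\<close> with \<open>w = 0\<close> on \<open>D\<close>, as the closure in \<open>H1 \<Omega>\<close> of the
  smooth functions that vanish near \<open>D\<close>.\<close>

definition H1_zero_on :: "(real^'d) set \<Rightarrow> (real^'d) set \<Rightarrow> (real^'d \<Rightarrow> real) set" where
  "H1_zero_on \<Omega> D =
     {w \<in> H1 \<Omega>. \<forall>\<epsilon>>0. \<exists>\<phi>\<in>test_functions (- closure D). H1_norm \<Omega> (\<lambda>x. w x - \<phi> x) < \<epsilon>}"

text \<open>For \<open>v\<close> in \<open>Hdiv \<Omega>\<close> the normal component on the boundary is only a functional. It is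
  defined by Green's formula: for smooth \<open>v\<close> and \<open>w\<close> the right-hand side is the boundary integral
  of \<open>w\<close> times the outward normal component of \<open>v\<close>.\<close>

definition normal_trace ::
    "(real^'d) set \<Rightarrow> (real^'d \<Rightarrow> real^'d) \<Rightarrow> (real^'d \<Rightarrow> real) \<Rightarrow> real" where
  "normal_trace \<Omega> v w =
     integral\<^sup>L (lebesgue_on \<Omega>) (\<lambda>x. v x \<bullet> wgrad \<Omega> w x + wdiv \<Omega> v x * w x)"

text \<open>The normal trace vanishes on \<open>\<Gamma>\<close> if it annihilates every \<open>w\<close> that is zero on the rest of
  the boundary.\<close>

definition Hdiv_zero_on :: "(real^'d) set \<Rightarrow> (real^'d) set \<Rightarrow> (real^'d \<Rightarrow> real^'d) set" where
  "Hdiv_zero_on \<Omega> \<Gamma> =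
     {v \<in> Hdiv \<Omega>. \<forall>w\<in>H1_zero_on \<Omega> (frontier \<Omega> - \<Gamma>). normal_trace \<Omega> v w = 0}"

section \<open>Data\<close>

definition wlaplace :: "(real^'d) set \<Rightarrow> (real^'d \<Rightarrow> real) \<Rightarrow> real^'d \<Rightarrow> real" where
  "wlaplace \<Omega> u = wdiv \<Omega> (wgrad \<Omega> u)"

definition V_space :: "(real^'d) set \<Rightarrow> (real^'d \<Rightarrow> real) set" where
  "V_space \<Omega> = {v \<in> H1 \<Omega>. wgrad \<Omega> v \<in> Hdiv \<Omega>}"

definition V_inner :: "(real^'d) set \<Rightarrow> (real^'d \<Rightarrow> real) \<Rightarrow> (real^'d \<Rightarrow> real) \<Rightarrow> real" where
  "V_inner \<Omega> u v = integral\<^sup>L (lebesgue_on \<Omega>)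
     (\<lambda>x. u x * v x + wgrad \<Omega> u x \<bullet> wgrad \<Omega> v x + wlaplace \<Omega> u x * wlaplace \<Omega> v x)"

definition V_norm :: "(real^'d) set \<Rightarrow> (real^'d \<Rightarrow> real) \<Rightarrow> real" where
  "V_norm \<Omega> v = sqrt (V_inner \<Omega> v v)"

text \<open>Bounded linear functionals on a space \<open>S\<close> of functions with (semi)norm \<open>N\<close>. The bound makes
  such a functional independent of the representative modulo null sets.\<close>

definition dual_space ::
    "(real^'d \<Rightarrow> real) set \<Rightarrow> ((real^'d \<Rightarrow> real) \<Rightarrow> real) \<Rightarrow> ((real^'d \<Rightarrow> real) \<Rightarrow> real) set" where
  "dual_space S N =
     {F. (\<forall>u\<in>S. \<forall>v\<in>S. F (\<lambda>x. u x + v x) = F u + F v) \<and>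
         (\<forall>u\<in>S. \<forall>c. F (\<lambda>x. c * u x) = c * F u) \<and>
         (\<exists>C. \<forall>u\<in>S. \<bar>F u\<bar> \<le> C * N u)}"

section \<open>The saddle-point problem\<close>

text \<open>The first equation is tested with all of \<open>L2 \<Omega>\<close>, so for a datum \<open>f\<close> in the dual of
  \<open>V_space \<Omega>\<close> the right-hand side \<open>F\<close> is the bounded extension of \<open>f\<close> to \<open>L2 \<Omega>\<close>. Choosing \<open>\<psi> = 0\<close>
  shows that no solution can exist if \<open>f\<close> has no such extension.\<close>

definition form_a ::
    "real \<Rightarrow> real \<Rightarrow> (real^'d) set \<Rightarrow> (real^'d \<Rightarrow> real) \<times> (real^'d \<Rightarrow> real^'d)
     \<Rightarrow> (real^'d \<Rightarrow> real) \<times> (real^'d \<Rightarrow> real^'d) \<Rightarrow> real" where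
  "form_a c0 c1 \<Omega> = (\<lambda>(u, v) (\<phi>, \<psi>).
     c0 * integral\<^sup>L (lebesgue_on \<Omega>) (\<lambda>x. v x \<bullet> \<psi> x)
     + integral\<^sup>L (lebesgue_on \<Omega>) (\<lambda>x. wdiv \<Omega> v x * wdiv \<Omega> \<psi> x)
     + c1 * integral\<^sup>L (lebesgue_on \<Omega>) (\<lambda>x. u x * \<phi> x))"

definition form_b ::
    "(real^'d) set \<Rightarrow> (real^'d \<Rightarrow> real) \<times> (real^'d \<Rightarrow> real^'d) \<Rightarrow> (real^'d \<Rightarrow> real^'d) \<Rightarrow> real" where
  "form_b \<Omega> = (\<lambda>(u, v) \<beta>.
     integral\<^sup>L (lebesgue_on \<Omega>) (\<lambda>x. \<beta> x \<bullet> v x + u x * wdiv \<Omega> \<beta> x))"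

definition saddle_point_solution ::
    "(real^'d) set \<Rightarrow> (real^'d) set \<Rightarrow> real \<Rightarrow> real \<Rightarrow> ((real^'d \<Rightarrow> real) \<Rightarrow> real)
     \<Rightarrow> (real^'d \<Rightarrow> real) \<Rightarrow> (real^'d \<Rightarrow> real^'d) \<Rightarrow> (real^'d \<Rightarrow> real^'d) \<Rightarrow> bool" where
  "saddle_point_solution \<Omega> \<Gamma>\<^sub>3 c0 c1 F u v \<alpha> \<longleftrightarrow>
     u \<in> L2 \<Omega> \<and> v \<in> Hdiv_zero_on \<Omega> \<Gamma>\<^sub>3 \<and> \<alpha> \<in> Hdiv_zero_on \<Omega> \<Gamma>\<^sub>3 \<and>
     (\<forall>\<phi>\<in>L2 \<Omega>. \<forall>\<psi>\<in>Hdiv_zero_on \<Omega> \<Gamma>\<^sub>3.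
        form_a c0 c1 \<Omega> (u, v) (\<phi>, \<psi>) + form_b \<Omega> (\<phi>, \<psi>) \<alpha> = F \<phi>) \<and>
     (\<forall>\<beta>\<in>Hdiv_zero_on \<Omega> \<Gamma>\<^sub>3. form_b \<Omega> (u, v) \<beta> = 0)"

end

theory Submission
  imports Defs
begin

text \<open>Modulo null sets, the graph of the divergence on \<open>Hdiv_zero_on \<Omega> \<Gamma>\<^sub>3\<close> is an orthogonal complement
  in \<open>L2\<close>, hence closed, and so is the kernel of the form \<open>b\<close>. On that kernel \<open>(v, v) = - (u, div v)\<close>
  and the form \<open>a\<close> is symmetric, so Riesz representation yields \<open>u\<close> and \<open>v\<close> as soon as \<open>a\<close> is coercive
  there. For \<open>c1 > 0\<close> this is immediate. For \<open>c1 = 0\<close> it suffices that the divergence maps onto \<open>L2\<close>,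
  which is dual to a Poincare inequality for smooth functions vanishing near \<open>\<Gamma>\<^sub>0\<close>. The multiplier
  \<open>\<alpha>\<close> is the Riesz representative, in the graph inner product, of \<open>\<beta> \<mapsto> l (div \<beta>, \<beta>)\<close> with \<open>l\<close> the residual
  of the first equation, because the pairs \<open>(div \<beta>, \<beta>)\<close> complement the kernel of \<open>b\<close>.

  The Poincare inequality is obtained from a single device: if a set can be moved within \<open>\<Omega>\<close> by a
  translation, its \<open>L2\<close> mass is bounded by that of the translate plus the gradient energy. Starting at a flat
  piece of \<open>\<Gamma>\<^sub>0\<close>, such bounds spread over \<open>\<Omega>\<close> by connectedness and up to the boundary by the
  Lipschitz charts.\<close>

text \<open>\<open>wdiv\<close> and \<open>wgrad\<close> return arbitrary representatives, so the
  divergence is handled as a relation: pairs \<open>(v, g)\<close> are tested against pairs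
  (gradient, function), and a choice is made only when translating back. What is used of closedness
  is that orthogonality to a set of tests survives weak limits. The inf-sup condition costs nothing:
  the form b at the pair (divergence of \<beta>, \<beta>), tested with \<beta>, returns the full
  squared graph norm of \<beta>. This is possible because the scalar test functions range over all
  of L2. The alternative between positive \<open>c1\<close> and nonempty \<Gamma>0 therefore enters
  only through coercivity on the kernel. With \<open>c0 = c1 = 0\<close> the form a sees nothing but
  the divergence of v, and a field with prescribed divergence is what recovers u and then v. The
  Poincare inequality is proved by estimates along segments instead of a compactness argument, so
  neither trace operators nor compact embeddings occur; the price is a constant, uniform in the
  function, that is carried through finitely many moves.\<close>

lemma quadratic_nonneg_discriminant:
  fixes a b c :: real
  assumes "\<And>t. a + 2 * t * b + t\<^sup>2 * c \<ge> 0"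
  shows "b\<^sup>2 \<le> a * c"
proof (cases "c = 0")
  case True
  have "b = 0"
  proof (rule ccontr)
    assume "b \<noteq> 0"
    \<comment> \<open>At this \<open>t\<close> the affine function takes the value -1.\<close>
    then show False using assms[of "- (a + 1) / (2 * b)"] True by (simp add: field_simps)
  qed
  then show ?thesis using True by simp
next
  case c: False
  have "c > 0"
  proof (rule ccontr)
    assume "\<not> c > 0"
    then have neg: "c < 0" using c by simp
    \<comment> \<open>Chosen so that \<open>t * c\<close> absorbs
      \<open>\<bar>a\<bar> + 2 * \<bar>b\<bar>\<close>; together with \<open>t \<ge> 1\<close> the
      quadratic becomes negative.\<close>
    define t where "t = 1 + (\<bar>a\<bar> + 2 * \<bar>b\<bar>) / (- c)"
    have t1: "t \<ge> 1" using neg by (simp add: t_def divide_nonneg_neg)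
    have tc: "t * c = c - (\<bar>a\<bar> + 2 * \<bar>b\<bar>)" using neg by (simp add: t_def field_simps)
    have "t\<^sup>2 * c = t * (c - (\<bar>a\<bar> + 2 * \<bar>b\<bar>))" using tc by (simp add: power2_eq_square)
    then have "a + 2 * t * b + t\<^sup>2 * c = a - t * \<bar>a\<bar> + 2 * t * (b - \<bar>b\<bar>) + t * c"
      by (simp add: algebra_simps)
    moreover have "a \<le> t * \<bar>a\<bar>" using mult_right_mono[OF t1, of "\<bar>a\<bar>"] by simp
    moreover have "2 * t * (b - \<bar>b\<bar>) \<le> 0" using t1 by (simp add: mult_nonneg_nonpos)
    moreover have "t * c < 0" using t1 neg by (simp add: mult_pos_neg)
    ultimately show False using assms[of t] by linarith
  qed
  then show ?thesis using assms[of "- b / c"] by (simp add: field_simps power2_eq_square)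
qed

section \<open>Semi-inner products on spaces of functions\<close>

text \<open>Definiteness is left out because functions that differ on a null set are distinct
  elements of \<open>S\<close>, and because the pointwise weight of the form a degenerates when
  \<open>c0\<close> or \<open>c1\<close> is 0. The instances are L2, orthogonal complements with a
  matrix weight, and smooth functions with the Dirichlet form.\<close>

locale semi_inner =
  fixes S :: "('x \<Rightarrow> 'b::real_vector) set" and B :: "('x \<Rightarrow> 'b) \<Rightarrow> ('x \<Rightarrow> 'b) \<Rightarrow> real"
  assumes zero: "(\<lambda>x. 0) \<in> S"
    and add: "u \<in> S \<Longrightarrow> w \<in> S \<Longrightarrow> (\<lambda>x. u x + w x) \<in> S"
    and scale: "u \<in> S \<Longrightarrow> (\<lambda>x. c *\<^sub>R u x) \<in> S"
    and B_add: "u \<in> S \<Longrightarrow> w \<in> S \<Longrightarrow> z \<in> S \<Longrightarrow> B (\<lambda>x. u x + w x) z = B u z + B w z"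
    and B_scale: "u \<in> S \<Longrightarrow> z \<in> S \<Longrightarrow> B (\<lambda>x. c *\<^sub>R u x) z = c * B u z"
    and B_sym: "u \<in> S \<Longrightarrow> z \<in> S \<Longrightarrow> B u z = B z u"
    and B_nonneg: "u \<in> S \<Longrightarrow> 0 \<le> B u u"
begin

lemma diff: "u \<in> S \<Longrightarrow> w \<in> S \<Longrightarrow> (\<lambda>x. u x - w x) \<in> S"
  using add[OF _ scale[of w "-1"], of u] by simp

lemma B_add_right: "u \<in> S \<Longrightarrow> w \<in> S \<Longrightarrow> z \<in> S \<Longrightarrow> B z (\<lambda>x. u x + w x) = B z u + B z w"
  using B_add[of u w z] B_sym[of z "\<lambda>x. u x + w x"] B_sym[of z u] B_sym[of z w] add by simp

lemma B_scale_right: "u \<in> S \<Longrightarrow> z \<in> S \<Longrightarrow> B z (\<lambda>x. c *\<^sub>R u x) = c * B z u"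
  using B_scale[of u z c] B_sym[of z "\<lambda>x. c *\<^sub>R u x"] B_sym[of z u] scale by simp

lemma B_diff: "u \<in> S \<Longrightarrow> w \<in> S \<Longrightarrow> z \<in> S \<Longrightarrow> B (\<lambda>x. u x - w x) z = B u z - B w z"
  using B_add[OF _ scale[of w "-1"], of u z] B_scale[of w z "-1"] by simp

lemma B_diff_right: "u \<in> S \<Longrightarrow> w \<in> S \<Longrightarrow> z \<in> S \<Longrightarrow> B z (\<lambda>x. u x - w x) = B z u - B z w"
  using B_diff[of u w z] B_sym[of z "\<lambda>x. u x - w x"] B_sym[of z u] B_sym[of z w] diff by simp

lemma B_line:
  assumes "u \<in> S" "w \<in> S"
  shows "B (\<lambda>x. u x + t *\<^sub>R w x) (\<lambda>x. u x + t *\<^sub>R w x) = B u u + 2 * t * B u w + t\<^sup>2 * B w w"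
  using assms B_sym[of w u]
  by (simp add: B_add B_scale B_add_right B_scale_right add scale power2_eq_square algebra_simps)

lemma Cauchy_Schwarz:
  assumes "u \<in> S" "w \<in> S"
  shows "(B u w)\<^sup>2 \<le> B u u * B w w"
proof (rule quadratic_nonneg_discriminant)
  fix t
  show "0 \<le> B u u + 2 * t * B u w + t\<^sup>2 * B w w"
    using B_nonneg[OF add[OF assms(1) scale[OF assms(2)]], of t] B_line[OF assms, of t] by simp
qed

lemma Cauchy_Schwarz_abs:
  assumes "u \<in> S" "w \<in> S"
  shows "\<bar>B u w\<bar> \<le> sqrt (B u u) * sqrt (B w w)"
  using Cauchy_Schwarz[OF assms] by (metis real_sqrt_abs real_sqrt_le_mono real_sqrt_mult)

text \<open>A minimizing sequence of the energy \<open>B w w - 2 * F w\<close>; no completeness is assumed.\<close>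

lemma Riesz_sequence:
  assumes F_add: "\<And>u w. u \<in> S \<Longrightarrow> w \<in> S \<Longrightarrow> F (\<lambda>x. u x + w x) = F u + F w"
    and F_scale: "\<And>u c. u \<in> S \<Longrightarrow> F (\<lambda>x. c *\<^sub>R u x) = c * F u"
    and F_bound: "\<And>u. u \<in> S \<Longrightarrow> \<bar>F u\<bar> \<le> C * sqrt (B u u)"
  obtains z :: "nat \<Rightarrow> 'x \<Rightarrow> 'b" where "\<And>n. z n \<in> S"
    and "\<And>m n. B (\<lambda>x. z m x - z n x) (\<lambda>x. z m x - z n x) \<le> 2 / Suc m + 2 / Suc n"
    and "\<And>w. w \<in> S \<Longrightarrow> (\<lambda>n. B (z n) w) \<longlonglongrightarrow> F w"
proof -
  define J where "J w = B w w - 2 * F w" for w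
  define d where "d = (INF w\<in>S. J w)"
  \<comment> \<open>Completing the square in \<open>sqrt (B w w)\<close> bounds the energy below, so
    its infimum is finite.\<close>
  have J_ge: "J w \<ge> - C\<^sup>2" if "w \<in> S" for w
  proof -
    have "B w w = (sqrt (B w w))\<^sup>2" using B_nonneg[OF that] by simp
    moreover have "0 \<le> (sqrt (B w w) - C)\<^sup>2" by simp
    moreover have "F w \<le> C * sqrt (B w w)" using F_bound[OF that] by simp
    ultimately show ?thesis unfolding J_def power2_diff by (simp add: algebra_simps)
  qed
  have bdd: "bdd_below (J ` S)" using J_ge by (auto intro!: bdd_belowI2)
  have d_le: "d \<le> J w" if "w \<in> S" for w unfolding d_def using bdd that by (rule cINF_lower)
  have "\<exists>w\<in>S. J w < d + 1 / Suc n" for n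
  proof -
    have "Inf (J ` S) < d + 1 / Suc n" unfolding d_def by simp
    then show ?thesis using cINF_less_iff[OF _ bdd] zero by blast
  qed
  then obtain z where z: "\<And>n. z n \<in> S" "\<And>n. J (z n) < d + 1 / Suc n" by metis
  have F_diff: "F (\<lambda>x. u x - w x) = F u - F w" if "u \<in> S" "w \<in> S" for u w
    using F_add[OF that(1) scale[OF that(2), of "-1"]] F_scale[OF that(2), of "-1"] by simp
  show thesis
  proof
    show "z n \<in> S" for n by (rule z)
    show "B (\<lambda>x. z m x - z n x) (\<lambda>x. z m x - z n x) \<le> 2 / Suc m + 2 / Suc n" for m n
    proof -
      \<comment> \<open>Parallelogram law at the midpoint: the squared distance is
        \<open>2 * J (z m) + 2 * J (z n) - 4 * J ?h\<close>, where \<open>J ?h\<close> is at least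
        the infimum and the other two values nearly attain it.\<close>
      let ?h = "\<lambda>x. (1/2) *\<^sub>R (z m x + z n x)"
      have "d \<le> J ?h" by (intro d_le scale add z)
      moreover have "4 * J ?h = B (z m) (z m) + 2 * B (z m) (z n) + B (z n) (z n) - 4 * F (z m) - 4 * F (z n)"
        using z(1) B_sym[of "z n" "z m"]
        by (simp add: J_def F_scale F_add add scale B_add B_scale B_add_right B_scale_right field_simps)
      moreover have "B (\<lambda>x. z m x - z n x) (\<lambda>x. z m x - z n x) =
          B (z m) (z m) - 2 * B (z m) (z n) + B (z n) (z n)"
        using z(1) B_sym[of "z n" "z m"] by (simp add: B_diff B_diff_right diff)
      ultimately show ?thesis using z(2)[of m] z(2)[of n] unfolding J_def by simp
    qed
    fix w assume w: "w \<in> S"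
    \<comment> \<open>Near-minimality along the whole line through \<open>z n\<close> in direction
      \<open>w\<close> makes a quadratic in \<open>t\<close> nonnegative; its discriminant bounds
      the defect in the Euler equation.\<close>
    have est: "(B (z n) w - F w)\<^sup>2 \<le> (1 / Suc n) * B w w" for n
    proof (rule quadratic_nonneg_discriminant)
      fix t
      have "d \<le> J (\<lambda>x. z n x + t *\<^sub>R w x)" by (intro d_le scale add z w)
      also have "\<dots> = J (z n) + 2 * t * (B (z n) w - F w) + t\<^sup>2 * B w w"
        unfolding J_def B_line[OF z(1) w] by (simp add: F_add F_scale z w scale algebra_simps)
      finally show "0 \<le> 1 / real (Suc n) + 2 * t * (B (z n) w - F w) + t\<^sup>2 * B w w"
        using z(2)[of n] by simp
    qed
    have "(\<lambda>n. (1 / Suc n) * B w w) \<longlonglongrightarrow> 0"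
      by (rule tendsto_mult_left_zero, rule LIMSEQ_Suc[OF lim_1_over_n])
    then have "(\<lambda>n. (B (z n) w - F w)\<^sup>2) \<longlonglongrightarrow> 0"
      by (rule tendsto_sandwich[OF _ _ tendsto_const, rotated 2]) (use est in auto)
    then have "(\<lambda>n. B (z n) w - F w) \<longlonglongrightarrow> 0"
      using tendsto_real_sqrt[of "\<lambda>n. (B (z n) w - F w)\<^sup>2" 0] by (simp add: tendsto_rabs_zero_iff)
    then show "(\<lambda>n. B (z n) w) \<longlonglongrightarrow> F w" by (simp add: LIM_zero_iff)
  qed
qed

end

section \<open>Square integrable functions\<close>

text \<open>The measure and the Euclidean codomain stay free so that scalars, vector fields and
  pairs of a field and its divergence share one theory; the inner product of a product codomain then
  is the graph inner product.\<close>

definition sqint :: "'a measure \<Rightarrow> ('a \<Rightarrow> 'b::euclidean_space) set" where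
  "sqint M = {u \<in> borel_measurable M. integrable M (\<lambda>x. (norm (u x))\<^sup>2)}"

definition ip :: "'a measure \<Rightarrow> ('a \<Rightarrow> 'b::euclidean_space) \<Rightarrow> ('a \<Rightarrow> 'b) \<Rightarrow> real" where
  "ip M u v = integral\<^sup>L M (\<lambda>x. u x \<bullet> v x)"

lemma sqint_measurable [measurable_dest]: "u \<in> sqint M \<Longrightarrow> u \<in> borel_measurable M"
  by (simp add: sqint_def)

text \<open>Rests on \<open>(a + b)\<^sup>2 \<le> 2 * a\<^sup>2 + 2 * b\<^sup>2\<close>. Sums and
  images under linear maps both fit this bound, the latter with the zero function as second
  majorant.\<close>

lemma sqint_dominated:
  assumes "u \<in> sqint M" "v \<in> sqint M" "w \<in> borel_measurable M"
    and "\<And>x. norm (w x) \<le> c * (norm (u x) + norm (v x))"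
  shows "w \<in> sqint M"
proof -
  have "integrable M (\<lambda>x. 2 * c\<^sup>2 * ((norm (u x))\<^sup>2 + (norm (v x))\<^sup>2))"
    using assms by (simp add: sqint_def)
  then have "integrable M (\<lambda>x. (norm (w x))\<^sup>2)"
  proof (rule Bochner_Integration.integrable_bound)
    show "(\<lambda>x. (norm (w x))\<^sup>2) \<in> borel_measurable M" using assms(3) by measurable
    show "AE x in M. norm ((norm (w x))\<^sup>2) \<le> norm (2 * c\<^sup>2 * ((norm (u x))\<^sup>2 + (norm (v x))\<^sup>2))"
    proof (intro AE_I2)
      fix x
      have "(norm (w x))\<^sup>2 \<le> (c * (norm (u x) + norm (v x)))\<^sup>2" using assms(4) by (simp add: power_mono)
      also have "\<dots> \<le> c\<^sup>2 * (2 * ((norm (u x))\<^sup>2 + (norm (v x))\<^sup>2))"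
        unfolding power_mult_distrib
        using sum_squares_bound[of "norm (u x)" "norm (v x)"]
        by (intro mult_left_mono) (auto simp: power2_sum)
      finally show "norm ((norm (w x))\<^sup>2) \<le> norm (2 * c\<^sup>2 * ((norm (u x))\<^sup>2 + (norm (v x))\<^sup>2))"
        by (simp add: algebra_simps)
    qed
  qed
  then show ?thesis using assms(3) by (simp add: sqint_def)
qed

lemma sqint_zero [simp]: "(\<lambda>x. 0) \<in> sqint M"
  by (simp add: sqint_def)

lemma sqint_add: "u \<in> sqint M \<Longrightarrow> w \<in> sqint M \<Longrightarrow> (\<lambda>x. u x + w x) \<in> sqint M"
  by (rule sqint_dominated[where c = 1 and u = u and v = w]) (auto simp: sqint_measurable intro: norm_triangle_ineq)

lemma sqint_linear:
  assumes "bounded_linear T" "u \<in> sqint M"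
  shows "(\<lambda>x. T (u x)) \<in> sqint M"
proof -
  obtain c where c: "\<And>x. norm (T x) \<le> norm x * c" using bounded_linear.bounded[OF assms(1)] by blast
  have "(\<lambda>x. T (u x)) \<in> borel_measurable M"
    using borel_measurable_continuous_onI[OF linear_continuous_on[OF assms(1)]] assms(2) by measurable
  then show ?thesis
    by (rule sqint_dominated[OF assms(2) sqint_zero[where 'b='b], where c = c]) (use c in \<open>simp add: mult.commute\<close>)
qed

lemma sqint_scale: "u \<in> sqint M \<Longrightarrow> (\<lambda>x. c *\<^sub>R u x) \<in> sqint M"
  by (rule sqint_linear[OF bounded_linear_scaleR_right])

lemma sqint_diff: "u \<in> sqint M \<Longrightarrow> w \<in> sqint M \<Longrightarrow> (\<lambda>x. u x - w x) \<in> sqint M"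
  using sqint_add[OF _ sqint_scale[of w M "-1"], of u] by simp

lemma sqint_fst: "u \<in> sqint M \<Longrightarrow> (\<lambda>x. fst (u x)) \<in> sqint M"
  by (rule sqint_linear[OF bounded_linear_fst])

lemma sqint_snd: "u \<in> sqint M \<Longrightarrow> (\<lambda>x. snd (u x)) \<in> sqint M"
  by (rule sqint_linear[OF bounded_linear_snd])

lemma sqint_Pair: "u \<in> sqint M \<Longrightarrow> w \<in> sqint M \<Longrightarrow> (\<lambda>x. (u x, w x)) \<in> sqint M"
proof -
  assume uw: "u \<in> sqint M" "w \<in> sqint M"
  have "(\<lambda>x. (u x, 0) + (0, w x)) \<in> sqint M"
    by (intro sqint_add sqint_linear[OF _ uw(1)] sqint_linear[OF _ uw(2)])
      (auto intro!: bounded_linear_Pair bounded_linear_ident bounded_linear_zero)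
  then show ?thesis by simp
qed

lemma ip_integrable:
  assumes "u \<in> sqint M" "v \<in> sqint M"
  shows "integrable M (\<lambda>x. u x \<bullet> v x)"
proof (rule Bochner_Integration.integrable_bound)
  show "integrable M (\<lambda>x. (norm (u x))\<^sup>2 + (norm (v x))\<^sup>2)" using assms by (simp add: sqint_def)
  show "(\<lambda>x. u x \<bullet> v x) \<in> borel_measurable M" using assms by measurable
  show "AE x in M. norm (u x \<bullet> v x) \<le> norm ((norm (u x))\<^sup>2 + (norm (v x))\<^sup>2)"
  proof (intro AE_I2)
    fix x
    have "\<bar>u x \<bullet> v x\<bar> \<le> norm (u x) * norm (v x)" by (rule Cauchy_Schwarz_ineq2)
    moreover have "2 * (norm (u x) * norm (v x)) \<le> (norm (u x))\<^sup>2 + (norm (v x))\<^sup>2"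
      using sum_squares_bound[of "norm (u x)" "norm (v x)"] by simp
    moreover have "0 \<le> norm (u x) * norm (v x)" by simp
    ultimately show "norm (u x \<bullet> v x) \<le> norm ((norm (u x))\<^sup>2 + (norm (v x))\<^sup>2)" by simp
  qed
qed

lemma ip_commute: "ip M u v = ip M v u"
  by (simp add: ip_def inner_commute)

lemma ip_add: "u \<in> sqint M \<Longrightarrow> w \<in> sqint M \<Longrightarrow> z \<in> sqint M \<Longrightarrow>
    ip M (\<lambda>x. u x + w x) z = ip M u z + ip M w z"
  by (simp add: ip_def inner_add_left ip_integrable)

lemma ip_scale: "ip M (\<lambda>x. c *\<^sub>R u x) z = c * ip M u z"
  by (simp add: ip_def)

lemma ip_nonneg: "0 \<le> ip M u u"
  by (simp add: ip_def)

lemma semi_inner_L2: "semi_inner (sqint M) (ip M)"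
proof
  fix u w z :: "'a \<Rightarrow> 'b" and c :: real
  show "(\<lambda>x. 0 :: 'b) \<in> sqint M" by simp
  assume u: "u \<in> sqint M"
  show "(\<lambda>x. c *\<^sub>R u x) \<in> sqint M" using u by (rule sqint_scale)
  show "0 \<le> ip M u u" by (rule ip_nonneg)
  show "ip M (\<lambda>x. c *\<^sub>R u x) z = c * ip M u z" by (rule ip_scale)
  show "ip M u z = ip M z u" by (rule ip_commute)
  assume w: "w \<in> sqint M"
  show "(\<lambda>x. u x + w x) \<in> sqint M" using u w by (rule sqint_add)
  assume z: "z \<in> sqint M"
  show "ip M (\<lambda>x. u x + w x) z = ip M u z + ip M w z" using u w z by (rule ip_add)
qed

interpretation L2: semi_inner "sqint M" "ip M" for M :: "'a measure"
  by (rule semi_inner_L2)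

lemma ip_Pair:
  assumes "a \<in> sqint M" "b \<in> sqint M" "c \<in> sqint M" "d \<in> sqint M"
  shows "ip M (\<lambda>x. (a x, b x)) (\<lambda>x. (c x, d x)) = ip M a c + ip M b d"
  using assms by (simp add: ip_def ip_integrable)

lemma ip_self_eq_0_iff:
  assumes "u \<in> sqint M"
  shows "ip M u u = 0 \<longleftrightarrow> (AE x in M. u x = 0)"
  unfolding ip_def using integral_nonneg_eq_0_iff_AE[OF ip_integrable[OF assms assms]] by simp

lemma ip_cong_AE:
  assumes "AE x in M. u x = u' x" "AE x in M. v x = v' x"
    and "u \<in> borel_measurable M" "u' \<in> borel_measurable M" "v \<in> borel_measurable M" "v' \<in> borel_measurable M"
  shows "ip M u v = ip M u' v'"
  unfolding ip_def using assms by (intro integral_cong_AE) auto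

lemma L2_limit_ip:
  assumes "\<And>n. u n \<in> sqint M" "z \<in> sqint M" "w \<in> sqint M"
    and lim: "(\<lambda>n. ip M (\<lambda>x. u n x - z x) (\<lambda>x. u n x - z x)) \<longlonglongrightarrow> 0"
  shows "(\<lambda>n. ip M (u n) w) \<longlonglongrightarrow> ip M z w"
proof -
  have lim0: "(\<lambda>n. sqrt (ip M (\<lambda>x. u n x - z x) (\<lambda>x. u n x - z x)) * sqrt (ip M w w)) \<longlonglongrightarrow> 0"
    using tendsto_mult_left_zero[OF tendsto_real_sqrt[OF lim, simplified]] .
  have bound: "\<bar>ip M (u n) w - ip M z w\<bar> \<le>
      sqrt (ip M (\<lambda>x. u n x - z x) (\<lambda>x. u n x - z x)) * sqrt (ip M w w)" for n
    using L2.Cauchy_Schwarz_abs[OF L2.diff[OF assms(1)[of n] assms(2)] assms(3)]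
    by (simp add: L2.B_diff assms)
  have "(\<lambda>n. \<bar>ip M (u n) w - ip M z w\<bar>) \<longlonglongrightarrow> 0"
    by (rule tendsto_sandwich[OF _ _ tendsto_const lim0]) (use bound in auto)
  then show ?thesis by (simp add: tendsto_rabs_zero_iff LIM_zero_iff)
qed

text \<open>The Riesz-Fischer argument: a fast subsequence converges almost everywhere, and Fatou's
  lemma along it estimates the distance of every late member to the limit.\<close>

lemma L2_complete:
  fixes u :: "nat \<Rightarrow> 'a \<Rightarrow> 'b::euclidean_space"
  assumes u: "\<And>n. u n \<in> sqint M"
    and Cauchy: "\<And>e. e > 0 \<Longrightarrow> \<exists>N. \<forall>m\<ge>N. \<forall>n\<ge>N. ip M (\<lambda>x. u m x - u n x) (\<lambda>x. u m x - u n x) < e"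
  obtains z where "z \<in> sqint M" "(\<lambda>n. ip M (\<lambda>x. u n x - z x) (\<lambda>x. u n x - z x)) \<longlonglongrightarrow> 0"
proof -
  have [measurable]: "u n \<in> borel_measurable M" for n using u by (rule sqint_measurable)
  have sq: "ip M (\<lambda>x. u m x - u n x) (\<lambda>x. u m x - u n x) = (\<integral>x. (norm (u m x - u n x))\<^sup>2 \<partial>M)" for m n
    by (simp add: ip_def power2_norm_eq_inner)
  have int: "integrable M (\<lambda>x. (norm (u m x - u n x))\<^sup>2)" for m n
    using sqint_diff[OF u u, of m n] by (simp add: sqint_def)
  have "\<forall>k. \<exists>N. \<forall>m\<ge>N. \<forall>n\<ge>N. ip M (\<lambda>x. u m x - u n x) (\<lambda>x. u m x - u n x) < (1/8)^k"
    using Cauchy by simp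
  then obtain N where N: "\<And>k m n. m \<ge> N k \<Longrightarrow> n \<ge> N k \<Longrightarrow>
      ip M (\<lambda>x. u m x - u n x) (\<lambda>x. u m x - u n x) < (1/8)^k" by metis
  \<comment> \<open>Partial sums dominate each \<open>N k\<close> and make the indices monotone at
    the same time.\<close>
  define r where "r k = (\<Sum>i\<le>k. N i)" for k
  have r_ge: "N k \<le> r k" for k unfolding r_def by (rule member_le_sum) auto
  have r_mono: "r j \<le> r k" if "j \<le> k" for j k
    unfolding r_def using that by (intro sum_mono2) auto
  have nn: "(\<integral>\<^sup>+x. ennreal ((norm (u m x - u n x))\<^sup>2) \<partial>M) \<le> ennreal ((1/8)^k)"
    if "m \<ge> r k" "n \<ge> r k" for m n k
    using N[of k m n] that r_ge[of k]
    by (simp add: nn_integral_eq_integral[OF int] sq ennreal_leI)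
  \<comment> \<open>The squared increments integrate to at most \<open>(1/8)^k\<close>. The weight
    \<open>2^k\<close> still leaves the summable \<open>(1/4)^k\<close>, and it is what turns
    summable squares into summable increments at a point.\<close>
  define d where "d k x = norm (u (r (Suc k)) x - u (r k) x)" for k x
  have [measurable]: "d k \<in> borel_measurable M" for k unfolding d_def by measurable
  have "(\<integral>\<^sup>+x. (\<Sum>k. ennreal (2^k * (d k x)\<^sup>2)) \<partial>M) = (\<Sum>k. \<integral>\<^sup>+x. ennreal (2^k * (d k x)\<^sup>2) \<partial>M)"
    by (rule nn_integral_suminf) measurable
  also have "\<dots> \<le> (\<Sum>k. ennreal ((1/4)^k))"
  proof (intro suminf_le)
    fix k
    have "(\<integral>\<^sup>+x. ennreal (2^k * (d k x)\<^sup>2) \<partial>M) = ennreal (2^k) * (\<integral>\<^sup>+x. ennreal ((d k x)\<^sup>2) \<partial>M)"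
      by (subst nn_integral_cmult[symmetric]) (auto simp: ennreal_mult)
    also have "\<dots> \<le> ennreal (2^k) * ennreal ((1/8)^k)"
      unfolding d_def by (intro mult_left_mono nn r_mono) auto
    also have "\<dots> = ennreal ((1/4)^k)"
      by (simp add: ennreal_mult[symmetric] power_mult_distrib[symmetric])
    finally show "(\<integral>\<^sup>+x. ennreal (2^k * (d k x)\<^sup>2) \<partial>M) \<le> ennreal ((1/4)^k)" .
  qed auto
  also have "\<dots> < \<infinity>"
    by (subst suminf_ennreal2) (auto simp: summable_geometric)
  finally have fin: "AE x in M. (\<Sum>k. ennreal (2^k * (d k x)\<^sup>2)) \<noteq> \<infinity>"
    by (intro nn_integral_PInf_AE) auto
  define z where "z x = lim (\<lambda>k. u (r k) x)" for x
  have [measurable]: "z \<in> borel_measurable M" unfolding z_def by (rule borel_measurable_lim_metric) measurable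
  have conv: "AE x in M. (\<lambda>k. u (r k) x) \<longlonglongrightarrow> z x"
    using fin
  proof eventually_elim
    case (elim x)
    have "summable (\<lambda>k. 2^k * (d k x)\<^sup>2)"
      by (rule summable_suminf_not_top) (use elim in auto)
    then have "summable (\<lambda>k. (1/2)^k + 2^k * (d k x)\<^sup>2)"
      by (intro summable_add summable_geometric) auto
    \<comment> \<open>Weighted Young inequality:
      \<open>2 * d k x \<le> (1/2)^k + 2^k * (d k x)\<^sup>2\<close>.\<close>
    then have "summable (\<lambda>k. d k x)"
    proof (rule summable_comparison_test[rotated], intro exI allI impI)
      fix k
      have "(1/2::real)^k * 2^k = 1" by (simp add: power_mult_distrib[symmetric])
      moreover have "0 \<le> 2^k * ((d k x) - (1/2)^k)\<^sup>2" by simp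
      moreover have "d k x \<ge> 0" by (simp add: d_def)
      moreover have "2^k * ((d k x) - (1/2)^k)\<^sup>2 =
          2^k * (d k x)\<^sup>2 - 2 * d k x * ((1/2)^k * 2^k) + (1/2)^k * ((1/2)^k * 2^k)"
        by (simp add: power2_eq_square algebra_simps)
      ultimately show "norm (d k x) \<le> (1/2)^k + 2^k * (d k x)\<^sup>2" by simp
    qed
    then have "summable (\<lambda>k. u (r (Suc k)) x - u (r k) x)"
      unfolding d_def by (rule summable_norm_cancel)
    then have "convergent (\<lambda>n. \<Sum>k<n. u (r (Suc k)) x - u (r k) x)"
      by (simp add: summable_iff_convergent)
    then have "convergent (\<lambda>n. u (r n) x - u (r 0) x)"
      by (simp add: sum_lessThan_telescope[of "\<lambda>k. u (r k) x"])
    then have "convergent (\<lambda>n. u (r n) x)"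
      by (simp add: convergent_diff_const_right_iff)
    then show ?case unfolding z_def by (simp add: convergent_LIMSEQ_iff)
  qed
  \<comment> \<open>Fatou along the subsequence: the integrand is the limit of distances to its
    members, whose integrals are already bounded.\<close>
  have est: "(\<integral>\<^sup>+x. ennreal ((norm (u n x - z x))\<^sup>2) \<partial>M) \<le> ennreal ((1/8)^j)" if n: "n \<ge> r j" for n j
  proof -
    have "(\<integral>\<^sup>+x. ennreal ((norm (u n x - z x))\<^sup>2) \<partial>M) =
        (\<integral>\<^sup>+x. liminf (\<lambda>k. ennreal ((norm (u n x - u (r k) x))\<^sup>2)) \<partial>M)"
    proof (intro nn_integral_cong_AE, use conv in eventually_elim)
      case (elim x)
      have "(\<lambda>k. ennreal ((norm (u n x - u (r k) x))\<^sup>2)) \<longlonglongrightarrow> ennreal ((norm (u n x - z x))\<^sup>2)"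
        using elim by (intro tendsto_intros)
      then show ?case by (rule lim_imp_Liminf[OF trivial_limit_sequentially, symmetric])
    qed
    also have "\<dots> \<le> liminf (\<lambda>k. \<integral>\<^sup>+x. ennreal ((norm (u n x - u (r k) x))\<^sup>2) \<partial>M)"
      by (rule nn_integral_liminf) measurable
    also have "\<dots> \<le> liminf (\<lambda>k::nat. ennreal ((1/8)^j))"
      by (intro Liminf_mono eventually_sequentiallyI[of j] nn n r_mono)
    finally show ?thesis by (simp add: Liminf_const)
  qed
  have uz: "(\<lambda>x. u n x - z x) \<in> sqint M" if "n \<ge> r j" for n j
    using est[OF that] le_less_trans[OF est[OF that] ennreal_less_top] by (simp add: sqint_def integrable_iff_bounded)
  have "(\<lambda>x. u (r 0) x - (u (r 0) x - z x)) \<in> sqint M"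
    by (intro sqint_diff u uz[of 0]) simp
  then have z: "z \<in> sqint M" by simp
  have est': "ip M (\<lambda>x. u n x - z x) (\<lambda>x. u n x - z x) \<le> (1/8)^j" if "n \<ge> r j" for n j
    using est[OF that] nn_integral_eq_integral[of M "\<lambda>x. (norm (u n x - z x))\<^sup>2"] uz[OF that]
    by (simp add: ip_def sqint_def power2_norm_eq_inner)
  have "(\<lambda>n. ip M (\<lambda>x. u n x - z x) (\<lambda>x. u n x - z x)) \<longlonglongrightarrow> 0"
  proof (rule LIMSEQ_I)
    fix e :: real assume "e > 0"
    then obtain j where j: "(1/8)^j < e" using real_arch_pow_inv[of e "1/8"] by auto
    show "\<exists>no. \<forall>n\<ge>no. norm (ip M (\<lambda>x. u n x - z x) (\<lambda>x. u n x - z x) - 0) < e"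
      using est' j by (intro exI[of _ "r j"]) (force simp: ip_nonneg intro: le_less_trans)
  qed
  then show thesis using z that by blast
qed

text \<open>\<open>K\<close> is an arbitrary set of tests. Orthogonality to it passes to weak
  limits, which stands in for closedness without any topology on the functions.\<close>

definition orth :: "'a measure \<Rightarrow> ('a \<Rightarrow> 'b::euclidean_space) set \<Rightarrow> ('a \<Rightarrow> 'b) set" where
  "orth M K = {p \<in> sqint M. \<forall>k\<in>K. ip M p k = 0}"

lemma semi_inner_orth:
  assumes K: "K \<subseteq> sqint M" and T: "bounded_linear T"
    and sym: "\<And>a b. T a \<bullet> b = a \<bullet> T b" and nonneg: "\<And>a. 0 \<le> T a \<bullet> a"
  shows "semi_inner (orth M K) (\<lambda>p q. ip M (\<lambda>x. T (p x)) q)"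
proof
  show "(\<lambda>x. 0) \<in> orth M K" by (simp add: orth_def ip_def)
  show "(\<lambda>x. u x + w x) \<in> orth M K" if "u \<in> orth M K" "w \<in> orth M K" for u w
    using that K by (auto simp: orth_def sqint_add ip_add subset_iff)
  show "(\<lambda>x. c *\<^sub>R u x) \<in> orth M K" if "u \<in> orth M K" for u c
    using that by (auto simp: orth_def sqint_scale ip_scale)
  interpret T: bounded_linear T by (rule T)
  show "ip M (\<lambda>x. T (u x + w x)) z = ip M (\<lambda>x. T (u x)) z + ip M (\<lambda>x. T (w x)) z"
    if "u \<in> orth M K" "w \<in> orth M K" "z \<in> orth M K" for u w z
    using that by (simp add: T.add ip_add sqint_linear[OF T] orth_def)
  show "ip M (\<lambda>x. T (c *\<^sub>R u x)) z = c * ip M (\<lambda>x. T (u x)) z" for c u z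
    by (simp add: T.scaleR ip_scale)
  show "ip M (\<lambda>x. T (u x)) z = ip M (\<lambda>x. T (z x)) u" for u z
  proof -
    have "T (u x) \<bullet> z x = T (z x) \<bullet> u x" for x
      using sym[of "u x" "z x"] inner_commute[of "u x" "T (z x)"] by simp
    then show ?thesis by (simp add: ip_def)
  qed
  show "0 \<le> ip M (\<lambda>x. T (u x)) u" for u
    by (simp add: ip_def nonneg)
qed

text \<open>Lax-Milgram for a symmetric form given by a constant matrix \<open>T\<close>. Minimizing
  sequences are Cauchy in the energy, coercivity makes them Cauchy in L2, and constraint and
  equation both survive the limit because \<open>T\<close> can be moved to the other
  argument.\<close>

lemma Riesz_orth:
  fixes K :: "('a \<Rightarrow> 'b::euclidean_space) set"
  assumes K: "K \<subseteq> sqint M" and T: "bounded_linear T"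
    and sym: "\<And>a b. T a \<bullet> b = a \<bullet> T b" and nonneg: "\<And>a. 0 \<le> T a \<bullet> a"
    and coercive: "\<And>p. p \<in> orth M K \<Longrightarrow> ip M p p \<le> \<kappa> * ip M (\<lambda>x. T (p x)) p"
    and F_add: "\<And>u w. u \<in> orth M K \<Longrightarrow> w \<in> orth M K \<Longrightarrow> F (\<lambda>x. u x + w x) = F u + F w"
    and F_scale: "\<And>u c. u \<in> orth M K \<Longrightarrow> F (\<lambda>x. c *\<^sub>R u x) = c * F u"
    and F_bound: "\<And>u. u \<in> orth M K \<Longrightarrow> \<bar>F u\<bar> \<le> C * sqrt (ip M u u)"
  obtains z where "z \<in> orth M K" "\<And>p. p \<in> orth M K \<Longrightarrow> ip M (\<lambda>x. T (z x)) p = F p"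
proof -
  interpret semi_inner "orth M K" "\<lambda>p q. ip M (\<lambda>x. T (p x)) q"
    by (rule semi_inner_orth[OF K T sym nonneg])
  have orth_sq: "p \<in> sqint M" if "p \<in> orth M K" for p using that by (simp add: orth_def)
  have F_bound': "\<bar>F u\<bar> \<le> (\<bar>C\<bar> * sqrt \<bar>\<kappa>\<bar>) * sqrt (ip M (\<lambda>x. T (u x)) u)" if u: "u \<in> orth M K" for u
  proof -
    have "\<bar>F u\<bar> \<le> \<bar>C\<bar> * sqrt (ip M u u)"
      using F_bound[OF u] mult_right_mono[OF abs_ge_self[of C], of "sqrt (ip M u u)"] by (simp add: ip_nonneg)
    also have "\<dots> \<le> \<bar>C\<bar> * sqrt (\<bar>\<kappa>\<bar> * ip M (\<lambda>x. T (u x)) u)"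
      using coercive[OF u] mult_right_mono[OF abs_ge_self[of \<kappa>] B_nonneg[OF u]]
      by (intro mult_left_mono real_sqrt_le_mono) auto
    finally show ?thesis by (simp add: real_sqrt_mult)
  qed
  obtain w where w: "\<And>n. w n \<in> orth M K"
    and Cau: "\<And>m n. ip M (\<lambda>x. T (w m x - w n x)) (\<lambda>x. w m x - w n x) \<le> 2 / Suc m + 2 / Suc n"
    and lim: "\<And>q. q \<in> orth M K \<Longrightarrow> (\<lambda>n. ip M (\<lambda>x. T (w n x)) q) \<longlonglongrightarrow> F q"
    using Riesz_sequence[of F, OF F_add F_scale F_bound'] by blast
  have "\<exists>N. \<forall>m\<ge>N. \<forall>n\<ge>N. ip M (\<lambda>x. w m x - w n x) (\<lambda>x. w m x - w n x) < e" if "e > 0" for e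
  proof -
    \<comment> \<open>\<open>2 / Suc m + 2 / Suc n\<close> is at most \<open>4 / Suc N\<close>;
      adding 1 to \<open>\<bar>\<kappa>\<bar>\<close> keeps the divisor positive.\<close>
    have "0 < e / (4 * (\<bar>\<kappa>\<bar> + 1))" using that by (intro divide_pos_pos) auto
    then obtain N where N: "inverse (real (Suc N)) < e / (4 * (\<bar>\<kappa>\<bar> + 1))"
      using reals_Archimedean by blast
    have "ip M (\<lambda>x. w m x - w n x) (\<lambda>x. w m x - w n x) < e" if "m \<ge> N" "n \<ge> N" for m n
    proof -
      have le: "2 / real (Suc k) \<le> 2 * inverse (real (Suc N))" if "k \<ge> N" for k
        using that by (simp add: divide_inverse)
      have "ip M (\<lambda>x. w m x - w n x) (\<lambda>x. w m x - w n x) \<le>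
          \<kappa> * ip M (\<lambda>x. T (w m x - w n x)) (\<lambda>x. w m x - w n x)"
        by (intro coercive diff w)
      also have "\<dots> \<le> (\<bar>\<kappa>\<bar> + 1) * ip M (\<lambda>x. T (w m x - w n x)) (\<lambda>x. w m x - w n x)"
        by (intro mult_right_mono B_nonneg diff w) simp
      also have "\<dots> \<le> (\<bar>\<kappa>\<bar> + 1) * (4 * inverse (real (Suc N)))"
        using Cau[of m n] le[of m] le[of n] that by (intro mult_left_mono) auto
      also have "\<dots> < e" using N by (simp add: field_simps)
      finally show ?thesis .
    qed
    then show ?thesis by blast
  qed
  then obtain z where z: "z \<in> sqint M"
    and wz: "(\<lambda>n. ip M (\<lambda>x. w n x - z x) (\<lambda>x. w n x - z x)) \<longlonglongrightarrow> 0"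
    using L2_complete[of w M] orth_sq[OF w] by blast
  have lim_ip: "(\<lambda>n. ip M (w n) q) \<longlonglongrightarrow> ip M z q" if "q \<in> sqint M" for q
    by (rule L2_limit_ip[OF orth_sq[OF w] z that wz])
  show thesis
  proof
    have "ip M z k = 0" if "k \<in> K" for k
      using lim_ip[of k] K that w by (auto simp: orth_def LIMSEQ_const_iff)
    then show "z \<in> orth M K" using z by (simp add: orth_def)
    fix p assume p: "p \<in> orth M K"
    have T_ip: "ip M (\<lambda>x. T (q x)) p = ip M q (\<lambda>x. T (p x))" for q by (simp add: ip_def sym)
    have "(\<lambda>n. ip M (w n) (\<lambda>x. T (p x))) \<longlonglongrightarrow> F p"
      using lim[OF p] by (simp add: T_ip)
    then show "ip M (\<lambda>x. T (z x)) p = F p"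
      using lim_ip[OF sqint_linear[OF T orth_sq[OF p]]] LIMSEQ_unique by (auto simp: T_ip)
  qed
qed

section \<open>The saddle-point problem for a closed operator\<close>

text \<open>\<open>orth M K\<close> plays the role of the graph of the divergence on its domain.\<close>

locale saddle =
  fixes M :: "'a measure" and K :: "('a \<Rightarrow> 'e::euclidean_space \<times> real) set" and c0 c1 :: real
  assumes K: "K \<subseteq> sqint M" and c0: "c0 \<ge> 0" and c1: "c1 \<ge> 0"
    and stable: "c1 > 0 \<or>
      (\<exists>C. \<forall>u\<in>sqint M. \<exists>\<beta>. (\<lambda>x. (\<beta> x, u x)) \<in> orth M K \<and> ip M \<beta> \<beta> \<le> C * ip M u u)"
begin

definition graph :: "('a \<Rightarrow> 'e) \<Rightarrow> ('a \<Rightarrow> real) \<Rightarrow> bool" where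
  "graph v g \<longleftrightarrow> (\<lambda>x. (v x, g x)) \<in> orth M K"

text \<open>The divergences of \<open>v\<close> and \<open>\<alpha>\<close> are separate data
  \<open>g\<close> and \<open>\<gamma>\<close>, tied to their fields only by \<open>graph\<close>;
  no representative has to be chosen here.\<close>

definition solution where
  "solution F u v g \<alpha> \<gamma> \<longleftrightarrow> u \<in> sqint M \<and> graph v g \<and> graph \<alpha> \<gamma> \<and>
     (\<forall>\<phi>\<in>sqint M. \<forall>\<psi> \<delta>. graph \<psi> \<delta> \<longrightarrow>
        c0 * ip M v \<psi> + ip M g \<delta> + c1 * ip M u \<phi> + (ip M \<alpha> \<psi> + ip M \<gamma> \<phi>) = F \<phi>) \<and>
     (\<forall>\<beta> \<delta>. graph \<beta> \<delta> \<longrightarrow> ip M v \<beta> + ip M u \<delta> = 0)"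

lemma graph_sqint:
  assumes "graph v g"
  shows "v \<in> sqint M" "g \<in> sqint M"
  using assms sqint_fst[of "\<lambda>x. (v x, g x)" M] sqint_snd[of "\<lambda>x. (v x, g x)" M]
  by (simp_all add: graph_def orth_def)

lemma graph_diff:
  assumes "graph v g" "graph w h"
  shows "graph (\<lambda>x. v x - w x) (\<lambda>x. g x - h x)"
proof -
  interpret semi_inner "orth M K" "\<lambda>p q. ip M (\<lambda>x. p x) q"
    using semi_inner_orth[OF K bounded_linear_ident] by simp
  show ?thesis using diff[of "\<lambda>x. (v x, g x)" "\<lambda>x. (w x, h x)"] assms by (simp add: graph_def)
qed

text \<open>Taking \<open>\<beta> = v\<close> in the kernel condition shows that the square of
  \<open>v\<close> is minus the pairing of \<open>u\<close> with \<open>g\<close>, so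
  \<open>v\<close> is controlled even where \<open>c0\<close> vanishes. For \<open>c1 > 0\<close>
  Young's inequality finishes. Otherwise a field with divergence \<open>u\<close> bounds
  \<open>u\<close> by \<open>v\<close>, and the two bounds are chained.\<close>

lemma coercive:
  obtains \<kappa> where "\<kappa> \<ge> 0" "\<And>u v g. u \<in> sqint M \<Longrightarrow> graph v g \<Longrightarrow>
      (\<And>\<beta> \<delta>. graph \<beta> \<delta> \<Longrightarrow> ip M v \<beta> + ip M u \<delta> = 0) \<Longrightarrow>
      ip M u u + ip M v v + ip M g g \<le> \<kappa> * (c1 * ip M u u + c0 * ip M v v + ip M g g)"
  using stable
proof
  assume pos: "c1 > 0"
  show thesis
  proof (rule that)
    show "0 \<le> 2 * (1 + 1 / c1)" using pos by simp
    fix u v g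
    assume u: "u \<in> sqint M" and vg: "graph v g"
      and ker: "\<And>\<beta> \<delta>. graph \<beta> \<delta> \<Longrightarrow> ip M v \<beta> + ip M u \<delta> = 0"
    note v = graph_sqint[OF vg]
    have "0 \<le> ip M u u + 2 * ip M u g + ip M g g"
      using L2.B_nonneg[OF L2.add[OF u v(2)]] L2.B_line[OF u v(2), of 1] by simp
    then have "ip M u u + ip M v v + ip M g g \<le> 2 * (ip M u u + ip M g g)"
      using ker[OF vg] ip_nonneg[of M u] ip_nonneg[of M g] by simp
    also have "\<dots> \<le> 2 * (1 + 1 / c1) * (c1 * ip M u u + ip M g g)"
      using pos by (simp add: field_simps ip_nonneg)
    also have "\<dots> \<le> 2 * (1 + 1 / c1) * (c1 * ip M u u + c0 * ip M v v + ip M g g)"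
      using pos c0 by (intro mult_left_mono) (auto simp: ip_nonneg)
    finally show "ip M u u + ip M v v + ip M g g \<le>
        2 * (1 + 1 / c1) * (c1 * ip M u u + c0 * ip M v v + ip M g g)" .
  qed
next
  assume "\<exists>C. \<forall>u\<in>sqint M. \<exists>\<beta>. (\<lambda>x. (\<beta> x, u x)) \<in> orth M K \<and> ip M \<beta> \<beta> \<le> C * ip M u u"
  then obtain C' where C': "\<And>u. u \<in> sqint M \<Longrightarrow> \<exists>\<beta>. graph \<beta> u \<and> ip M \<beta> \<beta> \<le> C' * ip M u u"
    unfolding graph_def by blast
  define C where "C = \<bar>C'\<bar>"
  show thesis
  proof (rule that)
    \<comment> \<open>The summands \<open>C\<^sup>2\<close>, \<open>C\<close> and 1 are the bounds
      for \<open>u\<close>, \<open>v\<close> and \<open>g\<close> in terms of the square of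
      \<open>g\<close>.\<close>
    show "0 \<le> C\<^sup>2 + C + 1" by (simp add: C_def)
    fix u v g
    assume u: "u \<in> sqint M" and vg: "graph v g"
      and ker: "\<And>\<beta> \<delta>. graph \<beta> \<delta> \<Longrightarrow> ip M v \<beta> + ip M u \<delta> = 0"
    define a b d where "a = ip M u u" "b = ip M v v" "d = ip M g g"
    have nn: "a \<ge> 0" "b \<ge> 0" "d \<ge> 0" "C \<ge> 0" by (auto simp: a_b_d_def ip_nonneg C_def)
    note v = graph_sqint[OF vg]
    obtain \<beta> where \<beta>: "graph \<beta> u" and "ip M \<beta> \<beta> \<le> C' * a"
      using C'[OF u] by (auto simp: a_b_d_def)
    moreover have "C' * a \<le> C * a" using nn by (simp add: C_def mult_right_mono)
    ultimately have \<beta>_le: "ip M \<beta> \<beta> \<le> C * a" by simp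
    \<comment> \<open>Testing the kernel condition with a field of divergence \<open>u\<close>
      recovers the square of \<open>u\<close>; Cauchy-Schwarz then lets one factor cancel.\<close>
    have "a = - ip M v \<beta>" using ker[OF \<beta>] by (simp add: a_b_d_def)
    then have "a\<^sup>2 \<le> b * ip M \<beta> \<beta>"
      using L2.Cauchy_Schwarz[OF v(1) graph_sqint(1)[OF \<beta>]] by (simp add: a_b_d_def)
    also have "\<dots> \<le> b * (C * a)" using \<beta>_le nn by (intro mult_left_mono)
    finally have "a * a \<le> (C * b) * a" by (simp add: power2_eq_square mult_ac)
    then have ab: "a \<le> C * b" using nn by (cases "a = 0") (auto simp: mult_le_cancel_right)
    have "b = - ip M u g" using ker[OF vg] by (simp add: a_b_d_def)
    then have "b\<^sup>2 \<le> a * d"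
      using L2.Cauchy_Schwarz[OF u v(2)] by (simp add: a_b_d_def)
    also have "\<dots> \<le> (C * b) * d" using ab nn by (intro mult_right_mono)
    finally have "b * b \<le> (C * d) * b" by (simp add: power2_eq_square mult_ac)
    then have bd: "b \<le> C * d" using nn by (cases "b = 0") (auto simp: mult_le_cancel_right)
    have "C * b \<le> C\<^sup>2 * d" using mult_left_mono[OF bd nn(4)] by (simp add: power2_eq_square mult_ac)
    then have "a + b + d \<le> (C\<^sup>2 + C + 1) * d" using ab bd by (simp add: algebra_simps)
    also have "\<dots> \<le> (C\<^sup>2 + C + 1) * (c1 * a + c0 * b + d)"
      using nn c0 c1 by (intro mult_left_mono) auto
    finally show "ip M u u + ip M v v + ip M g g \<le>
        (C\<^sup>2 + C + 1) * (c1 * ip M u u + c0 * ip M v v + ip M g g)" by (simp add: a_b_d_def)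
  qed
qed

text \<open>The constraints defining the kernel of the form \<open>b\<close>, as a set of test functions.\<close>

definition kernel_tests :: "('a \<Rightarrow> real \<times> 'e \<times> real) set" where
  "kernel_tests = (\<lambda>k x. (0, k x)) ` K \<union> (\<lambda>q x. (snd (q x), (fst (q x), 0))) ` orth M K"

lemma kernel_tests_sqint: "kernel_tests \<subseteq> sqint M"
  unfolding kernel_tests_def using K
  by (auto intro!: sqint_Pair sqint_fst sqint_snd simp: orth_def)


text \<open>Pairing with \<open>(0, k)\<close> puts \<open>(v, g)\<close> into the graph. Pairing
  \<open>(u, v, g)\<close> with a graph element rearranged as \<open>(\<delta>, \<beta>, 0)\<close>
  reproduces the form b. The kernel of b is thus an \<open>orth\<close> set, and
  \<open>Riesz_orth\<close> applies to it.\<close>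

lemma orth_kernel_tests:
  "p \<in> orth M kernel_tests \<longleftrightarrow>
     (\<lambda>x. fst (p x)) \<in> sqint M \<and> graph (\<lambda>x. fst (snd (p x))) (\<lambda>x. snd (snd (p x))) \<and>
     (\<forall>\<beta> \<delta>. graph \<beta> \<delta> \<longrightarrow> ip M (\<lambda>x. fst (snd (p x))) \<beta> + ip M (\<lambda>x. fst (p x)) \<delta> = 0)"
  (is "_ \<longleftrightarrow> ?R")
proof -
  have sq: "p \<in> sqint M \<longleftrightarrow> (\<lambda>x. fst (p x)) \<in> sqint M \<and> (\<lambda>x. snd (p x)) \<in> sqint M"
    using sqint_fst[of p M] sqint_snd[of p M] sqint_Pair[of "\<lambda>x. fst (p x)" M "\<lambda>x. snd (p x)"] by auto
  have 1: "ip M p (\<lambda>x. (0, k x)) = ip M (\<lambda>x. snd (p x)) k" if "p \<in> sqint M" for k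
    by (simp add: ip_def inner_prod_def)
  have 2: "ip M p (\<lambda>x. (snd (q x), (fst (q x), 0))) =
      ip M (\<lambda>x. fst (snd (p x))) (\<lambda>x. fst (q x)) + ip M (\<lambda>x. fst (p x)) (\<lambda>x. snd (q x))"
    if "p \<in> sqint M" "q \<in> orth M K" for q
  proof -
    have "(\<lambda>x. fst (q x)) \<in> sqint M" "(\<lambda>x. snd (q x)) \<in> sqint M"
      using that by (auto simp: orth_def intro: sqint_fst sqint_snd)
    moreover have "(\<lambda>x. fst (snd (p x))) \<in> sqint M" "(\<lambda>x. fst (p x)) \<in> sqint M"
      using that by (auto intro: sqint_fst sqint_snd)
    ultimately show ?thesis
      using ip_integrable[of "\<lambda>x. fst (p x)" M "\<lambda>x. snd (q x)"]
        ip_integrable[of "\<lambda>x. fst (snd (p x))" M "\<lambda>x. fst (q x)"]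
      by (simp add: ip_def inner_prod_def)
  qed
  have pairs: "(\<forall>q\<in>orth M K. P (\<lambda>x. fst (q x)) (\<lambda>x. snd (q x))) \<longleftrightarrow> (\<forall>\<beta> \<delta>. graph \<beta> \<delta> \<longrightarrow> P \<beta> \<delta>)" for P
  proof
    assume l: "\<forall>q\<in>orth M K. P (\<lambda>x. fst (q x)) (\<lambda>x. snd (q x))"
    show "\<forall>\<beta> \<delta>. graph \<beta> \<delta> \<longrightarrow> P \<beta> \<delta>"
      unfolding graph_def using l by fastforce
  next
    assume "\<forall>\<beta> \<delta>. graph \<beta> \<delta> \<longrightarrow> P \<beta> \<delta>"
    then show "\<forall>q\<in>orth M K. P (\<lambda>x. fst (q x)) (\<lambda>x. snd (q x))"
      unfolding graph_def by simp
  qed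
  have graph: "graph (\<lambda>x. fst (snd (p x))) (\<lambda>x. snd (snd (p x))) \<longleftrightarrow> (\<lambda>x. snd (p x)) \<in> orth M K"
    by (simp add: graph_def)
  have "p \<in> orth M kernel_tests \<longleftrightarrow> p \<in> sqint M \<and> (\<forall>k\<in>kernel_tests. ip M p k = 0)"
    by (simp add: orth_def)
  also have "\<dots> \<longleftrightarrow> p \<in> sqint M \<and> (\<forall>k\<in>K. ip M (\<lambda>x. snd (p x)) k = 0) \<and>
     (\<forall>q\<in>orth M K. ip M (\<lambda>x. fst (snd (p x))) (\<lambda>x. fst (q x)) + ip M (\<lambda>x. fst (p x)) (\<lambda>x. snd (q x)) = 0)"
    using 1 2 by (auto simp: kernel_tests_def ball_Un)
  also have "\<dots> \<longleftrightarrow> ?R"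
    unfolding graph pairs[symmetric] by (auto simp: sq orth_def)
  finally show ?thesis .
qed

text \<open>Two tests of the difference: with \<open>(U, V)\<close> the multiplier terms cancel by
  the second equation and coercivity applies; with \<open>(D, A)\<close>, the multiplier preceded by
  its own divergence, only the graph norm of the multiplier is left.\<close>

lemma solution_unique:
  assumes s: "solution F u v g \<alpha> \<gamma>" and s': "solution F u' v' g' \<alpha>' \<gamma>'"
  shows "AE x in M. u' x = u x" "AE x in M. v' x = v x" "AE x in M. \<alpha>' x = \<alpha> x"
proof -
  define U V G A D where "U = (\<lambda>x. u' x - u x)" "V = (\<lambda>x. v' x - v x)" "G = (\<lambda>x. g' x - g x)"
    "A = (\<lambda>x. \<alpha>' x - \<alpha> x)" "D = (\<lambda>x. \<gamma>' x - \<gamma> x)"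
  note defs = U_V_G_A_D_def
  have u: "u \<in> sqint M" "u' \<in> sqint M" and gr: "graph v g" "graph v' g'" "graph \<alpha> \<gamma>" "graph \<alpha>' \<gamma>'"
    using s s' by (auto simp: solution_def)
  note sq = u gr[THEN graph_sqint(1)] gr[THEN graph_sqint(2)]
  have U: "U \<in> sqint M" using u by (simp add: defs L2.diff)
  have VG: "graph V G" and AD: "graph A D" using gr by (auto simp: defs graph_diff)
  have eq1: "c0 * ip M V \<psi> + ip M G \<delta> + c1 * ip M U \<phi> + (ip M A \<psi> + ip M D \<phi>) = 0"
    if "\<phi> \<in> sqint M" "graph \<psi> \<delta>" for \<phi> \<psi> \<delta>
  proof -
    have "c0 * ip M v \<psi> + ip M g \<delta> + c1 * ip M u \<phi> + (ip M \<alpha> \<psi> + ip M \<gamma> \<phi>) =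
        c0 * ip M v' \<psi> + ip M g' \<delta> + c1 * ip M u' \<phi> + (ip M \<alpha>' \<psi> + ip M \<gamma>' \<phi>)"
      using s s' that by (simp add: solution_def)
    then show ?thesis
      using that sq graph_sqint[OF that(2)] by (simp add: defs L2.B_diff algebra_simps)
  qed
  have eq2: "ip M V \<beta> + ip M U \<delta> = 0" if "graph \<beta> \<delta>" for \<beta> \<delta>
  proof -
    have "ip M v \<beta> + ip M u \<delta> = ip M v' \<beta> + ip M u' \<delta>"
      using s s' that by (simp add: solution_def)
    then show ?thesis
      using that sq graph_sqint[OF that] by (simp add: defs L2.B_diff algebra_simps)
  qed
  have "c1 * ip M U U + c0 * ip M V V + ip M G G = 0"
    using eq1[OF U VG] eq2[OF AD] by (simp add: ip_commute[of M A] ip_commute[of M D])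
  then have "ip M U U + ip M V V + ip M G G \<le> 0"
    using coercive U VG eq2 by (metis mult_zero_right)
  then have "ip M U U = 0" "ip M V V = 0" and V0: "ip M G G = 0"
    using ip_nonneg[of M U] ip_nonneg[of M V] ip_nonneg[of M G] by linarith+
  then have AE: "AE x in M. U x = 0" "AE x in M. V x = 0" "AE x in M. G x = 0"
    using U graph_sqint[OF VG] by (auto simp: ip_self_eq_0_iff)
  have "ip M V A = 0" "ip M G D = 0" "ip M U D = 0"
    unfolding ip_def by (rule integral_eq_zero_AE, use AE in eventually_elim, simp)+
  then have "ip M A A + ip M D D = 0"
    using eq1[OF graph_sqint(2)[OF AD] AD] by simp
  then have "ip M A A = 0" using ip_nonneg[of M A] ip_nonneg[of M D] by linarith
  then have "AE x in M. A x = 0"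
    using graph_sqint[OF AD] by (auto simp: ip_self_eq_0_iff)
  with AE show "AE x in M. u' x = u x" "AE x in M. v' x = v x" "AE x in M. \<alpha>' x = \<alpha> x"
    by (auto simp: defs)
qed

lemma solution_exists:
  assumes F_add: "\<And>u w. u \<in> sqint M \<Longrightarrow> w \<in> sqint M \<Longrightarrow> F (\<lambda>x. u x + w x) = F u + F w"
    and F_scale: "\<And>u c. u \<in> sqint M \<Longrightarrow> F (\<lambda>x. c *\<^sub>R u x) = c * F u"
    and F_bound: "\<And>u. u \<in> sqint M \<Longrightarrow> \<bar>F u\<bar> \<le> C * sqrt (ip M u u)"
  obtains u v g \<alpha> \<gamma> where "solution F u v g \<alpha> \<gamma>"
proof -
  have fst_bound: "ip M (\<lambda>x. fst (p x)) (\<lambda>x. fst (p x)) \<le> ip M p p" if "p \<in> sqint M" for p :: "'a \<Rightarrow> 'x::euclidean_space \<times> 'y::euclidean_space"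
    using ip_Pair[OF sqint_fst[OF that] sqint_snd[OF that] sqint_fst[OF that] sqint_snd[OF that]] ip_nonneg[of M "\<lambda>x. snd (p x)"]
    by simp
  have snd_bound: "ip M (\<lambda>x. snd (p x)) (\<lambda>x. snd (p x)) \<le> ip M p p" if "p \<in> sqint M" for p :: "'a \<Rightarrow> 'x::euclidean_space \<times> 'y::euclidean_space"
    using ip_Pair[OF sqint_fst[OF that] sqint_snd[OF that] sqint_fst[OF that] sqint_snd[OF that]] ip_nonneg[of M "\<lambda>x. fst (p x)"]
    by simp
  have F_bound': "\<bar>F u\<bar> \<le> \<bar>C\<bar> * sqrt (ip M u u)" if "u \<in> sqint M" for u
    using F_bound[OF that] mult_right_mono[OF abs_ge_self[of C], of "sqrt (ip M u u)"] by (simp add: ip_nonneg)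
  \<comment> \<open>The form a as a pointwise matrix on triples \<open>(u, v, g)\<close>: diagonal,
    hence symmetric, and nonnegative by the signs of \<open>c0\<close> and
    \<open>c1\<close>.\<close>
  define T where "T = (\<lambda>(a::real, (b::'e), (c::real)). (c1 * a, c0 *\<^sub>R b, c))"
  have T_simp: "T (a, b, c) = (c1 * a, c0 *\<^sub>R b, c)" for a b c by (simp add: T_def)
  have T: "bounded_linear T"
    by (rule linear_conv_bounded_linear[THEN iffD1], rule linearI) (auto simp: T_def algebra_simps)
  have ip_T: "ip M (\<lambda>x. T (u x, v x, g x)) (\<lambda>x. (\<phi> x, \<psi> x, \<delta> x)) =
      c1 * ip M u \<phi> + c0 * ip M v \<psi> + ip M g \<delta>"
    if "u \<in> sqint M" "v \<in> sqint M" "g \<in> sqint M" "\<phi> \<in> sqint M" "\<psi> \<in> sqint M" "\<delta> \<in> sqint M"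
    for u v g \<phi> \<psi> \<delta>
    using that ip_integrable[of u M \<phi>] ip_integrable[of v M \<psi>] ip_integrable[of g M \<delta>]
    by (simp add: T_simp ip_def mult.assoc)
  obtain \<kappa> where \<kappa>: "\<kappa> \<ge> 0" "\<And>u v g. u \<in> sqint M \<Longrightarrow> graph v g \<Longrightarrow>
      (\<And>\<beta> \<delta>. graph \<beta> \<delta> \<Longrightarrow> ip M v \<beta> + ip M u \<delta> = 0) \<Longrightarrow>
      ip M u u + ip M v v + ip M g g \<le> \<kappa> * (c1 * ip M u u + c0 * ip M v v + ip M g g)"
    using coercive by blast
  have ker_sq: "p \<in> sqint M" if "p \<in> orth M kernel_tests" for p using that by (simp add: orth_def)
  obtain p where p: "p \<in> orth M kernel_tests"
    and p_eq: "\<And>q. q \<in> orth M kernel_tests \<Longrightarrow> ip M (\<lambda>x. T (p x)) q = F (\<lambda>x. fst (q x))"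
  proof (rule Riesz_orth[OF kernel_tests_sqint T, where F = "\<lambda>q. F (\<lambda>x. fst (q x))" and \<kappa> = \<kappa> and C = "\<bar>C\<bar>"])
    show "T a \<bullet> b = a \<bullet> T b" for a b
      by (cases a; cases b) (simp add: T_def algebra_simps)
    show "0 \<le> T a \<bullet> a" for a
      using c0 c1 by (cases a) (simp add: T_def mult.assoc)
    show "ip M q q \<le> \<kappa> * ip M (\<lambda>x. T (q x)) q" if q: "q \<in> orth M kernel_tests" for q
    proof -
      define u v g where "u = (\<lambda>x. fst (q x))" "v = (\<lambda>x. fst (snd (q x)))" "g = (\<lambda>x. snd (snd (q x)))"
      have q': "q = (\<lambda>x. (u x, v x, g x))" by (simp add: u_v_g_def)
      have u: "u \<in> sqint M" and vg: "graph v g" and ker: "\<And>\<beta> \<delta>. graph \<beta> \<delta> \<Longrightarrow> ip M v \<beta> + ip M u \<delta> = 0"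
        using q unfolding orth_kernel_tests u_v_g_def by auto
      note sq = u graph_sqint[OF vg]
      have "ip M q q = ip M u u + ip M v v + ip M g g"
        unfolding q' using sq by (simp add: ip_Pair sqint_Pair)
      then show ?thesis using \<kappa>(2)[OF u vg ker] ip_T[OF sq sq] by (simp add: q')
    qed
    show "F (\<lambda>x. fst (u x + w x)) = F (\<lambda>x. fst (u x)) + F (\<lambda>x. fst (w x))"
      if "u \<in> orth M kernel_tests" "w \<in> orth M kernel_tests" for u w
      using F_add[OF sqint_fst[OF ker_sq[OF that(1)]] sqint_fst[OF ker_sq[OF that(2)]]] by simp
    show "F (\<lambda>x. fst (c *\<^sub>R u x)) = c * F (\<lambda>x. fst (u x))" if "u \<in> orth M kernel_tests" for u c
      using F_scale[OF sqint_fst[OF ker_sq[OF that]], of c] by simp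
    show "\<bar>F (\<lambda>x. fst (u x))\<bar> \<le> \<bar>C\<bar> * sqrt (ip M u u)" if "u \<in> orth M kernel_tests" for u
      using F_bound'[OF sqint_fst[OF ker_sq[OF that]]] fst_bound[OF ker_sq[OF that]]
      by (meson abs_ge_zero mult_left_mono order_trans real_sqrt_le_mono)
  qed (blast intro: that)
  define u v g where "u = (\<lambda>x. fst (p x))" "v = (\<lambda>x. fst (snd (p x)))" "g = (\<lambda>x. snd (snd (p x)))"
  have p': "p = (\<lambda>x. (u x, v x, g x))" by (simp add: u_v_g_def)
  have u: "u \<in> sqint M" and vg: "graph v g" and ker: "\<And>\<beta> \<delta>. graph \<beta> \<delta> \<Longrightarrow> ip M v \<beta> + ip M u \<delta> = 0"
    using p unfolding orth_kernel_tests u_v_g_def by auto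
  note sq = u graph_sqint[OF vg]
  \<comment> \<open>Residual of the first equation. It vanishes on the kernel of b by the choice of
    \<open>p\<close>, and the multiplier has to represent it off the kernel.\<close>
  define l where "l \<phi> \<psi> \<delta> = F \<phi> - (c1 * ip M u \<phi> + c0 * ip M v \<psi> + ip M g \<delta>)" for \<phi> \<psi> \<delta>
  have l_ker: "l \<phi> \<psi> \<delta> = 0" if "\<phi> \<in> sqint M" "graph \<psi> \<delta>"
    "\<And>\<beta> \<delta>'. graph \<beta> \<delta>' \<Longrightarrow> ip M \<psi> \<beta> + ip M \<phi> \<delta>' = 0" for \<phi> \<psi> \<delta>
  proof -
    have "(\<lambda>x. (\<phi> x, \<psi> x, \<delta> x)) \<in> orth M kernel_tests"
      unfolding orth_kernel_tests using that by simp
    then show ?thesis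
      using p_eq ip_T[OF sq that(1) graph_sqint[OF that(2)]] by (auto simp: l_def p')
  qed
  \<comment> \<open>Riesz representation in the graph inner product, stated for general functionals
    of both components because it serves twice: for the multiplier and for the splitting of test
    pairs.\<close>
  have Riesz_graph: "\<exists>\<beta> \<delta>. graph \<beta> \<delta> \<and> (\<forall>\<psi> \<eta>. graph \<psi> \<eta> \<longrightarrow> ip M \<beta> \<psi> + ip M \<delta> \<eta> = L \<psi> \<eta>)"
    if L: "\<And>q r. q \<in> orth M K \<Longrightarrow> r \<in> orth M K \<Longrightarrow>
        L (\<lambda>x. fst (q x + r x)) (\<lambda>x. snd (q x + r x)) =
        L (\<lambda>x. fst (q x)) (\<lambda>x. snd (q x)) + L (\<lambda>x. fst (r x)) (\<lambda>x. snd (r x))"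
      "\<And>q c. q \<in> orth M K \<Longrightarrow> L (\<lambda>x. fst (c *\<^sub>R q x)) (\<lambda>x. snd (c *\<^sub>R q x)) =
        c * L (\<lambda>x. fst (q x)) (\<lambda>x. snd (q x))"
      "\<And>q. q \<in> orth M K \<Longrightarrow> \<bar>L (\<lambda>x. fst (q x)) (\<lambda>x. snd (q x))\<bar> \<le> C' * sqrt (ip M q q)" for L C'
  proof -
    obtain q where q: "q \<in> orth M K"
      and q_eq: "\<And>r. r \<in> orth M K \<Longrightarrow> ip M (\<lambda>x. q x) r = L (\<lambda>x. fst (r x)) (\<lambda>x. snd (r x))"
    proof (rule Riesz_orth[OF K bounded_linear_ident, where F = "\<lambda>q. L (\<lambda>x. fst (q x)) (\<lambda>x. snd (q x))" and \<kappa> = 1 and C = C'])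
    qed (auto simp del: fst_add snd_add fst_scaleR snd_scaleR intro: L that)
    have gq: "graph (\<lambda>x. fst (q x)) (\<lambda>x. snd (q x))" using q by (simp add: graph_def)
    show ?thesis
    proof (intro exI conjI allI impI)
      show "graph (\<lambda>x. fst (q x)) (\<lambda>x. snd (q x))" by (rule gq)
      fix \<psi> \<eta> assume g: "graph \<psi> \<eta>"
      then have "ip M (\<lambda>x. (fst (q x), snd (q x))) (\<lambda>x. (\<psi> x, \<eta> x)) = L \<psi> \<eta>"
        using q_eq[of "\<lambda>x. (\<psi> x, \<eta> x)"] by (simp add: graph_def)
      then show "ip M (\<lambda>x. fst (q x)) \<psi> + ip M (\<lambda>x. snd (q x)) \<eta> = L \<psi> \<eta>"
        using ip_Pair[OF graph_sqint[OF gq] graph_sqint[OF g]] by simp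
    qed
  qed
  have comp: "(\<lambda>x. fst (q x)) \<in> sqint M" "(\<lambda>x. snd (q x)) \<in> sqint M" if "q \<in> orth M K" for q
    using that by (auto simp: orth_def intro: sqint_fst sqint_snd)
  have orth_sq: "q \<in> sqint M" if "q \<in> orth M K" for q using that by (simp add: orth_def)
  have ip_le_fst: "\<bar>ip M a (\<lambda>x. fst (q x))\<bar> \<le> sqrt (ip M a a) * sqrt (ip M q q)"
    if "a \<in> sqint M" "q \<in> orth M K" for a q
    by (rule order_trans[OF L2.Cauchy_Schwarz_abs[OF that(1) comp(1)[OF that(2)]]
      mult_left_mono[OF real_sqrt_le_mono[OF fst_bound[OF orth_sq[OF that(2)]]] real_sqrt_ge_zero[OF ip_nonneg]]])
  have ip_le_snd: "\<bar>ip M a (\<lambda>x. snd (q x))\<bar> \<le> sqrt (ip M a a) * sqrt (ip M q q)"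
    if "a \<in> sqint M" "q \<in> orth M K" for a q
    by (rule order_trans[OF L2.Cauchy_Schwarz_abs[OF that(1) comp(2)[OF that(2)]]
      mult_left_mono[OF real_sqrt_le_mono[OF snd_bound[OF orth_sq[OF that(2)]]] real_sqrt_ge_zero[OF ip_nonneg]]])
  have F_le_snd: "\<bar>F (\<lambda>x. snd (q x))\<bar> \<le> \<bar>C\<bar> * sqrt (ip M q q)" if "q \<in> orth M K" for q
    by (rule order_trans[OF F_bound'[OF comp(2)[OF that]]
      mult_left_mono[OF real_sqrt_le_mono[OF snd_bound[OF orth_sq[OF that]]] abs_ge_zero]])
  \<comment> \<open>In \<open>l \<eta> \<psi> \<eta>\<close> the divergence \<open>\<eta>\<close>
    occurs in two roles, as scalar test function and as divergence of \<open>\<psi>\<close>.\<close>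
  have "\<exists>\<alpha> \<gamma>. graph \<alpha> \<gamma> \<and> (\<forall>\<psi> \<eta>. graph \<psi> \<eta> \<longrightarrow> ip M \<alpha> \<psi> + ip M \<gamma> \<eta> = l \<eta> \<psi> \<eta>)"
  proof (rule Riesz_graph[of "\<lambda>\<psi> \<eta>. l \<eta> \<psi> \<eta>" "\<bar>C\<bar> + (c1 * sqrt (ip M u u) + c0 * sqrt (ip M v v) + sqrt (ip M g g))"])
    fix q r c assume q: "q \<in> orth M K"
    show "l (\<lambda>x. snd (c *\<^sub>R q x)) (\<lambda>x. fst (c *\<^sub>R q x)) (\<lambda>x. snd (c *\<^sub>R q x)) =
        c * l (\<lambda>x. snd (q x)) (\<lambda>x. fst (q x)) (\<lambda>x. snd (q x))"
      using comp[OF q] sq F_scale[of "\<lambda>x. snd (q x)" c] L2.B_scale_right[of "\<lambda>x. snd (q x)" M _ c]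
        L2.B_scale_right[of "\<lambda>x. fst (q x)" M _ c]
      by (simp add: l_def algebra_simps)
    show "\<bar>l (\<lambda>x. snd (q x)) (\<lambda>x. fst (q x)) (\<lambda>x. snd (q x))\<bar> \<le>
        (\<bar>C\<bar> + (c1 * sqrt (ip M u u) + c0 * sqrt (ip M v v) + sqrt (ip M g g))) * sqrt (ip M q q)"
      using F_le_snd[OF q] mult_left_mono[OF ip_le_snd[OF sq(1) q] c1] mult_left_mono[OF ip_le_fst[OF sq(2) q] c0]
        ip_le_snd[OF sq(3) q] c0 c1
        abs_mult[of c1 "ip M u (\<lambda>x. snd (q x))"] abs_mult[of c0 "ip M v (\<lambda>x. fst (q x))"]
      unfolding l_def distrib_right by (simp only: abs_of_nonneg[OF c0] abs_of_nonneg[OF c1] mult.assoc) linarith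
    assume r: "r \<in> orth M K"
    show "l (\<lambda>x. snd (q x + r x)) (\<lambda>x. fst (q x + r x)) (\<lambda>x. snd (q x + r x)) =
        l (\<lambda>x. snd (q x)) (\<lambda>x. fst (q x)) (\<lambda>x. snd (q x)) + l (\<lambda>x. snd (r x)) (\<lambda>x. fst (r x)) (\<lambda>x. snd (r x))"
      using comp[OF q] comp[OF r] sq by (simp add: l_def F_add L2.B_add_right algebra_simps)
  qed
  then obtain \<alpha> \<gamma> where \<alpha>: "graph \<alpha> \<gamma>"
    and \<alpha>_eq: "\<And>\<psi> \<eta>. graph \<psi> \<eta> \<Longrightarrow> ip M \<alpha> \<psi> + ip M \<gamma> \<eta> = l \<eta> \<psi> \<eta>" by blast
  have "l \<phi> \<psi> \<delta> = ip M \<alpha> \<psi> + ip M \<gamma> \<phi>" if \<phi>: "\<phi> \<in> sqint M" and \<psi>: "graph \<psi> \<delta>" for \<phi> \<psi> \<delta>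
  proof -
    note sq' = \<phi> graph_sqint[OF \<psi>]
    \<comment> \<open>\<open>(\<beta>, \<eta>)\<close> is the orthogonal projection of
      \<open>(\<psi>, \<phi>)\<close> onto the graph. Orthogonality of the remainder to the graph is
      precisely the constraint defining the kernel of b.\<close>
    have "\<exists>\<beta> \<eta>. graph \<beta> \<eta> \<and> (\<forall>\<psi>' \<eta>'. graph \<psi>' \<eta>' \<longrightarrow> ip M \<beta> \<psi>' + ip M \<eta> \<eta>' = ip M \<psi> \<psi>' + ip M \<phi> \<eta>')"
    proof (rule Riesz_graph[of "\<lambda>\<psi>' \<eta>'. ip M \<psi> \<psi>' + ip M \<phi> \<eta>'" "sqrt (ip M \<psi> \<psi>) + sqrt (ip M \<phi> \<phi>)"])
      fix q r c assume q: "q \<in> orth M K"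
      show "ip M \<psi> (\<lambda>x. fst (c *\<^sub>R q x)) + ip M \<phi> (\<lambda>x. snd (c *\<^sub>R q x)) =
        c * (ip M \<psi> (\<lambda>x. fst (q x)) + ip M \<phi> (\<lambda>x. snd (q x)))"
        using comp[OF q] sq' L2.B_scale_right[of "\<lambda>x. snd (q x)" M _ c]
          L2.B_scale_right[of "\<lambda>x. fst (q x)" M _ c]
        by (simp add: algebra_simps)
      show "\<bar>ip M \<psi> (\<lambda>x. fst (q x)) + ip M \<phi> (\<lambda>x. snd (q x))\<bar> \<le>
          (sqrt (ip M \<psi> \<psi>) + sqrt (ip M \<phi> \<phi>)) * sqrt (ip M q q)"
        using ip_le_fst[OF sq'(2) q] ip_le_snd[OF sq'(1) q] by (simp add: distrib_right)
      assume r: "r \<in> orth M K"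
      show "ip M \<psi> (\<lambda>x. fst (q x + r x)) + ip M \<phi> (\<lambda>x. snd (q x + r x)) =
          ip M \<psi> (\<lambda>x. fst (q x)) + ip M \<phi> (\<lambda>x. snd (q x)) + (ip M \<psi> (\<lambda>x. fst (r x)) + ip M \<phi> (\<lambda>x. snd (r x)))"
        using comp[OF q] comp[OF r] sq' by (simp add: L2.B_add_right algebra_simps)
    qed
    then obtain \<beta> \<eta> where \<beta>: "graph \<beta> \<eta>"
      and \<beta>_eq: "\<And>\<psi>' \<eta>'. graph \<psi>' \<eta>' \<Longrightarrow> ip M \<beta> \<psi>' + ip M \<eta> \<eta>' = ip M \<psi> \<psi>' + ip M \<phi> \<eta>'" by blast
    note sq'' = graph_sqint[OF \<beta>]
    text \<open>Split \<open>(\<phi>, \<psi>)\<close> into \<open>(\<eta>, \<beta>)\<close> and a remainder in the kernel of \<open>b\<close>.\<close>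
    have orth: "ip M (\<lambda>x. \<psi> x - \<beta> x) \<psi>' + ip M (\<lambda>x. \<phi> x - \<eta> x) \<eta>' = 0" if "graph \<psi>' \<eta>'" for \<psi>' \<eta>'
      using \<beta>_eq[OF that] sq' sq'' graph_sqint[OF that] by (simp add: L2.B_diff)
    have "l (\<lambda>x. \<phi> x - \<eta> x) (\<lambda>x. \<psi> x - \<beta> x) (\<lambda>x. \<delta> x - \<eta> x) = 0"
      using orth sq' sq'' by (intro l_ker graph_diff \<psi> \<beta> L2.diff)
    moreover have "F (\<lambda>x. \<phi> x - \<eta> x) = F \<phi> - F \<eta>"
      using F_add[OF \<phi> L2.scale[OF sq''(2), of "-1"]] F_scale[OF sq''(2), of "-1"] by simp
    ultimately have "l \<phi> \<psi> \<delta> = l \<eta> \<beta> \<eta>"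
      using sq sq' sq'' by (simp add: l_def L2.B_diff_right algebra_simps)
    also have "\<dots> = ip M \<alpha> \<beta> + ip M \<gamma> \<eta>" using \<alpha>_eq[OF \<beta>] by simp
    also have "\<dots> = ip M \<alpha> \<psi> + ip M \<gamma> \<phi>"
      using \<beta>_eq[OF \<alpha>] by (simp add: ip_commute[of M \<alpha>] ip_commute[of M \<gamma>])
    finally show ?thesis .
  qed
  then have "solution F u v g \<alpha> \<gamma>"
    unfolding solution_def using u vg \<alpha> ker by (auto simp: l_def algebra_simps)
  then show thesis by (rule that)
qed

end

section \<open>Smooth functions\<close>

lemma frechet_derivative_eq_grad:
  assumes "\<phi> differentiable (at x)"
  shows "frechet_derivative \<phi> (at x) h = grad \<phi> x \<bullet> h"
proof -
  interpret bounded_linear "frechet_derivative \<phi> (at x)"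
    using assms by (simp add: frechet_derivative_works has_derivative_bounded_linear)
  have "h = (\<Sum>i\<in>UNIV. (h $ i) *\<^sub>R axis i 1)"
    by (simp add: basis_expansion flip: scalar_mult_eq_scaleR)
  then have "frechet_derivative \<phi> (at x) h = frechet_derivative \<phi> (at x) (\<Sum>i\<in>UNIV. (h $ i) *\<^sub>R axis i 1)"
    by (rule arg_cong)
  also have "\<dots> = (\<Sum>i\<in>UNIV. (h $ i) * frechet_derivative \<phi> (at x) (axis i 1))"
    by (simp add: sum scaleR)
  finally show ?thesis by (simp add: grad_def inner_vec_def mult.commute)
qed

lemma has_derivative_grad:
  assumes "\<phi> differentiable (at x)"
  shows "(\<phi> has_derivative (\<lambda>h. grad \<phi> x \<bullet> h)) (at x)"
  using assms unfolding frechet_derivative_works frechet_derivative_eq_grad[OF assms, symmetric] .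

lemma grad_unique:
  assumes "(\<phi> has_derivative (\<lambda>h. G \<bullet> h)) (at x)"
  shows "grad \<phi> x = G"
proof -
  have "frechet_derivative \<phi> (at x) = (\<lambda>h. G \<bullet> h)"
    by (rule frechet_derivative_at[OF assms, symmetric])
  then show ?thesis by (simp add: grad_def vec_eq_iff inner_axis)
qed

lemma grad_add:
  assumes "\<phi> differentiable (at x)" "\<psi> differentiable (at x)"
  shows "grad (\<lambda>x. \<phi> x + \<psi> x) x = grad \<phi> x + grad \<psi> x"
  by (rule grad_unique, rule has_derivative_eq_rhs, rule has_derivative_add[OF assms[THEN has_derivative_grad]])
    (simp add: inner_add_left fun_eq_iff)

lemma grad_mult:
  assumes "\<phi> differentiable (at x)" "\<psi> differentiable (at x)"
  shows "grad (\<lambda>x. \<phi> x * \<psi> x) x = \<phi> x *\<^sub>R grad \<psi> x + \<psi> x *\<^sub>R grad \<phi> x"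
  by (rule grad_unique, rule has_derivative_eq_rhs, rule has_derivative_mult[OF assms[THEN has_derivative_grad]])
    (simp add: inner_add_left fun_eq_iff)

lemma grad_const [simp]: "grad (\<lambda>x. c) x = 0"
  by (rule grad_unique) simp

lemma Ck_const: "Ck k (\<lambda>x. c)"
  by (induction k arbitrary: c) simp_all

lemma Ck_SucD: "Ck (Suc k) \<phi> \<Longrightarrow> Ck k \<phi>"
  by (induction k arbitrary: \<phi>) (auto intro: differentiable_imp_continuous_on)

lemma Ck_add: "Ck k \<phi> \<Longrightarrow> Ck k \<psi> \<Longrightarrow> Ck k (\<lambda>x. \<phi> x + \<psi> x)"
proof (induction k arbitrary: \<phi> \<psi>)
  case (Suc k)
  then have d: "\<phi> differentiable (at x)" "\<psi> differentiable (at x)" for x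
    by (auto simp: differentiable_on_def)
  have "(\<lambda>x. grad (\<lambda>x. \<phi> x + \<psi> x) x $ i) = (\<lambda>x. grad \<phi> x $ i + grad \<psi> x $ i)" for i
    by (simp add: grad_add[OF d])
  then show ?case using Suc by (auto simp: differentiable_on_add)
qed (auto intro: continuous_on_add)

lemma Ck_mult: "Ck k \<phi> \<Longrightarrow> Ck k \<psi> \<Longrightarrow> Ck k (\<lambda>x. \<phi> x * \<psi> x)"
proof (induction k arbitrary: \<phi> \<psi>)
  case (Suc k)
  then have d: "\<phi> differentiable (at x)" "\<psi> differentiable (at x)" for x
    by (auto simp: differentiable_on_def)
  have "(\<lambda>x. grad (\<lambda>x. \<phi> x * \<psi> x) x $ i) = (\<lambda>x. \<phi> x * grad \<psi> x $ i + \<psi> x * grad \<phi> x $ i)" for i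
    by (simp add: grad_mult[OF d])
  then show ?case using Suc.prems Ck_SucD[of k \<phi>] Ck_SucD[of k \<psi>]
    by (auto simp: differentiable_on_mult intro!: Ck_add Suc.IH)
qed (auto intro: continuous_on_mult)

lemma Ck_prod: "finite A \<Longrightarrow> (\<And>i. i \<in> A \<Longrightarrow> Ck k (f i)) \<Longrightarrow> Ck k (\<lambda>x. \<Prod>i\<in>A. f i x)"
  by (induction A rule: finite_induct) (auto simp: Ck_const Ck_mult)

lemma test_functionsD:
  assumes "\<phi> \<in> test_functions U"
  shows "Ck k \<phi>" "\<phi> differentiable (at x)" "continuous_on UNIV \<phi>" "continuous_on UNIV (grad \<phi>)"
    "compact (closure {x. \<phi> x \<noteq> 0})" "closure {x. \<phi> x \<noteq> 0} \<subseteq> U"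
proof -
  have Ck: "Ck k \<phi>" for k using assms by (simp add: test_functions_def)
  show "Ck k \<phi>" by (rule Ck)
  show "\<phi> differentiable (at x)" using Ck[of 1] by (simp add: differentiable_on_def)
  show "continuous_on UNIV \<phi>" using Ck[of 0] by simp
  have "continuous_on UNIV (\<lambda>x. \<chi> i. grad \<phi> x $ i)"
    by (intro continuous_on_vec_lambda) (use Ck[of 1] in simp)
  then show "continuous_on UNIV (grad \<phi>)" by simp
qed (use assms in \<open>auto simp: test_functions_def\<close>)

lemma zero_outside: "x \<notin> closure {x. \<phi> x \<noteq> (0::real)} \<Longrightarrow> \<phi> x = 0"
  using subsetD[OF closure_subset, of x "{x. \<phi> x \<noteq> 0}"] by blast

lemma grad_zero_outside:
  assumes "x \<notin> closure {x. \<phi> x \<noteq> 0}"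
  shows "grad \<phi> x = 0"
proof (rule grad_unique)
  have "((\<lambda>x. 0) has_derivative (\<lambda>h. 0)) (at x)" by simp
  then have "(\<phi> has_derivative (\<lambda>h. 0)) (at x)"
    by (rule has_derivative_transform_within_open[where s = "- closure {x. \<phi> x \<noteq> 0}"])
      (use assms zero_outside in auto)
  then show "(\<phi> has_derivative (\<lambda>h. 0 \<bullet> h)) (at x)" by simp
qed

lemma test_zero: "(\<lambda>x. 0) \<in> test_functions U"
  by (simp add: test_functions_def Ck_const)

lemma test_mult:
  assumes "\<phi> \<in> test_functions U" "\<And>k. Ck k \<psi>"
  shows "(\<lambda>x. \<phi> x * \<psi> x) \<in> test_functions U"
proof -
  have sub: "closure {x. \<phi> x * \<psi> x \<noteq> 0} \<subseteq> closure {x. \<phi> x \<noteq> 0}"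
    by (rule closure_mono) auto
  then have "compact (closure {x. \<phi> x * \<psi> x \<noteq> 0})"
    using test_functionsD(5)[OF assms(1)] by (meson bounded_subset closed_closure compact_eq_bounded_closed)
  then show ?thesis
    using sub test_functionsD(1,6)[OF assms(1)] assms(2) by (auto simp: test_functions_def Ck_mult)
qed

lemma test_scale: "\<phi> \<in> test_functions U \<Longrightarrow> (\<lambda>x. c * \<phi> x) \<in> test_functions U"
  using test_mult[of \<phi> U "\<lambda>x. c"] by (simp add: Ck_const mult.commute)

lemma test_add:
  assumes "\<phi> \<in> test_functions U" "\<psi> \<in> test_functions U"
  shows "(\<lambda>x. \<phi> x + \<psi> x) \<in> test_functions U"
proof -
  have sub: "closure {x. \<phi> x + \<psi> x \<noteq> 0} \<subseteq> closure {x. \<phi> x \<noteq> 0} \<union> closure {x. \<psi> x \<noteq> 0}"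
    unfolding closure_Un[symmetric] by (rule closure_mono) auto
  moreover have "compact (closure {x. \<phi> x \<noteq> 0} \<union> closure {x. \<psi> x \<noteq> 0})"
    using assms by (intro compact_Un test_functionsD(5))
  ultimately have "compact (closure {x. \<phi> x + \<psi> x \<noteq> 0})"
    by (meson bounded_subset closed_closure compact_eq_bounded_closed)
  then show ?thesis
    using sub assms[THEN test_functionsD(1)] assms[THEN test_functionsD(6)] by (auto simp: test_functions_def Ck_add)
qed

lemma grad_scale:
  assumes "\<phi> differentiable (at x)"
  shows "grad (\<lambda>x. c * \<phi> x) x = c *\<^sub>R grad \<phi> x"
  using grad_mult[of "\<lambda>x. c" x \<phi>] assms by simp

section \<open>Integration by parts for smooth functions\<close>

lemma continuous_sqint:
  fixes f :: "real^'d \<Rightarrow> 'b::euclidean_space"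
  assumes "open \<Omega>" "bounded \<Omega>" and f: "continuous_on UNIV f"
  shows "f \<in> sqint (lebesgue_on \<Omega>)"
proof -
  have \<Omega>: "\<Omega> \<in> sets lebesgue" "emeasure lebesgue \<Omega> < \<infinity>"
    using assms bounded_set_imp_lmeasurable[of \<Omega>] by (auto simp: fmeasurable_def)
  interpret finite_measure "lebesgue_on \<Omega>"
    by (rule finite_measure_lebesgue_on) (use \<Omega> in \<open>auto simp: fmeasurable_def\<close>)
  have meas: "f \<in> borel_measurable (lebesgue_on \<Omega>)"
    by (rule continuous_imp_measurable_on_sets_lebesgue[OF continuous_on_subset[OF f] \<Omega>(1)]) simp
  have "bounded (f ` closure \<Omega>)"
    using assms by (intro compact_imp_bounded compact_continuous_image continuous_on_subset[OF f]) auto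
  then obtain C where C: "\<And>x. x \<in> closure \<Omega> \<Longrightarrow> norm (f x) \<le> C"
    unfolding bounded_iff by blast
  have "integrable (lebesgue_on \<Omega>) (\<lambda>x. (norm (f x))\<^sup>2)"
  proof (rule integrable_const_bound[where B = "C\<^sup>2"])
    show "AE x in lebesgue_on \<Omega>. norm ((norm (f x))\<^sup>2) \<le> C\<^sup>2"
      using C closure_subset by (intro AE_I2) (auto simp: space_restrict_space intro!: power_mono)
    show "(\<lambda>x. (norm (f x))\<^sup>2) \<in> borel_measurable (lebesgue_on \<Omega>)" using meas by measurable
  qed
  then show ?thesis using meas by (simp add: sqint_def)
qed

text \<open>The integral of a difference quotient vanishes by translation invariance.\<close>

lemma integral_grad_zero:
  assumes "\<phi> \<in> test_functions (UNIV :: (real^'d) set)"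
  shows "integrable lborel (grad \<phi>)" "integral\<^sup>L lborel (grad \<phi>) = 0"
proof -
  note \<phi> = test_functionsD[OF assms]
  define S where "S = closure {x. \<phi> x \<noteq> 0}"
  have z: "\<phi> x = 0" "grad \<phi> x = 0" if "x \<notin> S" for x
    using that unfolding S_def by (rule zero_outside, rule grad_zero_outside)
  have "bounded S" using \<phi>(5) by (simp add: S_def compact_imp_bounded)
  then obtain R where R: "R > 0" "\<And>x. x \<in> S \<Longrightarrow> norm x \<le> R" by (auto simp: bounded_pos)
  \<comment> \<open>The radius leaves room for difference quotients, which evaluate
    \<open>\<phi>\<close> at distance up to 1 from the point.\<close>
  have "bounded (grad \<phi> ` cball 0 (R + 2))"
    by (intro compact_imp_bounded compact_continuous_image continuous_on_subset[OF \<phi>(4)]) auto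
  then obtain C where bound: "\<And>x. x \<in> cball 0 (R + 2) \<Longrightarrow> norm (grad \<phi> x) \<le> C"
    unfolding bounded_iff by blast
  then have C: "norm (grad \<phi> x) \<le> \<bar>C\<bar>" for x
  proof (cases "x \<in> S")
    case True
    then show ?thesis using R(2)[of x] bound[of x] by simp
  qed (simp add: S_def grad_zero_outside)
  have [measurable]: "\<phi> \<in> borel_measurable borel" "grad \<phi> \<in> borel_measurable borel"
    using \<phi>(3,4) by (auto intro: borel_measurable_continuous_onI)
  have int_\<phi>: "integrable lborel \<phi>"
  proof -
    have "integrable lborel (\<lambda>x. indicator S x *\<^sub>R \<phi> x)"
      by (rule borel_integrable_compact) (use \<phi> in \<open>auto simp: S_def intro: continuous_on_subset\<close>)
    also have "(\<lambda>x. indicator S x *\<^sub>R \<phi> x) = \<phi>"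
      using z(1) by (auto simp: fun_eq_iff indicator_def)
    finally show ?thesis .
  qed
  show int: "integrable lborel (grad \<phi>)"
  proof -
    have "integrable lborel (\<lambda>x. indicator S x *\<^sub>R grad \<phi> x)"
      by (rule borel_integrable_compact) (use \<phi> in \<open>auto simp: S_def intro: continuous_on_subset\<close>)
    also have "(\<lambda>x. indicator S x *\<^sub>R grad \<phi> x) = grad \<phi>"
      using z(2) by (auto simp: fun_eq_iff indicator_def)
    finally show ?thesis .
  qed
  have "integral\<^sup>L lborel (grad \<phi>) \<bullet> e = 0" if e: "norm e = 1" for e
  proof -
    define t where "t n = 1 / real (Suc n)" for n
    have t: "0 < t n" "t n \<le> 1" for n by (auto simp: t_def)
    have t0: "t \<longlonglongrightarrow> 0" unfolding t_def by (rule LIMSEQ_Suc[OF lim_1_over_n])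
    define f where "f n x = (\<phi> (x + t n *\<^sub>R e) - \<phi> x) / t n" for n x
    have lip: "\<bar>\<phi> y - \<phi> x\<bar> \<le> \<bar>C\<bar> * norm (y - x)" for x y
    proof -
      have "norm (\<phi> y - \<phi> x) \<le> \<bar>C\<bar> * norm (y - x)"
      proof (rule differentiable_bound[where S = UNIV and f' = "\<lambda>x h. grad \<phi> x \<bullet> h"])
        show "(\<phi> has_derivative (\<lambda>h. grad \<phi> x \<bullet> h)) (at x within UNIV)" for x
          using has_derivative_grad[OF \<phi>(2)] .
        show "onorm (\<lambda>h. grad \<phi> x \<bullet> h) \<le> \<bar>C\<bar>" for x
          unfolding real_norm_def[symmetric]
          by (intro onorm_le, unfold real_norm_def)
            (rule order_trans[OF Cauchy_Schwarz_ineq2 mult_right_mono[OF C norm_ge_zero, simplified]])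
      qed auto
      then show ?thesis by simp
    qed
    have "(\<lambda>n. integral\<^sup>L lborel (f n)) \<longlonglongrightarrow> integral\<^sup>L lborel (\<lambda>x. grad \<phi> x \<bullet> e)"
    proof (rule integral_dominated_convergence[where w = "\<lambda>x. indicator (cball 0 (R + 2)) x *\<^sub>R \<bar>C\<bar>"])
      show "f n \<in> borel_measurable lborel" for n unfolding f_def by measurable
      show "integrable lborel (\<lambda>x. indicator (cball 0 (R + 2)) x *\<^sub>R \<bar>C\<bar>)"
        by (rule borel_integrable_compact) auto
      show "AE x in lborel. (\<lambda>n. f n x) \<longlonglongrightarrow> grad \<phi> x \<bullet> e"
      proof (intro AE_I2)
        fix x
        have "((\<lambda>s. \<phi> (x + s *\<^sub>R e)) has_derivative (\<lambda>s. grad \<phi> x \<bullet> (s *\<^sub>R e))) (at 0)"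
        proof -
          have "((\<lambda>s. x + s *\<^sub>R e) has_derivative (\<lambda>s. s *\<^sub>R e)) (at 0)"
            by (auto intro!: derivative_eq_intros)
          then show ?thesis
            by (rule has_derivative_compose) (use has_derivative_grad[OF \<phi>(2), of x] in simp)
        qed
        then have "((\<lambda>s. \<phi> (x + s *\<^sub>R e)) has_real_derivative grad \<phi> x \<bullet> e) (at 0)"
          by (simp add: has_field_derivative_def mult_commute_abs)
        then have "((\<lambda>h. (\<phi> (x + h *\<^sub>R e) - \<phi> x) / h) \<longlongrightarrow> grad \<phi> x \<bullet> e) (at 0)"
          by (simp add: DERIV_def)
        moreover have "filterlim t (at 0) sequentially"
          using t0 t(1) by (simp add: filterlim_at less_imp_neq[symmetric] order_less_imp_not_eq2)
        ultimately show "(\<lambda>n. f n x) \<longlonglongrightarrow> grad \<phi> x \<bullet> e"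
          unfolding f_def by (rule filterlim_compose)
      qed
      show "AE x in lborel. norm (f n x) \<le> indicator (cball 0 (R + 2)) x *\<^sub>R \<bar>C\<bar>" for n
      proof (intro AE_I2)
        fix x
        show "norm (f n x) \<le> indicator (cball 0 (R + 2)) x *\<^sub>R \<bar>C\<bar>"
        proof (cases "x \<in> cball 0 (R + 2)")
          case True
          have "\<bar>\<phi> (x + t n *\<^sub>R e) - \<phi> x\<bar> \<le> \<bar>C\<bar> * t n"
            using lip[of "x + t n *\<^sub>R e" x] e t(1)[of n] by simp
          then show ?thesis using True t(1)[of n] by (simp add: f_def field_simps)
        next
          case False
          have "x \<notin> S" using False R(2)[of x] by auto
          moreover have "norm (x + t n *\<^sub>R e) \<ge> norm x - t n"
            using norm_diff_triangle_ineq[of x "- (t n *\<^sub>R e)"] norm_triangle_ineq4[of "x + t n *\<^sub>R e" "t n *\<^sub>R e"] e t(1)[of n] by simp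
          then have "x + t n *\<^sub>R e \<notin> S" using False R(2)[of "x + t n *\<^sub>R e"] t(2)[of n] by auto
          ultimately show ?thesis using z(1) by (simp add: f_def)
        qed
      qed
    qed (use \<phi> in measurable)
    moreover have "integral\<^sup>L lborel (f n) = 0" for n
    proof -
      have eq: "integral\<^sup>L lborel (\<lambda>x. \<phi> (x + t n *\<^sub>R e)) = integral\<^sup>L lborel \<phi>"
        using integral_distr[of "(+) (t n *\<^sub>R e)" lborel borel \<phi>] lborel_distr_plus[of "t n *\<^sub>R e"]
        by (simp add: add.commute)
      have "integrable lborel (\<lambda>x. \<phi> (x + t n *\<^sub>R e))"
        using integrable_distr_eq[of "(+) (t n *\<^sub>R e)" lborel borel \<phi>] lborel_distr_plus[of "t n *\<^sub>R e"] int_\<phi>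
        by (simp add: add.commute)
      then show ?thesis unfolding f_def using eq int_\<phi> by simp
    qed
    ultimately have "integral\<^sup>L lborel (\<lambda>x. grad \<phi> x \<bullet> e) = 0"
      by (simp add: LIMSEQ_const_iff)
    then show ?thesis using int by simp
  qed
  then have "integral\<^sup>L lborel (grad \<phi>) \<bullet> axis i 1 = 0" for i :: 'd by simp
  then show "integral\<^sup>L lborel (grad \<phi>) = 0"
    by (simp add: vec_eq_iff inner_axis)
qed

text \<open>Only \<open>\<eta>\<close> has its support inside the domain, but then so has
  \<open>\<eta> * \<phi>\<close>, whose gradient integrates to zero; the product rule does the rest.
  Thus \<open>\<phi>\<close> may be nonzero at the boundary, as are the functions that approximate
  elements of \<open>H1_zero_on\<close>.\<close>

lemma weak_grad_test:
  assumes "open \<Omega>" and \<phi>: "\<phi> \<in> test_functions (U :: (real^'d) set)"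
    and \<Omega>: "bounded \<Omega>"
  shows "is_weak_grad \<Omega> \<phi> (grad \<phi>)"
  unfolding is_weak_grad_def
proof
  fix \<eta> assume \<eta>: "\<eta> \<in> test_functions \<Omega>"
  have \<Omega>s: "\<Omega> \<in> sets lebesgue" using assms by auto
  have "(\<lambda>x. \<eta> x * \<phi> x) \<in> test_functions \<Omega>"
    by (rule test_mult[OF \<eta> test_functionsD(1)[OF \<phi>]])
  then have m: "(\<lambda>x. \<eta> x * \<phi> x) \<in> test_functions UNIV" by (auto simp: test_functions_def)
  have g: "grad (\<lambda>x. \<eta> x * \<phi> x) x = \<eta> x *\<^sub>R grad \<phi> x + \<phi> x *\<^sub>R grad \<eta> x" for x
    by (rule grad_mult[OF test_functionsD(2)[OF \<eta>] test_functionsD(2)[OF \<phi>]])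
  have z: "grad (\<lambda>x. \<eta> x * \<phi> x) x = 0" if "x \<notin> \<Omega>" for x
  proof -
    have x: "x \<notin> closure {x. \<eta> x \<noteq> 0}" using that test_functionsD(6)[OF \<eta>] by blast
    show ?thesis using zero_outside[OF x] grad_zero_outside[OF x] by (simp add: g)
  qed
  have meas: "grad (\<lambda>x. \<eta> x * \<phi> x) \<in> borel_measurable lborel"
    using test_functionsD(4)[OF m] by (simp add: borel_measurable_continuous_onI)
  have "integral\<^sup>L (lebesgue_on \<Omega>) (grad (\<lambda>x. \<eta> x * \<phi> x)) =
      integral\<^sup>L lebesgue (\<lambda>x. indicator \<Omega> x *\<^sub>R grad (\<lambda>x. \<eta> x * \<phi> x) x)"
    by (rule integral_restrict_space) (use \<Omega>s in simp)
  also have "(\<lambda>x. indicator \<Omega> x *\<^sub>R grad (\<lambda>x. \<eta> x * \<phi> x) x) = grad (\<lambda>x. \<eta> x * \<phi> x)"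
    using z by (auto simp: fun_eq_iff indicator_def)
  also have "integral\<^sup>L lebesgue (grad (\<lambda>x. \<eta> x * \<phi> x)) = 0"
    using integral_completion[OF meas] integral_grad_zero(2)[OF m] by simp
  finally have 0: "integral\<^sup>L (lebesgue_on \<Omega>) (\<lambda>x. \<eta> x *\<^sub>R grad \<phi> x + \<phi> x *\<^sub>R grad \<eta> x) = 0"
    by (simp add: g[abs_def])
  have int: "integrable (lebesgue_on \<Omega>) f" if "continuous_on UNIV f" for f :: "real^'d \<Rightarrow> real^'d"
  proof -
    have "integrable (lebesgue_on \<Omega>) (\<lambda>x. f x \<bullet> axis i 1)" for i
      by (intro ip_integrable continuous_sqint assms(1) \<Omega> that continuous_on_const)
    then have "integrable (lebesgue_on \<Omega>) (\<lambda>x. \<Sum>i\<in>UNIV. (f x $ i) *\<^sub>R axis i (1::real))"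
      by (intro Bochner_Integration.integrable_sum integrable_scaleR_left) (simp add: inner_axis)
    moreover have "(\<lambda>x. \<Sum>i\<in>UNIV. (f x $ i) *\<^sub>R axis i (1::real)) = f"
      by (simp add: basis_expansion flip: scalar_mult_eq_scaleR)
    ultimately show ?thesis by simp
  qed
  have "integrable (lebesgue_on \<Omega>) (\<lambda>x. \<eta> x *\<^sub>R grad \<phi> x)" "integrable (lebesgue_on \<Omega>) (\<lambda>x. \<phi> x *\<^sub>R grad \<eta> x)"
    using test_functionsD(3,4)[OF \<eta>] test_functionsD(3,4)[OF \<phi>]
    by (auto intro!: int continuous_on_scaleR)
  then show "integral\<^sup>L (lebesgue_on \<Omega>) (\<lambda>x. \<phi> x *\<^sub>R grad \<eta> x) =
      - integral\<^sup>L (lebesgue_on \<Omega>) (\<lambda>x. \<eta> x *\<^sub>R grad \<phi> x)"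
    using 0 by (simp add: add_eq_0_iff)
qed

subsection \<open>Bump functions\<close>

text \<open>This family is closed under differentiation up to linear combinations,
  so smoothness needs no explicit higher derivatives.\<close>

definition flat :: "nat \<Rightarrow> real \<Rightarrow> real" where
  "flat k t = (if t \<le> 0 then 0 else exp (- 1 / t) / t ^ k)"

text \<open>Substituting \<open>inverse t\<close> turns the right-hand limit into a power over an
  exponential at infinity.\<close>

lemma flat_tendsto_0: "(flat k \<longlongrightarrow> 0) (at 0)"
proof (rule filterlim_split_at)
  show "(flat k \<longlongrightarrow> 0) (at_left 0)"
    by (rule tendsto_eventually) (auto simp: flat_def eventually_at_filter)
  have "((\<lambda>t::real. inverse t ^ k / exp (inverse t)) \<longlongrightarrow> 0) (at_right 0)"
    by (rule filterlim_compose[OF tendsto_power_div_exp_0 filterlim_inverse_at_top_right])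
  then show "(flat k \<longlongrightarrow> 0) (at_right 0)"
    by (rule Lim_transform_eventually)
      (auto simp: flat_def eventually_at_filter exp_minus field_simps)
qed

lemma flat_deriv: "(flat k has_real_derivative (flat (k + 2) t - real k * flat (k + 1) t)) (at t)"
proof -
  consider "t < 0" | "t = 0" | "t > 0" by linarith
  then show ?thesis
  proof cases
    case 1
    have "((\<lambda>t. 0) has_real_derivative 0) (at t)" by simp
    then have "(flat k has_real_derivative 0) (at t)"
      by (rule has_field_derivative_transform_within_open[where S = "{..<0}"]) (use 1 in \<open>auto simp: flat_def\<close>)
    then show ?thesis using 1 by (simp add: flat_def)
  next
    case 2
    \<comment> \<open>The difference quotient of \<open>flat k\<close> at 0 is
      \<open>flat (Suc k)\<close>.\<close>
    have "((\<lambda>h. flat k h / h) \<longlongrightarrow> 0) (at 0)"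
      by (rule Lim_transform_eventually[OF flat_tendsto_0[of "Suc k"]])
        (auto simp: flat_def eventually_at_filter field_simps)
    then show ?thesis using 2 by (simp add: DERIV_def flat_def)
  next
    case 3
    have "((\<lambda>t. exp (- 1 / t) / t ^ k) has_real_derivative
        (exp (- 1 / t) / t ^ (k + 2) - real k * (exp (- 1 / t) / t ^ (k + 1)))) (at t)"
    proof (cases k)
      case 0
      then show ?thesis using 3 by (auto intro!: derivative_eq_intros simp: field_simps power2_eq_square)
    next
      case (Suc n)
      have "n = 0 \<or> t ^ n = t * t ^ (n - Suc 0)" by (cases n) auto
      then show ?thesis using 3 Suc
        by (auto intro!: derivative_eq_intros simp: field_simps power2_eq_square)
    qed
    then have "(flat k has_real_derivative
        (exp (- 1 / t) / t ^ (k + 2) - real k * (exp (- 1 / t) / t ^ (k + 1)))) (at t)"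
      by (rule has_field_derivative_transform_within_open[where S = "{0<..}"]) (use 3 in \<open>auto simp: flat_def\<close>)
    then show ?thesis using 3 by (simp add: flat_def)
  qed
qed

lemma Ck_flat: "Ck m (\<lambda>x::real^'d. flat k (a * x $ i + b))"
proof (induction m arbitrary: k)
  case 0
  have "continuous_on UNIV (flat k)"
    by (meson DERIV_continuous_on flat_deriv has_field_derivative_at_within)
  then show ?case
    by (auto intro!: continuous_on_compose2[of UNIV "flat k"] continuous_intros)
next
  case (Suc m)
  let ?d = "\<lambda>x::real^'d. flat (k + 2) (a * x $ i + b) + (- real k) * flat (k + 1) (a * x $ i + b)"
  have D: "((\<lambda>x. flat k (a * x $ i + b)) has_derivative (\<lambda>h. (a * ?d x) *\<^sub>R axis i 1 \<bullet> h)) (at x)" for x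
  proof -
    have "((\<lambda>x. a * x $ i + b) has_derivative (\<lambda>h. a * h $ i)) (at x)"
      by (auto intro!: derivative_eq_intros bounded_linear.has_derivative[OF bounded_linear_vec_nth])
    from has_derivative_compose[OF this flat_deriv[of k, unfolded has_field_derivative_def]]
    show ?thesis by (simp add: inner_axis' mult_ac)
  qed
  have "Ck m (\<lambda>x. grad (\<lambda>x. flat k (a * x $ i + b)) x $ j)" for j
  proof -
    have "(\<lambda>x. grad (\<lambda>x. flat k (a * x $ i + b)) x $ j) = (\<lambda>x. (if j = i then a else 0) * ?d x)"
      unfolding grad_unique[OF D] by (auto simp: axis_def)
    then show ?thesis
      by (simp only:) (intro Ck_mult Ck_add Ck_const Suc.IH)
  qed
  moreover have "(\<lambda>x. flat k (a * x $ i + b)) differentiable_on UNIV"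
    using D unfolding differentiable_on_def differentiable_def by auto
  ultimately show ?case by simp
qed

lemma flat_0_range: "0 \<le> flat 0 t" "flat 0 t \<le> 1"
  by (auto simp: flat_def)

text \<open>\<open>flat 0 (Suc n * c)\<close> tends to 1 for \<open>c > 0\<close> and is 0 for
  \<open>c \<le> 0\<close>, so the product over the signed distances to all faces is a smooth cutoff
  vanishing off the open box. Its support can fill the closed box, whence the assumption on
  \<open>cbox a b\<close>.\<close>

lemma indicator_box_limit:
  fixes a b :: "real^'d"
  assumes "cbox a b \<subseteq> \<Omega>"
  obtains \<phi> where "\<And>n::nat. \<phi> n \<in> test_functions \<Omega>" "\<And>n x. \<bar>\<phi> n x\<bar> \<le> indicator (box a b) x"
    "\<And>x. (\<lambda>n. \<phi> n x) \<longlonglongrightarrow> indicator (box a b) x"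
proof -
  define \<phi> where "\<phi> n x = (\<Prod>i\<in>UNIV. flat 0 (real (Suc n) * (x $ i - a $ i)) * flat 0 (real (Suc n) * (b $ i - x $ i)))"
    for n and x :: "real^'d"
  have zero: "\<phi> n x = 0" if outside: "x \<notin> box a b" for n x
  proof -
    obtain i where "\<not> (a $ i < x $ i \<and> x $ i < b $ i)" using outside unfolding mem_box_cart by blast
    then have "flat 0 (real (Suc n) * (x $ i - a $ i)) * flat 0 (real (Suc n) * (b $ i - x $ i)) = 0"
      by (auto simp: flat_def mult_le_0_iff not_less)
    then show ?thesis unfolding \<phi>_def by (intro prod_zero) auto
  qed
  have supp: "closure {x. \<phi> n x \<noteq> 0} \<subseteq> cbox a b" for n
    by (rule closure_minimal) (use zero box_subset_cbox in fastforce)+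
  show thesis
  proof
    fix n
    have "Ck k (\<phi> n)" for k
    proof -
      have "Ck k (\<lambda>x. \<Prod>i\<in>UNIV. flat 0 (real (Suc n) * x $ i + (- (real (Suc n) * a $ i))) *
          flat 0 ((- real (Suc n)) * x $ i + real (Suc n) * b $ i))"
        by (intro Ck_prod Ck_mult Ck_flat) auto
      then show ?thesis by (simp add: \<phi>_def[abs_def] algebra_simps)
    qed
    moreover have "compact (closure {x. \<phi> n x \<noteq> 0})"
      using supp[of n] by (meson bounded_cbox bounded_subset closed_closure compact_eq_bounded_closed)
    ultimately show "\<phi> n \<in> test_functions \<Omega>"
      using supp[of n] assms by (auto simp: test_functions_def)
  next
    fix n x
    have "0 \<le> \<phi> n x" unfolding \<phi>_def by (intro prod_nonneg) (simp add: flat_0_range)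
    moreover have "\<phi> n x \<le> 1" unfolding \<phi>_def
      by (intro prod_le_1) (simp add: flat_0_range mult_le_one)
    ultimately show "\<bar>\<phi> n x\<bar> \<le> indicator (box a b) x"
      using zero[of x n] by (auto simp: indicator_def)
  next
    fix x
    show "(\<lambda>n. \<phi> n x) \<longlonglongrightarrow> indicator (box a b) x"
    proof (cases "x \<in> box a b")
      case True
      have lim: "(\<lambda>n. flat 0 (real (Suc n) * c)) \<longlonglongrightarrow> 1" if "c > 0" for c
      proof -
        have "(\<lambda>n. exp (- ((1 / c) * (1 / real (Suc n))))) \<longlonglongrightarrow> exp (- ((1 / c) * 0))"
          by (intro tendsto_intros LIMSEQ_Suc[OF lim_1_over_n])
        moreover have "flat 0 (real (Suc n) * c) = exp (- ((1 / c) * (1 / real (Suc n))))" for n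
        proof -
          have "0 < real (Suc n) * c" using that by simp
          then show ?thesis using that by (simp add: flat_def not_le field_simps)
        qed
        ultimately show ?thesis by simp
      qed
      have "(\<lambda>n. \<phi> n x) \<longlonglongrightarrow> (\<Prod>i\<in>(UNIV::'d set). 1 * 1)"
        unfolding \<phi>_def using True by (intro tendsto_prod tendsto_mult lim) (auto simp: mem_box_cart)
      then show ?thesis using True by simp
    qed (simp add: zero)
  qed
qed

subsection \<open>The fundamental lemma of the calculus of variations\<close>

text \<open>Open boxes form an intersection-stable generator of the Borel sets, so Dynkin's argument
  extends vanishing integrals from boxes to all Borel \<open>A\<close>. Intersecting with
  \<open>box c d\<close> keeps every box where the hypothesis applies and makes the complement step
  work.\<close>

lemma AE_zero_if_box_integrals_zero:
  fixes g :: "real^'d \<Rightarrow> real"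
  assumes g: "integrable lborel g" 
    and zero: "\<And>a b. box a b \<subseteq> box c d \<Longrightarrow> (LINT x:box a b|lborel. g x) = 0"
  shows "AE x in lborel. x \<in> box c d \<longrightarrow> g x = 0"
proof -
  have int: "set_integrable lborel A g" if "A \<in> sets borel" for A
    unfolding set_integrable_def using g that by (intro integrable_mult_indicator) auto
  have Z: "(LINT x:A \<inter> box c d|lborel. g x) = 0" if "A \<in> sets borel" for A
  proof -
    have 1: "Int_stable (range (\<lambda>(a, b). box a b :: (real^'d) set))"
      by (auto simp: Int_stable_def box_Int_box)
    have 2: "range (\<lambda>(a, b). box a b :: (real^'d) set) \<subseteq> Pow UNIV" by simp
    have 3: "A \<in> sigma_sets UNIV (range (\<lambda>(a, b). box a b :: (real^'d) set))"
      using that unfolding borel_eq_box by simp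
    show ?thesis using 1 2 3
    proof (induction A rule: sigma_sets_induct_disjoint)
      case (basic A)
      then show ?case by (auto simp: box_Int_box intro!: zero) (auto simp flip: box_Int_box)
    next
      case empty
      then show ?case by (simp add: set_lebesgue_integral_def)
    next
      case (compl A)
      then have A: "A \<in> sets borel" unfolding borel_eq_box by simp
      have "(LINT x:box c d|lborel. g x) = (LINT x:A \<inter> box c d|lborel. g x) + (LINT x:(UNIV - A) \<inter> box c d|lborel. g x)"
        by (subst set_integral_Un[symmetric]) (use A in \<open>auto intro!: int arg_cong[where f = "\<lambda>A. LINT x:A|lborel. g x"]\<close>)
      then show ?case using zero[of c d] compl by simp
    next
      case (union A)
      then have A: "A i \<in> sets borel" for i unfolding borel_eq_box by auto
      have "(\<Union>i. A i) \<inter> box c d = (\<Union>i. A i \<inter> box c d)" by auto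
      moreover have "(LINT x:(\<Union>i. A i \<inter> box c d)|lborel. g x) = (\<Sum>i. LINT x:A i \<inter> box c d|lborel. g x)"
        by (rule lebesgue_integral_countable_add)
          (use A union in \<open>auto simp: disjoint_family_on_def intro!: int\<close>)
      ultimately show ?case using union by simp
    qed
  qed
  have "AE x in lborel. indicator (box c d) x * g x = 0"
  proof (rule density_unique_real)
    show "integrable lborel (\<lambda>x. indicator (box c d) x * g x)"
      using int[of "box c d"] by (simp add: set_integrable_def)
    show "(LINT x:A|lborel. indicator (box c d) x * g x) = (LINT x:A|lborel. 0)" if "A \<in> sets lborel" for A
      using Z[of A] that by (simp add: set_lebesgue_integral_def indicator_inter_arith mult.assoc)
  qed simp
  then show ?thesis by eventually_elim (auto simp: indicator_def)
qed

lemma fundamental_lemma: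
  fixes g :: "real^'d \<Rightarrow> real"
  assumes \<Omega>: "open \<Omega>" and g: "integrable (lebesgue_on \<Omega>) g"
    and zero: "\<And>\<phi>. \<phi> \<in> test_functions \<Omega> \<Longrightarrow> integral\<^sup>L (lebesgue_on \<Omega>) (\<lambda>x. g x * \<phi> x) = 0"
  shows "AE x in lebesgue_on \<Omega>. g x = 0"
proof -
  have \<Omega>s: "\<Omega> \<in> sets lebesgue" using \<Omega> by auto
  define g0 where "g0 x = indicator \<Omega> x * g x" for x
  have g0: "integrable lebesgue g0"
    using g \<Omega>s by (simp add: integrable_restrict_space g0_def[abs_def])
  \<comment> \<open>A Borel representative, since the box argument runs over \<open>lborel\<close>
    and not over its completion.\<close>
  then obtain g1 where g1: "g1 \<in> borel_measurable lborel" "AE x in lborel. g0 x = g1 x"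
    using completion_ex_borel_measurable_real[of g0 lborel] borel_measurable_integrable by blast
  have AE1: "AE x in lebesgue. g0 x = g1 x" using g1(2) by (rule AE_completion)
  have int1: "integrable lborel g1"
    using integrable_cong_AE[OF _ _ AE1] g0 g1(1) borel_measurable_integrable[OF g0]
    by (simp add: integrable_completion measurable_completion)
  have box0: "(LINT x:box a b|lborel. g1 x) = 0" if "box a b \<subseteq> box c d" "cbox c d \<subseteq> \<Omega>" for a b c d
  proof (cases "box a b = {}")
    case False
    then have "cbox a b = closure (box a b)" by (simp add: closure_box)
    also have "\<dots> \<subseteq> cbox c d" using that(1) box_subset_cbox by (intro closure_minimal) auto
    finally have "cbox a b \<subseteq> \<Omega>" using that(2) by simp
    then obtain \<phi> where \<phi>: "\<And>n::nat. \<phi> n \<in> test_functions \<Omega>" "\<And>n x. \<bar>\<phi> n x\<bar> \<le> indicator (box a b) x"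
      "\<And>x. (\<lambda>n. \<phi> n x) \<longlonglongrightarrow> indicator (box a b) x" by (rule indicator_box_limit) (rule that)
    have meas: "\<phi> n \<in> borel_measurable borel" for n
      using test_functionsD(3)[OF \<phi>(1)] by (rule borel_measurable_continuous_onI)
    have "(\<lambda>n. integral\<^sup>L lborel (\<lambda>x. g1 x * \<phi> n x)) \<longlonglongrightarrow> integral\<^sup>L lborel (\<lambda>x. g1 x * indicator (box a b) x)"
    proof (rule integral_dominated_convergence[where w = "\<lambda>x. \<bar>g1 x\<bar>"])
      show "AE x in lborel. norm (g1 x * \<phi> n x) \<le> \<bar>g1 x\<bar>" for n
      proof (intro AE_I2)
        fix x
        have "\<bar>\<phi> n x\<bar> \<le> 1" using \<phi>(2)[of n x] by (rule order_trans) (simp add: indicator_def)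
        then show "norm (g1 x * \<phi> n x) \<le> \<bar>g1 x\<bar>" by (simp add: abs_mult mult_left_le)
      qed
      show "AE x in lborel. (\<lambda>n. g1 x * \<phi> n x) \<longlonglongrightarrow> g1 x * indicator (box a b) x"
        by (intro AE_I2 tendsto_intros \<phi>)
    qed (use g1(1) meas int1 in \<open>auto intro!: integrable_abs\<close>)
    moreover have "integral\<^sup>L lborel (\<lambda>x. g1 x * \<phi> n x) = 0" for n
    proof -
      have m: "\<phi> n \<in> borel_measurable lebesgue" using meas by (simp add: measurable_completion)
      have "0 = integral\<^sup>L (lebesgue_on \<Omega>) (\<lambda>x. g x * \<phi> n x)" using zero[OF \<phi>(1)] by simp
      also have "\<dots> = integral\<^sup>L lebesgue (\<lambda>x. g0 x * \<phi> n x)"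
        using \<Omega>s by (simp add: integral_restrict_space g0_def mult.assoc)
      also have "\<dots> = integral\<^sup>L lebesgue (\<lambda>x. g1 x * \<phi> n x)"
        by (rule integral_cong_AE)
          (use AE1 m borel_measurable_integrable[OF g0] measurable_completion[OF g1(1)] in \<open>auto\<close>)
      also have "\<dots> = integral\<^sup>L lborel (\<lambda>x. g1 x * \<phi> n x)"
        by (rule integral_completion) (use g1(1) meas in measurable)
      finally show ?thesis by simp
    qed
    ultimately show ?thesis
      by (simp add: LIMSEQ_const_iff set_lebesgue_integral_def mult.commute)
  qed (simp add: set_lebesgue_integral_def)
  \<comment> \<open>Countably many closed boxes fill the domain; the faces lost by passing to open
    boxes are negligible.\<close>
  obtain D where D: "countable D" "D \<subseteq> Pow \<Omega>" "\<And>X. X \<in> D \<Longrightarrow> \<exists>a b. X = cbox a b" "\<Union>D = \<Omega>"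
    using open_countable_Union_open_cbox[OF \<Omega>] by metis
  have "AE x in lebesgue. x \<in> X \<longrightarrow> g1 x = 0" if X: "X \<in> D" for X
  proof -
    obtain c d where X': "X = cbox c d" using D(3)[OF X] by blast
    then have "cbox c d \<subseteq> \<Omega>" using D(2) X by blast
    then have "AE x in lborel. x \<in> box c d \<longrightarrow> g1 x = 0"
      by (intro AE_zero_if_box_integrals_zero int1 box0)
    then have "AE x in lebesgue. x \<in> box c d \<longrightarrow> g1 x = 0" by (rule AE_completion)
    moreover have "AE x in lebesgue. x \<notin> cbox c d - box c d"
      by (rule AE_not_in[OF negligible_frontier_interval[unfolded negligible_iff_null_sets]])
    ultimately show ?thesis by eventually_elim (simp add: X')
  qed
  then have "AE x in lebesgue. \<forall>X\<in>D. x \<in> X \<longrightarrow> g1 x = 0"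
    by (subst AE_ball_countable[OF D(1)]) blast
  with AE1 have "AE x in lebesgue. x \<in> \<Omega> \<longrightarrow> g x = 0"
    by eventually_elim (use D(4) in \<open>auto simp: g0_def indicator_def split: if_splits\<close>)
  then show ?thesis using \<Omega>s by (simp add: AE_restrict_space_iff)
qed

section \<open>A Poincare inequality\<close>

definition grad_energy :: "(real^'d) set \<Rightarrow> (real^'d \<Rightarrow> real) \<Rightarrow> ennreal" where
  "grad_energy \<Omega> \<phi> = (\<integral>\<^sup>+x. indicator \<Omega> x * ennreal ((norm (grad \<phi> x))\<^sup>2) \<partial>lborel)"

text \<open>The constant may depend on everything except \<open>\<phi>\<close>. Extended nonnegative
  integrals over \<open>lborel\<close> permit Fubini and translations without integrability
  conditions, and measuring the energy over all of \<open>\<Omega>\<close> lets bounds for different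
  \<open>E\<close> be added.\<close>

definition controlled :: "(real^'d) set \<Rightarrow> (real^'d) set \<Rightarrow> (real^'d) set \<Rightarrow> bool" where
  "controlled \<Omega> U E \<longleftrightarrow> (\<exists>C::real. \<forall>\<phi>\<in>test_functions U.
     (\<integral>\<^sup>+x. indicator E x * ennreal ((\<phi> x)\<^sup>2) \<partial>lborel) \<le> ennreal C * grad_energy \<Omega> \<phi>)"

lemma controlled_subset:
  assumes "controlled \<Omega> U E" "E' \<subseteq> E"
  shows "controlled \<Omega> U E'"
proof -
  have "(\<integral>\<^sup>+x. indicator E' x * ennreal ((\<phi> x)\<^sup>2) \<partial>lborel) \<le> (\<integral>\<^sup>+x. indicator E x * ennreal ((\<phi> x)\<^sup>2) \<partial>lborel)" for \<phi>
    using assms(2) by (intro nn_integral_mono mult_right_mono) (auto simp: indicator_def)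
  then show ?thesis using assms(1) unfolding controlled_def by (meson order_trans)
qed

lemma borel_measurable_test:
  assumes "\<phi> \<in> test_functions U"
  shows "\<phi> \<in> borel_measurable borel" "grad \<phi> \<in> borel_measurable borel"
  using test_functionsD(3,4)[OF assms] by (auto intro: borel_measurable_continuous_onI)

lemma controlledE:
  assumes "controlled \<Omega> U E"
  obtains C where "C \<ge> 0" "\<And>\<phi>. \<phi> \<in> test_functions U \<Longrightarrow>
      (\<integral>\<^sup>+x. indicator E x * ennreal ((\<phi> x)\<^sup>2) \<partial>lborel) \<le> ennreal C * grad_energy \<Omega> \<phi>"
proof -
  obtain C where C: "\<And>\<phi>. \<phi> \<in> test_functions U \<Longrightarrow>
      (\<integral>\<^sup>+x. indicator E x * ennreal ((\<phi> x)\<^sup>2) \<partial>lborel) \<le> ennreal C * grad_energy \<Omega> \<phi>"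
    using assms unfolding controlled_def by blast
  show thesis
  proof (rule that)
    fix \<phi> assume "\<phi> \<in> test_functions U"
    from C[OF this] show "(\<integral>\<^sup>+x. indicator E x * ennreal ((\<phi> x)\<^sup>2) \<partial>lborel) \<le> ennreal \<bar>C\<bar> * grad_energy \<Omega> \<phi>"
      by (rule order_trans) (intro mult_right_mono ennreal_leI, auto)
  qed simp
qed

lemma controlled_Un:
  assumes "controlled \<Omega> U E" "controlled \<Omega> U E'" and [measurable]: "E \<in> sets borel" "E' \<in> sets borel"
  shows "controlled \<Omega> U (E \<union> E')"
proof -
  obtain C where C: "C \<ge> 0" "\<And>\<phi>. \<phi> \<in> test_functions U \<Longrightarrow>
      (\<integral>\<^sup>+x. indicator E x * ennreal ((\<phi> x)\<^sup>2) \<partial>lborel) \<le> ennreal C * grad_energy \<Omega> \<phi>"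
    using assms(1) by (rule controlledE) (rule that)
  obtain C' where C': "C' \<ge> 0" "\<And>\<phi>. \<phi> \<in> test_functions U \<Longrightarrow>
      (\<integral>\<^sup>+x. indicator E' x * ennreal ((\<phi> x)\<^sup>2) \<partial>lborel) \<le> ennreal C' * grad_energy \<Omega> \<phi>"
    using assms(2) by (rule controlledE) (rule that)
  show ?thesis unfolding controlled_def
  proof (intro exI ballI)
    fix \<phi> assume \<phi>: "\<phi> \<in> test_functions U"
    note [measurable] = borel_measurable_test(1)[OF \<phi>]
    have "(\<integral>\<^sup>+x. indicator (E \<union> E') x * ennreal ((\<phi> x)\<^sup>2) \<partial>lborel) \<le>
        (\<integral>\<^sup>+x. indicator E x * ennreal ((\<phi> x)\<^sup>2) + indicator E' x * ennreal ((\<phi> x)\<^sup>2) \<partial>lborel)"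
      by (intro nn_integral_mono) (auto simp: indicator_def)
    also have "\<dots> = (\<integral>\<^sup>+x. indicator E x * ennreal ((\<phi> x)\<^sup>2) \<partial>lborel) + (\<integral>\<^sup>+x. indicator E' x * ennreal ((\<phi> x)\<^sup>2) \<partial>lborel)"
      by (rule nn_integral_add) measurable
    also have "\<dots> \<le> ennreal C * grad_energy \<Omega> \<phi> + ennreal C' * grad_energy \<Omega> \<phi>"
      by (intro add_mono C C' \<phi>)
    also have "\<dots> = ennreal (C + C') * grad_energy \<Omega> \<phi>"
      using C(1) C'(1) by (simp add: distrib_right)
    finally show "(\<integral>\<^sup>+x. indicator (E \<union> E') x * ennreal ((\<phi> x)\<^sup>2) \<partial>lborel) \<le> ennreal (C + C') * grad_energy \<Omega> \<phi>" .
  qed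
qed

lemma controlled_Union:
  assumes "finite A" "\<And>E. E \<in> A \<Longrightarrow> controlled \<Omega> U E" "A \<subseteq> sets borel"
  shows "controlled \<Omega> U (\<Union>A)"
  using assms
proof (induction A)
  case empty
  then show ?case by (auto simp: controlled_def intro: exI[of _ 0])
next
  case (insert E A)
  have "\<Union>A \<in> sets borel" using insert by (intro sets.finite_Union) auto
  then show ?case using insert by (auto intro!: controlled_Un)
qed

text \<open>Expand the square of \<open>p - m\<close> with \<open>m\<close> the integral itself
  rather than the mean: nothing is divided by \<open>s\<close>, and \<open>s \<le> 1\<close> absorbs
  the leftover \<open>m\<^sup>2 * s\<close>.\<close>

lemma square_integral_le:
  fixes p :: "real \<Rightarrow> real"
  assumes "continuous_on {0..s} p" "0 \<le> s" "s \<le> 1"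
  shows "(integral {0..s} p)\<^sup>2 \<le> integral {0..s} (\<lambda>t. (p t)\<^sup>2)"
proof -
  define m where "m = integral {0..s} p"
  have int: "p integrable_on {0..s}" "(\<lambda>t. (p t)\<^sup>2) integrable_on {0..s}"
    using assms(1) by (auto intro!: integrable_continuous_interval continuous_intros)
  have "0 \<le> integral {0..s} (\<lambda>t. (p t - m)\<^sup>2)"
    by (intro integral_nonneg integrable_continuous_interval) (auto intro!: continuous_intros assms)
  also have "(\<lambda>t. (p t - m)\<^sup>2) = (\<lambda>t. (p t)\<^sup>2 - 2 * m * p t + m\<^sup>2)"
    by (simp add: power2_diff fun_eq_iff)
  also have "integral {0..s} \<dots> = integral {0..s} (\<lambda>t. (p t)\<^sup>2) - 2 * m * m + m\<^sup>2 * s"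
  proof -
    have "((\<lambda>t. m\<^sup>2) has_integral s * m\<^sup>2) {0..s}"
      using has_integral_const_real[of "m\<^sup>2" 0 s] assms(2) by simp
    then have "((\<lambda>t. (p t)\<^sup>2 - 2 * m * p t + m\<^sup>2) has_integral
        (integral {0..s} (\<lambda>t. (p t)\<^sup>2) - 2 * m * integral {0..s} p + s * m\<^sup>2)) {0..s}"
      using int by (intro has_integral_add has_integral_diff has_integral_mult_right integrable_integral)
    then show ?thesis by (simp add: integral_unique m_def mult.commute)
  qed
  finally have "2 * m * m - m\<^sup>2 * s \<le> integral {0..s} (\<lambda>t. (p t)\<^sup>2)" by simp
  moreover have "m\<^sup>2 * s \<le> m\<^sup>2 * 1" using assms by (intro mult_left_mono) auto
  ultimately show ?thesis by (simp add: m_def power2_eq_square)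
qed

text \<open>The full parameter range and the cutoff by \<open>\<Omega>\<close> make this independent
  of where a segment stops: it bounds increments over every shorter piece inside
  \<open>\<Omega>\<close> and still integrates over \<open>x\<close> to exactly the gradient
  energy.\<close>

definition line_energy :: "(real^'d) set \<Rightarrow> (real^'d \<Rightarrow> real) \<Rightarrow> real^'d \<Rightarrow> real^'d \<Rightarrow> ennreal" where
  "line_energy \<Omega> \<phi> h x = (\<integral>\<^sup>+t. indicator {0..1} t *
     (indicator \<Omega> (x + t *\<^sub>R h) * ennreal ((norm (grad \<phi> (x + t *\<^sub>R h)))\<^sup>2)) \<partial>lborel)"

text \<open>Fundamental theorem of calculus along the segment, then
  \<open>square_integral_le\<close> and Cauchy-Schwarz in space. The condition \<open>seg\<close> is
  confined to the open parameter interval because the end of a segment will be a boundary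
  point.\<close>

lemma segment_estimate:
  assumes \<Omega>: "\<Omega> \<in> sets borel" and \<phi>: "\<phi> \<in> test_functions U" and s: "0 \<le> s" "s \<le> 1"
    and seg: "\<And>t. 0 < t \<Longrightarrow> t < s \<Longrightarrow> x + t *\<^sub>R h \<in> \<Omega>"
  shows "ennreal ((\<phi> (x + s *\<^sub>R h) - \<phi> x)\<^sup>2) \<le> ennreal ((norm h)\<^sup>2) * line_energy \<Omega> \<phi> h x"
proof -
  define p where "p t = grad \<phi> (x + t *\<^sub>R h) \<bullet> h" for t
  have cont: "continuous_on UNIV (\<lambda>t. grad \<phi> (x + t *\<^sub>R h))"
    by (rule continuous_on_compose2[OF test_functionsD(4)[OF \<phi>]]) (auto intro!: continuous_intros)
  then have p_cont: "continuous_on A p" for A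
    unfolding p_def by (intro continuous_intros continuous_on_subset[OF cont]) auto
  have deriv: "((\<lambda>t. \<phi> (x + t *\<^sub>R h)) has_vector_derivative p t) (at t within A)" for t A
  proof -
    have "((\<lambda>t. x + t *\<^sub>R h) has_derivative (\<lambda>s. s *\<^sub>R h)) (at t within A)"
      by (auto intro!: derivative_eq_intros)
    then have "((\<lambda>t. \<phi> (x + t *\<^sub>R h)) has_derivative (\<lambda>s. grad \<phi> (x + t *\<^sub>R h) \<bullet> (s *\<^sub>R h))) (at t within A)"
      by (rule has_derivative_compose) (use has_derivative_grad[OF test_functionsD(2)[OF \<phi>]] in simp)
    then show ?thesis by (simp add: has_vector_derivative_def p_def)
  qed
  have "integral {0..s} p = \<phi> (x + s *\<^sub>R h) - \<phi> x"
    using fundamental_theorem_of_calculus[OF s(1) deriv] by (simp add: integral_unique)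
  then have "(\<phi> (x + s *\<^sub>R h) - \<phi> x)\<^sup>2 \<le> integral {0..s} (\<lambda>t. (p t)\<^sup>2)"
    using square_integral_le[OF p_cont s] by simp
  then have "ennreal ((\<phi> (x + s *\<^sub>R h) - \<phi> x)\<^sup>2) \<le> ennreal (integral {0..s} (\<lambda>t. (p t)\<^sup>2))"
    by (rule ennreal_leI)
  also have "\<dots> = (\<integral>\<^sup>+t. indicator {0..s} t * ennreal ((p t)\<^sup>2) \<partial>lborel)"
  proof -
    have "((\<lambda>t. (p t)\<^sup>2) has_integral integral {0..s} (\<lambda>t. (p t)\<^sup>2)) {0..s}"
      by (intro integrable_integral integrable_continuous_interval continuous_intros p_cont)
    then show ?thesis
      using nn_integral_has_integral_lebesgue'[of "{0..s}" "\<lambda>t. (p t)\<^sup>2"] by (simp add: mult.commute)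
  qed
  also have "\<dots> \<le> (\<integral>\<^sup>+t. ennreal ((norm h)\<^sup>2) * (indicator {0..1} t *
     (indicator \<Omega> (x + t *\<^sub>R h) * ennreal ((norm (grad \<phi> (x + t *\<^sub>R h)))\<^sup>2))) \<partial>lborel)"
  proof (rule nn_integral_mono_AE)
    have "AE t in lborel. t \<noteq> 0 \<and> t \<noteq> s"
      using AE_lborel_singleton[of 0] AE_lborel_singleton[of s] by eventually_elim simp
    then show "AE t in lborel. indicator {0..s} t * ennreal ((p t)\<^sup>2) \<le> ennreal ((norm h)\<^sup>2) *
      (indicator {0..1} t * (indicator \<Omega> (x + t *\<^sub>R h) * ennreal ((norm (grad \<phi> (x + t *\<^sub>R h)))\<^sup>2)))"
    proof eventually_elim
      case (elim t)
      show ?case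
      proof (cases "t \<in> {0..s}")
        case True
        then have "x + t *\<^sub>R h \<in> \<Omega>" using elim seg by auto
        moreover have "(p t)\<^sup>2 \<le> (norm h)\<^sup>2 * (norm (grad \<phi> (x + t *\<^sub>R h)))\<^sup>2"
        proof -
          have "\<bar>p t\<bar> \<le> norm (grad \<phi> (x + t *\<^sub>R h)) * norm h" unfolding p_def by (rule Cauchy_Schwarz_ineq2)
          then have "\<bar>p t\<bar>\<^sup>2 \<le> (norm (grad \<phi> (x + t *\<^sub>R h)) * norm h)\<^sup>2" by (rule power_mono) simp
          then show ?thesis by (simp add: power_mult_distrib mult.commute)
        qed
        ultimately show ?thesis using True s
          by (simp add: ennreal_mult[symmetric] ennreal_leI)
      qed simp
    qed
  qed
  also have "\<dots> = ennreal ((norm h)\<^sup>2) * line_energy \<Omega> \<phi> h x"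
    unfolding line_energy_def
  proof (rule nn_integral_cmult)
    have "(\<lambda>t. grad \<phi> (x + t *\<^sub>R h)) \<in> borel_measurable borel"
      using cont by (rule borel_measurable_continuous_onI)
    moreover have "(\<lambda>t. x + t *\<^sub>R h) \<in> borel_measurable borel" by measurable
    ultimately show "(\<lambda>t. indicator {0..1} t * (indicator \<Omega> (x + t *\<^sub>R h) *
        ennreal ((norm (grad \<phi> (x + t *\<^sub>R h)))\<^sup>2))) \<in> borel_measurable lborel"
      using \<Omega> by measurable
  qed
  finally show ?thesis .
qed

lemma nn_integral_translate:
  fixes f :: "real^'d \<Rightarrow> ennreal"
  assumes "f \<in> borel_measurable borel"
  shows "(\<integral>\<^sup>+x. f (x + h) \<partial>lborel) = (\<integral>\<^sup>+x. f x \<partial>lborel)"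
proof -
  have "(\<integral>\<^sup>+x. f x \<partial>lborel) = (\<integral>\<^sup>+x. f x \<partial>distr lborel borel ((+) h))"
    by (simp add: lborel_distr_plus)
  also have "\<dots> = (\<integral>\<^sup>+x. f (h + x) \<partial>lborel)"
    by (rule nn_integral_distr) (use assms in measurable)
  finally show ?thesis by (simp add: add.commute)
qed

lemma line_energy_measurable:
  assumes \<phi>: "\<phi> \<in> test_functions U" and [measurable]: "\<Omega> \<in> sets borel"
  shows "line_energy \<Omega> \<phi> h \<in> borel_measurable borel"
proof -
  note [measurable] = borel_measurable_test[OF \<phi>]
  show ?thesis unfolding line_energy_def by measurable
qed

text \<open>After Fubini every \<open>t\<close> contributes the same amount by translation
  invariance, and the parameter interval has length 1.\<close>

lemma integral_line_energy:
  fixes h :: "real^'d"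
  assumes \<phi>: "\<phi> \<in> test_functions U" and [measurable]: "\<Omega> \<in> sets borel"
  shows "(\<integral>\<^sup>+x. line_energy \<Omega> \<phi> h x \<partial>lborel) = grad_energy \<Omega> \<phi>"
proof -
  note [measurable] = borel_measurable_test[OF \<phi>]
  define G where "G x = indicator \<Omega> x * ennreal ((norm (grad \<phi> x))\<^sup>2)" for x
  have [measurable]: "G \<in> borel_measurable borel" unfolding G_def by measurable
  have "(\<integral>\<^sup>+x. line_energy \<Omega> \<phi> h x \<partial>lborel) =
      (\<integral>\<^sup>+x. (\<integral>\<^sup>+t. indicator {0..1} t * G (x + t *\<^sub>R h) \<partial>lborel) \<partial>lborel)"
    by (simp add: line_energy_def G_def)
  also have "\<dots> = (\<integral>\<^sup>+t. (\<integral>\<^sup>+x. indicator {0..1} (t::real) * G (x + t *\<^sub>R h) \<partial>lborel) \<partial>lborel)"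
    by (rule lborel_pair.Fubini') measurable
  also have "\<dots> = (\<integral>\<^sup>+t. indicator {0..1} (t::real) * grad_energy \<Omega> \<phi> \<partial>lborel)"
  proof (rule nn_integral_cong)
    fix t :: real
    have "(\<integral>\<^sup>+x. indicator {0..1} t * G (x + t *\<^sub>R h) \<partial>lborel) = indicator {0..1} t * (\<integral>\<^sup>+x. G (x + t *\<^sub>R h) \<partial>lborel)"
      by (rule nn_integral_cmult) measurable
    also have "(\<integral>\<^sup>+x. G (x + t *\<^sub>R h) \<partial>lborel) = grad_energy \<Omega> \<phi>"
      by (subst nn_integral_translate) (auto simp: grad_energy_def G_def[abs_def])
    finally show "(\<integral>\<^sup>+x. indicator {0..1} t * G (x + t *\<^sub>R h) \<partial>lborel) = indicator {0..1} t * grad_energy \<Omega> \<phi>" .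
  qed
  also have "\<dots> = grad_energy \<Omega> \<phi>"
    by (subst nn_integral_multc) auto
  finally show ?thesis .
qed

lemma controlled_translate:
  assumes \<Omega>: "\<Omega> \<in> sets borel" and E': "controlled \<Omega> U E'"
    and [measurable]: "E \<in> sets borel" "E' \<in> sets borel"
    and step: "\<And>x. x \<in> E \<Longrightarrow> x + h \<in> E'"
    and seg: "\<And>x t. x \<in> E \<Longrightarrow> 0 < t \<Longrightarrow> t < 1 \<Longrightarrow> x + t *\<^sub>R h \<in> \<Omega>"
  shows "controlled \<Omega> U E"
proof -
  obtain C where C: "C \<ge> 0" "\<And>\<phi>. \<phi> \<in> test_functions U \<Longrightarrow>
      (\<integral>\<^sup>+x. indicator E' x * ennreal ((\<phi> x)\<^sup>2) \<partial>lborel) \<le> ennreal C * grad_energy \<Omega> \<phi>"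
    using E' by (rule controlledE) (rule that)
  show ?thesis unfolding controlled_def
  proof (intro exI ballI)
    fix \<phi> assume \<phi>: "\<phi> \<in> test_functions U"
    note [measurable] = borel_measurable_test[OF \<phi>] line_energy_measurable[OF \<phi> \<Omega>]
    have "(\<integral>\<^sup>+x. indicator E x * ennreal ((\<phi> x)\<^sup>2) \<partial>lborel) \<le>
        (\<integral>\<^sup>+x. 2 * (indicator E' (x + h) * ennreal ((\<phi> (x + h))\<^sup>2)) + ennreal (2 * (norm h)\<^sup>2) * line_energy \<Omega> \<phi> h x \<partial>lborel)"
    proof (rule nn_integral_mono)
      fix x
      show "indicator E x * ennreal ((\<phi> x)\<^sup>2) \<le>
          2 * (indicator E' (x + h) * ennreal ((\<phi> (x + h))\<^sup>2)) + ennreal (2 * (norm h)\<^sup>2) * line_energy \<Omega> \<phi> h x"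
      proof (cases "x \<in> E")
        case True
        \<comment> \<open>The square whose expansion is the next estimate; its two factors 2 become
          the constant \<open>2 * C + 2 * (norm h)\<^sup>2\<close>.\<close>
        have "0 \<le> (\<phi> x - 2 * \<phi> (x + h))\<^sup>2" by simp
        then have "(\<phi> x)\<^sup>2 \<le> 2 * (\<phi> (x + h))\<^sup>2 + 2 * (\<phi> (x + h) - \<phi> x)\<^sup>2"
          by (simp add: power2_eq_square algebra_simps)
        then have "ennreal ((\<phi> x)\<^sup>2) \<le> ennreal (2 * (\<phi> (x + h))\<^sup>2 + 2 * (\<phi> (x + h) - \<phi> x)\<^sup>2)"
          by (rule ennreal_leI)
        also have "\<dots> = 2 * ennreal ((\<phi> (x + h))\<^sup>2) + 2 * ennreal ((\<phi> (x + h) - \<phi> x)\<^sup>2)"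
          by (simp add: ennreal_mult)
        also have "\<dots> \<le> 2 * ennreal ((\<phi> (x + h))\<^sup>2) + 2 * (ennreal ((norm h)\<^sup>2) * line_energy \<Omega> \<phi> h x)"
          using segment_estimate[OF \<Omega> \<phi>, of 1 x h] seg[OF True] by (intro add_left_mono mult_left_mono) auto
        finally show ?thesis using True step by (simp add: ennreal_mult mult.assoc)
      qed simp
    qed
    also have "\<dots> = (\<integral>\<^sup>+x. 2 * (indicator E' (x + h) * ennreal ((\<phi> (x + h))\<^sup>2)) \<partial>lborel) +
        (\<integral>\<^sup>+x. ennreal (2 * (norm h)\<^sup>2) * line_energy \<Omega> \<phi> h x \<partial>lborel)"
      by (rule nn_integral_add) measurable
    also have "(\<integral>\<^sup>+x. ennreal (2 * (norm h)\<^sup>2) * line_energy \<Omega> \<phi> h x \<partial>lborel) = ennreal (2 * (norm h)\<^sup>2) * grad_energy \<Omega> \<phi>"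
      by (subst nn_integral_cmult) (auto simp: integral_line_energy[OF \<phi> \<Omega>])
    also have "(\<integral>\<^sup>+x. 2 * (indicator E' (x + h) * ennreal ((\<phi> (x + h))\<^sup>2)) \<partial>lborel) =
        2 * (\<integral>\<^sup>+x. indicator E' x * ennreal ((\<phi> x)\<^sup>2) \<partial>lborel)"
      by (subst nn_integral_translate[where f = "\<lambda>x. 2 * (indicator E' x * ennreal ((\<phi> x)\<^sup>2))"]) (auto intro: nn_integral_cmult)
    also have "\<dots> \<le> 2 * (ennreal C * grad_energy \<Omega> \<phi>)"
      by (intro mult_left_mono C \<phi>) auto
    finally show "(\<integral>\<^sup>+x. indicator E x * ennreal ((\<phi> x)\<^sup>2) \<partial>lborel) \<le> ennreal (2 * C + 2 * (norm h)\<^sup>2) * grad_energy \<Omega> \<phi>"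
      using C(1) by (simp add: distrib_right ennreal_mult mult.assoc)
  qed
qed

text \<open>Test functions vanish outside \<open>U\<close>, so once the line from \<open>x\<close>
  meets such a point the value at \<open>x\<close> is itself an increment. The length
  \<open>s\<close> may vary with \<open>x\<close> because one \<open>line_energy\<close> covers all
  lengths up to 1.\<close>

lemma controlled_base:
  assumes \<Omega>: "\<Omega> \<in> sets borel"
    and exit: "\<And>x. x \<in> E \<Longrightarrow> \<exists>s. 0 \<le> s \<and> s \<le> 1 \<and> x + s *\<^sub>R h \<notin> U \<and> (\<forall>t. 0 < t \<and> t < s \<longrightarrow> x + t *\<^sub>R h \<in> \<Omega>)"
  shows "controlled \<Omega> U E"
  unfolding controlled_def
proof (intro exI ballI)
  fix \<phi> assume \<phi>: "\<phi> \<in> test_functions U"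
  note [measurable] = line_energy_measurable[OF \<phi> \<Omega>]
  have "(\<integral>\<^sup>+x. indicator E x * ennreal ((\<phi> x)\<^sup>2) \<partial>lborel) \<le> (\<integral>\<^sup>+x. ennreal ((norm h)\<^sup>2) * line_energy \<Omega> \<phi> h x \<partial>lborel)"
  proof (rule nn_integral_mono)
    fix x
    show "indicator E x * ennreal ((\<phi> x)\<^sup>2) \<le> ennreal ((norm h)\<^sup>2) * line_energy \<Omega> \<phi> h x"
    proof (cases "x \<in> E")
      case True
      then obtain s where s: "0 \<le> s" "s \<le> 1" "x + s *\<^sub>R h \<notin> U" "\<And>t. 0 < t \<Longrightarrow> t < s \<Longrightarrow> x + t *\<^sub>R h \<in> \<Omega>"
        using exit by blast
      have "\<phi> (x + s *\<^sub>R h) = 0" using s(3) test_functionsD(6)[OF \<phi>] by (intro zero_outside) blast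
      then show ?thesis using segment_estimate[OF \<Omega> \<phi> s(1,2,4)] True by simp
    qed simp
  qed
  also have "\<dots> = ennreal ((norm h)\<^sup>2) * grad_energy \<Omega> \<phi>"
    by (subst nn_integral_cmult) (auto simp: integral_line_energy[OF \<phi> \<Omega>])
  finally show "(\<integral>\<^sup>+x. indicator E x * ennreal ((\<phi> x)\<^sup>2) \<partial>lborel) \<le> ennreal ((norm h)\<^sup>2) * grad_energy \<Omega> \<phi>" .
qed

section \<open>Lipschitz charts and the spreading of local bounds\<close>

lemma in_ballI_norm: "norm ((x - z) + v) < r \<Longrightarrow> x + v \<in> ball z r"
  for x z v :: "'a::real_normed_vector"
  unfolding mem_ball dist_norm norm_minus_commute[of z "x + v"] by (simp add: algebra_simps)

text \<open>Points of the closure lie on or above the graph by continuity, and moving along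
  \<open>e\<close> raises the height while the base point in the hyperplane stays fixed. Boundary
  regularity is used below in this upward form.\<close>

lemma lipschitz_boundary_chart:
  fixes \<Omega> :: "(real^'d) set"
  assumes "lipschitz_boundary \<Omega>" "z \<in> frontier \<Omega>"
  obtains r e where "r > 0" "norm e = 1"
    "\<And>y t. y \<in> closure \<Omega> \<Longrightarrow> y \<in> ball z r \<Longrightarrow> 0 < t \<Longrightarrow> y + t *\<^sub>R e \<in> ball z r \<Longrightarrow> y + t *\<^sub>R e \<in> \<Omega>"
proof -
  obtain U e L and g :: "real^'d \<Rightarrow> real" where U: "open U" "z \<in> U" and e: "norm e = 1"
    and g: "L-lipschitz_on UNIV g" and graph: "\<Omega> \<inter> U = {y \<in> U. g (y - (y \<bullet> e) *\<^sub>R e) < y \<bullet> e}"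
    using bspec[OF assms(1)[unfolded lipschitz_boundary_def] assms(2)]
    by (elim exE conjE) (rule that)
  obtain r where r: "r > 0" "ball z r \<subseteq> U" using U open_contains_ball by blast
  have g_cont: "continuous_on UNIV g" using g by (rule lipschitz_on_continuous_on)
  have cont: "continuous_on UNIV (\<lambda>y. g (y - (y \<bullet> e) *\<^sub>R e))"
    by (rule continuous_on_compose2[OF g_cont]) (auto intro!: continuous_intros)
  have le: "g (y - (y \<bullet> e) *\<^sub>R e) \<le> y \<bullet> e" if y: "y \<in> closure \<Omega>" "y \<in> U" for y
  proof (rule ccontr)
    assume "\<not> ?thesis"
    moreover have "open {y. y \<bullet> e < g (y - (y \<bullet> e) *\<^sub>R e)}"
      by (rule open_Collect_less) (use cont in \<open>auto intro!: continuous_intros\<close>)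
    ultimately have "open (U \<inter> {y. y \<bullet> e < g (y - (y \<bullet> e) *\<^sub>R e)})" "y \<in> U \<inter> {y. y \<bullet> e < g (y - (y \<bullet> e) *\<^sub>R e)}"
      using U y by auto
    then have "\<Omega> \<inter> (U \<inter> {y. y \<bullet> e < g (y - (y \<bullet> e) *\<^sub>R e)}) \<noteq> {}"
      using y(1) open_Int_closure_eq_empty[of "U \<inter> {y. y \<bullet> e < g (y - (y \<bullet> e) *\<^sub>R e)}" \<Omega>] by blast
    then obtain w where "w \<in> \<Omega> \<inter> U" "w \<bullet> e < g (w - (w \<bullet> e) *\<^sub>R e)" by blast
    then show False unfolding graph by simp
  qed
  show thesis
  proof
    show "r > 0" "norm e = 1" by fact+
    fix y t
    assume y: "y \<in> closure \<Omega>" "y \<in> ball z r" and t: "0 < t" "y + t *\<^sub>R e \<in> ball z r"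
    have ee: "e \<bullet> e = 1" using e by (simp add: norm_eq_1)
    have "(y + t *\<^sub>R e) - ((y + t *\<^sub>R e) \<bullet> e) *\<^sub>R e = y - (y \<bullet> e) *\<^sub>R e"
      by (simp add: inner_add_left ee algebra_simps)
    moreover have "g (y - (y \<bullet> e) *\<^sub>R e) < (y + t *\<^sub>R e) \<bullet> e"
      using le[of y] y r(2) t(1) by (auto simp: inner_add_left ee)
    ultimately have "g ((y + t *\<^sub>R e) - ((y + t *\<^sub>R e) \<bullet> e) *\<^sub>R e) < (y + t *\<^sub>R e) \<bullet> e"
      by (simp only:)
    then have "y + t *\<^sub>R e \<in> {y \<in> U. g (y - (y \<bullet> e) *\<^sub>R e) < y \<bullet> e}"
      using subsetD[OF r(2) t(2)] by simp
    then show "y + t *\<^sub>R e \<in> \<Omega>" unfolding graph[symmetric] by simp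
  qed
qed

lemma controlled_domain:
  fixes \<Omega> :: "(real^'d) set"
  assumes \<Omega>: "open \<Omega>" "connected \<Omega>" "bounded \<Omega>" and lip: "lipschitz_boundary \<Omega>"
    and z: "z \<in> frontier \<Omega>" and \<rho>: "\<rho> > 0" "ball z \<rho> \<inter> frontier \<Omega> \<inter> U = {}"
  shows "controlled \<Omega> U \<Omega>"
proof -
  \<comment> \<open>Local form of the claim. Intersecting with \<open>\<Omega>\<close> admits
    centers on the boundary, so compactness of the closure gives the global bound from finitely many
    balls.\<close>
  define good where "good x \<longleftrightarrow> (\<exists>r>0. controlled \<Omega> U (ball x r \<inter> \<Omega>))" for x
  have \<Omega>b [measurable]: "\<Omega> \<in> sets borel" using \<Omega>(1) by auto
  have disj: "x \<notin> frontier \<Omega>" if "x \<in> \<Omega>" for x using \<Omega>(1) that by (simp add: frontier_def interior_open)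
  have near: "good y" if xr: "controlled \<Omega> U (ball x r \<inter> \<Omega>)" "y \<in> ball x r" for x y r
  proof -
    obtain s where "s > 0" "ball y s \<subseteq> ball x r" using xr(2) openE[OF open_ball] by metis
    then show ?thesis using controlled_subset[OF xr(1), of "ball y s \<inter> \<Omega>"] by (auto simp: good_def)
  qed
  text \<open>Start: lines from near \<open>z\<close> leave the domain through the part of the boundary where the
    test functions vanish.\<close>
  have good_z: "good z"
  proof -
    obtain r e where r: "r > 0" "norm e = 1" and chart:
      "\<And>y t. y \<in> closure \<Omega> \<Longrightarrow> y \<in> ball z r \<Longrightarrow> 0 < t \<Longrightarrow> y + t *\<^sub>R e \<in> ball z r \<Longrightarrow> y + t *\<^sub>R e \<in> \<Omega>"
      using lipschitz_boundary_chart[OF lip z] by blast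
    \<comment> \<open>Inside the chart and at most half of \<open>\<rho>\<close>: a start within
      \<open>\<delta> \<le> \<tau>\<close> of \<open>z\<close> followed by a move of length at most
      \<open>\<tau>\<close> stays within \<open>\<rho>\<close> of \<open>z\<close>.\<close>
    define \<tau> where "\<tau> = min r \<rho> / 2"
    have \<tau>: "0 < \<tau>" "\<tau> < r" "2 * \<tau> \<le> \<rho>" using r \<rho> by (auto simp: \<tau>_def)
    \<comment> \<open>Otherwise moving back up by \<open>\<tau>\<close> would put the boundary point
      \<open>z\<close> into \<open>\<Omega>\<close>. Hence lines going down from near
      \<open>z\<close> end outside the closure.\<close>
    have "z - \<tau> *\<^sub>R e \<notin> closure \<Omega>"
    proof
      assume "z - \<tau> *\<^sub>R e \<in> closure \<Omega>"
      then have "z \<in> \<Omega>" using chart[of "z - \<tau> *\<^sub>R e" \<tau>] \<tau> r by (simp add: dist_norm)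
      then show False using disj z by blast
    qed
    then obtain \<delta>0 where \<delta>0: "\<delta>0 > 0" "ball (z - \<tau> *\<^sub>R e) \<delta>0 \<subseteq> - closure \<Omega>"
      using open_contains_ball[of "- closure \<Omega>"] by auto
    define \<delta> where "\<delta> = min \<delta>0 \<tau>"
    have \<delta>: "\<delta> > 0" "\<delta> \<le> \<delta>0" "\<delta> \<le> \<tau>" using \<delta>0 \<tau> by (auto simp: \<delta>_def)
    have "controlled \<Omega> U (ball z \<delta> \<inter> \<Omega>)"
    proof (rule controlled_base[OF \<Omega>b, where h = "- \<tau> *\<^sub>R e"])
      fix x assume x: "x \<in> ball z \<delta> \<inter> \<Omega>"
      define h where "h = - \<tau> *\<^sub>R e"
      \<comment> \<open>Parameters at which the line is outside \<open>\<Omega>\<close>. The least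
        one is the first exit; it is a frontier point, close enough to \<open>z\<close> to avoid
        \<open>U\<close>.\<close>
      define S where "S = {0..1} \<inter> (\<lambda>t. x + t *\<^sub>R h) -` (- \<Omega>)"
      have "closed S" unfolding S_def
        by (rule continuous_closed_preimage) (use \<Omega> in \<open>auto intro!: continuous_intros\<close>)
      then have "compact S" by (auto simp: S_def compact_eq_bounded_closed intro: bounded_subset[of "{0..1}"])
      moreover have "x + h \<in> ball (z - \<tau> *\<^sub>R e) \<delta>0" using x \<delta> by (auto simp: h_def dist_norm)
      then have "1 \<in> S" using \<delta>0(2) closure_subset by (force simp: S_def)
      ultimately obtain s where s: "s \<in> S" and s_min: "\<And>t. t \<in> S \<Longrightarrow> s \<le> t"
        using compact_attains_inf[of S] by blast
      have s01: "0 \<le> s" "s \<le> 1" and sO: "x + s *\<^sub>R h \<notin> \<Omega>" using s by (auto simp: S_def)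
      have in\<Omega>: "x + t *\<^sub>R h \<in> \<Omega>" if "0 < t" "t < s" for t
        using s_min[of t] that s01 by (auto simp: S_def)
      have "s > 0" using s01 sO x by (cases "s = 0") auto
      have "(\<lambda>t. x + t *\<^sub>R h) ` closure {0<..<s} \<subseteq> closure \<Omega>"
        by (rule image_closure_subset) (use in\<Omega> closure_subset[of \<Omega>] in \<open>auto intro!: continuous_intros\<close>)
      then have "x + s *\<^sub>R h \<in> closure \<Omega>" using \<open>s > 0\<close> by (simp add: image_subset_iff)
      then have fr: "x + s *\<^sub>R h \<in> frontier \<Omega>" using sO \<Omega>(1) by (simp add: frontier_def interior_open)
      have "norm (s *\<^sub>R h) \<le> \<tau>" using s01 \<tau> r(2) mult_right_mono[of s 1 \<tau>] by (simp add: h_def)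
      moreover have "norm (x - z) < \<delta>" using x by (simp add: dist_norm norm_minus_commute)
      ultimately have "norm ((x - z) + s *\<^sub>R h) < \<rho>"
        using norm_triangle_ineq[of "x - z" "s *\<^sub>R h"] \<delta> \<tau> by simp
      then have "x + s *\<^sub>R h \<in> ball z \<rho>" by (rule in_ballI_norm)
      then have "x + s *\<^sub>R h \<notin> U" using fr \<rho>(2) by blast
      then show "\<exists>s\<ge>0. s \<le> 1 \<and> x + s *\<^sub>R - \<tau> *\<^sub>R e \<notin> U \<and> (\<forall>t. 0 < t \<and> t < s \<longrightarrow> x + t *\<^sub>R - \<tau> *\<^sub>R e \<in> \<Omega>)"
        using s01 in\<Omega> unfolding h_def by blast
    qed
    then show ?thesis using \<delta> by (auto simp: good_def)
  qed
  text \<open>Goodness spreads inside the domain by translation along segments.\<close>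
  have step: "good x" if r: "r > 0" "ball x r \<subseteq> \<Omega>" and y: "y \<in> ball x r" "good y" for x y r
  proof -
    obtain s where s: "s > 0" "controlled \<Omega> U (ball y s \<inter> \<Omega>)" using y(2) by (auto simp: good_def)
    \<comment> \<open>Small enough that the moving ball stays in \<open>ball x r\<close> and arrives
      inside the good ball about \<open>y\<close>.\<close>
    define \<delta> where "\<delta> = min s (r - dist x y)"
    have \<delta>: "\<delta> > 0" "\<delta> \<le> s" "\<delta> + dist x y \<le> r" using s y by (auto simp: \<delta>_def)
    have in_r: "x' + t *\<^sub>R (y - x) \<in> ball x r" if "x' \<in> ball x \<delta>" "0 \<le> t" "t \<le> 1" for x' t
    proof -
      have "norm (x' - x) < \<delta>" using that by (simp add: dist_norm norm_minus_commute)
      moreover have "norm (t *\<^sub>R (y - x)) \<le> dist x y"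
        using that mult_right_mono[of t 1 "norm (y - x)"] by (simp add: dist_norm norm_minus_commute)
      ultimately have "norm ((x' - x) + t *\<^sub>R (y - x)) < r"
        using norm_triangle_ineq[of "x' - x" "t *\<^sub>R (y - x)"] \<delta> by linarith
      then show ?thesis by (rule in_ballI_norm)
    qed
    have "controlled \<Omega> U (ball x \<delta>)"
    proof (rule controlled_translate[OF \<Omega>b s(2), where h = "y - x"])
      show "x' + (y - x) \<in> ball y s \<inter> \<Omega>" if "x' \<in> ball x \<delta>" for x'
      proof
        have "dist y (x' + (y - x)) = dist x x'" by (simp add: dist_norm algebra_simps)
        then show "x' + (y - x) \<in> ball y s" using that \<delta> by simp
        show "x' + (y - x) \<in> \<Omega>" using in_r[OF that, of 1] r by auto
      qed
      show "x' + t *\<^sub>R (y - x) \<in> \<Omega>" if "x' \<in> ball x \<delta>" "0 < t" "t < 1" for x' t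
        using in_r[OF that(1), of t] that r by auto
    qed auto
    then have "controlled \<Omega> U (ball x \<delta> \<inter> \<Omega>)" by (rule controlled_subset) simp
    then show ?thesis using \<delta> by (auto simp: good_def)
  qed
  have good_\<Omega>: "good x" if x: "x \<in> \<Omega>" for x
  proof -
    have "open {x \<in> \<Omega>. good x}"
    proof (rule Topological_Spaces.openI)
      fix x assume "x \<in> {x \<in> \<Omega>. good x}"
      then have x: "x \<in> \<Omega>" "good x" by auto
      obtain r where r: "r > 0" "controlled \<Omega> U (ball x r \<inter> \<Omega>)" using x(2) unfolding good_def by blast
      obtain r' where r': "r' > 0" "ball x r' \<subseteq> \<Omega>" using \<Omega>(1) x(1) by (rule openE)
      have "ball x (min r r') \<subseteq> {x \<in> \<Omega>. good x}" using near[OF r(2)] r'(2) by auto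
      then show "\<exists>T. open T \<and> x \<in> T \<and> T \<subseteq> {x \<in> \<Omega>. good x}"
        using r(1) r'(1) by (intro exI[of _ "ball x (min r r')"]) auto
    qed
    \<comment> \<open>Contrapositive of \<open>step\<close>: one good point in a ball inside
      \<open>\<Omega>\<close> makes the center good.\<close>
    moreover have "open {x \<in> \<Omega>. \<not> good x}"
    proof (rule Topological_Spaces.openI)
      fix x assume "x \<in> {x \<in> \<Omega>. \<not> good x}"
      then have x: "x \<in> \<Omega>" "\<not> good x" by auto
      obtain r where r: "r > 0" "ball x r \<subseteq> \<Omega>" using \<Omega>(1) x(1) by (rule openE)
      have "ball x r \<subseteq> {x \<in> \<Omega>. \<not> good x}" using step[OF r] x(2) r(2) by blast
      then show "\<exists>T. open T \<and> x \<in> T \<and> T \<subseteq> {x \<in> \<Omega>. \<not> good x}"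
        using r(1) by (intro exI[of _ "ball x r"]) auto
    qed
    moreover have "{x \<in> \<Omega>. good x} \<noteq> {}"
    proof -
      obtain r where r: "r > 0" "controlled \<Omega> U (ball z r \<inter> \<Omega>)" using good_z by (auto simp: good_def)
      have "z \<in> closure \<Omega>" using z by (simp add: frontier_def)
      then obtain y where "y \<in> \<Omega>" "dist y z < r" using r closure_approachable by blast
      then show ?thesis using near[OF r(2), of y] by (auto simp: dist_commute)
    qed
    ultimately have "{x \<in> \<Omega>. \<not> good x} = {}"
      using connectedD[OF \<Omega>(2), of "{x \<in> \<Omega>. good x}" "{x \<in> \<Omega>. \<not> good x}"] by blast
    then show ?thesis using x by blast
  qed
  have good_frontier: "good w" if w: "w \<in> frontier \<Omega>" for w
  proof -
    obtain r e where r: "r > 0" "norm e = 1" and chart: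
      "\<And>y t. y \<in> closure \<Omega> \<Longrightarrow> y \<in> ball w r \<Longrightarrow> 0 < t \<Longrightarrow> y + t *\<^sub>R e \<in> ball w r \<Longrightarrow> y + t *\<^sub>R e \<in> \<Omega>"
      using lipschitz_boundary_chart[OF lip w] by blast
    \<comment> \<open>Half the chart radius inward. From starts within \<open>r / 2\<close> of
      \<open>w\<close> the segment remains in the chart ball and ends near \<open>w + h\<close>, an
      interior point already known to be good.\<close>
    define h where "h = (r / 2) *\<^sub>R e"
    have h: "norm h = r / 2" using r by (simp add: h_def)
    have "w + h \<in> \<Omega>" unfolding h_def
      by (rule chart) (use w r in \<open>auto simp: frontier_def dist_norm\<close>)
    then obtain s where s: "s > 0" "controlled \<Omega> U (ball (w + h) s \<inter> \<Omega>)" using good_\<Omega> by (auto simp: good_def)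
    define \<delta> where "\<delta> = min s (r / 2)"
    have \<delta>: "\<delta> > 0" "\<delta> \<le> s" "\<delta> \<le> r / 2" using s r by (auto simp: \<delta>_def)
    have seg: "x + t *\<^sub>R h \<in> \<Omega>" if x: "x \<in> ball w \<delta> \<inter> \<Omega>" and t: "0 < t" "t \<le> 1" for x t
    proof -
      have "norm (x - w) < \<delta>" using x by (simp add: dist_norm norm_minus_commute)
      moreover have "norm (t *\<^sub>R h) \<le> r / 2" using t h mult_right_mono[of t 1 "norm h"] by simp
      ultimately have "norm ((x - w) + t *\<^sub>R h) < r"
        using norm_triangle_ineq[of "x - w" "t *\<^sub>R h"] \<delta> by linarith
      then have "x + t *\<^sub>R h \<in> ball w r" by (rule in_ballI_norm)
      moreover have "x \<in> closure \<Omega>" "x \<in> ball w r" using x \<delta> r closure_subset by auto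
      ultimately show ?thesis using chart[of x "t * (r / 2)"] t r by (simp add: h_def)
    qed
    have "controlled \<Omega> U (ball w \<delta> \<inter> \<Omega>)"
    proof (rule controlled_translate[OF \<Omega>b s(2), where h = h])
      show "x + h \<in> ball (w + h) s \<inter> \<Omega>" if x: "x \<in> ball w \<delta> \<inter> \<Omega>" for x
        using seg[OF x, of 1] x \<delta> by (auto simp: dist_norm)
    qed (use seg in auto)
    then show ?thesis using \<delta> by (auto simp: good_def)
  qed
  have "good x" if "x \<in> closure \<Omega>" for x
    using that good_\<Omega> good_frontier \<Omega>(1) by (auto simp: frontier_def interior_open)
  then obtain r where r: "\<And>x. x \<in> closure \<Omega> \<Longrightarrow> r x > 0 \<and> controlled \<Omega> U (ball x (r x) \<inter> \<Omega>)"
    unfolding good_def by metis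
  have "compact (closure \<Omega>)" using \<Omega>(3) by simp
  moreover have "closure \<Omega> \<subseteq> (\<Union>x\<in>closure \<Omega>. ball x (r x))" using r by (force intro: centre_in_ball[THEN iffD2])
  ultimately obtain X where X: "X \<subseteq> closure \<Omega>" "finite X" "closure \<Omega> \<subseteq> (\<Union>x\<in>X. ball x (r x))"
    using compactE_image[of "closure \<Omega>" "closure \<Omega>" "\<lambda>x. ball x (r x)"] by blast
  have "controlled \<Omega> U (\<Union>x\<in>X. ball x (r x) \<inter> \<Omega>)"
    using X r by (intro controlled_Union) auto
  moreover have "\<Omega> \<subseteq> (\<Union>x\<in>X. ball x (r x) \<inter> \<Omega>)" using X(3) closure_subset[of \<Omega>] by blast
  ultimately show ?thesis by (rule controlled_subset)
qed

section \<open>Return to Lebesgue integrals over the domain\<close>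

lemma lborel_lebesgue_on:
  fixes f :: "real^'d \<Rightarrow> real"
  assumes \<Omega>: "\<Omega> \<in> sets borel" and f: "f \<in> borel_measurable borel" "\<And>x. 0 \<le> f x"
    and int: "integrable (lebesgue_on \<Omega>) f"
  shows "(\<integral>\<^sup>+x. indicator \<Omega> x * ennreal (f x) \<partial>lborel) = ennreal (integral\<^sup>L (lebesgue_on \<Omega>) f)"
proof -
  have [measurable]: "f \<in> borel_measurable borel" "\<Omega> \<in> sets borel" by fact+
  have \<Omega>s: "\<Omega> \<inter> space lebesgue \<in> sets lebesgue" using \<Omega> by simp
  have "ennreal (integral\<^sup>L (lebesgue_on \<Omega>) f) = (\<integral>\<^sup>+x. ennreal (f x) \<partial>lebesgue_on \<Omega>)"
    using int f(2) by (simp add: nn_integral_eq_integral)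
  also have "\<dots> = (\<integral>\<^sup>+x. ennreal (f x) * indicator \<Omega> x \<partial>lebesgue)"
    by (rule nn_integral_restrict_space[OF \<Omega>s])
  also have "\<dots> = (\<integral>\<^sup>+x. ennreal (f x) * indicator \<Omega> x \<partial>lborel)"
    by (rule nn_integral_completion) measurable
  finally show ?thesis by (simp add: mult.commute)
qed

lemma Poincare:
  fixes \<Omega> :: "(real^'d) set"
  assumes \<Omega>: "open \<Omega>" "connected \<Omega>" "bounded \<Omega>" and lip: "lipschitz_boundary \<Omega>"
    and z: "z \<in> frontier \<Omega>" and \<rho>: "\<rho> > 0" "ball z \<rho> \<inter> frontier \<Omega> \<inter> U = {}"
  obtains C where "C \<ge> 0" "\<And>\<phi>. \<phi> \<in> test_functions U \<Longrightarrow>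
    ip (lebesgue_on \<Omega>) \<phi> \<phi> \<le> C * ip (lebesgue_on \<Omega>) (grad \<phi>) (grad \<phi>)"
proof -
  obtain C where C: "C \<ge> 0" "\<And>\<phi>. \<phi> \<in> test_functions U \<Longrightarrow>
      (\<integral>\<^sup>+x. indicator \<Omega> x * ennreal ((\<phi> x)\<^sup>2) \<partial>lborel) \<le> ennreal C * grad_energy \<Omega> \<phi>"
    using controlled_domain[OF assms] by (rule controlledE) (rule that)
  show thesis
  proof
    show "C \<ge> 0" by fact
    fix \<phi> assume \<phi>: "\<phi> \<in> test_functions U"
    note [measurable] = borel_measurable_test[OF \<phi>]
    have \<Omega>b: "\<Omega> \<in> sets borel" using \<Omega> by auto
    have sq: "\<phi> \<in> sqint (lebesgue_on \<Omega>)" "grad \<phi> \<in> sqint (lebesgue_on \<Omega>)"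
      using test_functionsD(3,4)[OF \<phi>] by (auto intro!: continuous_sqint \<Omega>)
    have ip: "ip (lebesgue_on \<Omega>) w w = integral\<^sup>L (lebesgue_on \<Omega>) (\<lambda>x. (norm (w x))\<^sup>2)"
      for w :: "real^'d \<Rightarrow> 'b::euclidean_space" by (simp add: ip_def power2_norm_eq_inner)
    have "(\<integral>\<^sup>+x. indicator \<Omega> x * ennreal ((norm (\<phi> x))\<^sup>2) \<partial>lborel) = ennreal (ip (lebesgue_on \<Omega>) \<phi> \<phi>)"
      unfolding ip using sq(1) by (intro lborel_lebesgue_on[OF \<Omega>b]) (auto simp: sqint_def)
    moreover have "grad_energy \<Omega> \<phi> = ennreal (ip (lebesgue_on \<Omega>) (grad \<phi>) (grad \<phi>))"
      unfolding ip grad_energy_def using sq(2) by (intro lborel_lebesgue_on[OF \<Omega>b]) (auto simp: sqint_def)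
    ultimately have "ennreal (ip (lebesgue_on \<Omega>) \<phi> \<phi>) \<le> ennreal (C * ip (lebesgue_on \<Omega>) (grad \<phi>) (grad \<phi>))"
      using C(2)[OF \<phi>] C(1) by (simp add: ennreal_mult ip_nonneg)
    then show "ip (lebesgue_on \<Omega>) \<phi> \<phi> \<le> C * ip (lebesgue_on \<Omega>) (grad \<phi>) (grad \<phi>)"
      using C(1) by (simp add: ip_nonneg)
  qed
qed

section \<open>Flat pieces of the boundary\<close>

text \<open>The chart direction \<open>e\<close> is transversal to the hyperplane, so a frontier
  point near \<open>z\<close> slides along \<open>e\<close> onto the flat piece. Both ends of the
  slide are frontier points, and the chart forbids two of them on one line along \<open>e\<close>;
  the slide is trivial.\<close>

lemma flat_piece_open_in_frontier:
  fixes \<Omega> P :: "(real^'d) set"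
  assumes \<Omega>: "open \<Omega>" "lipschitz_boundary \<Omega>"
    and P: "aff_dim P = int CARD('d) - 1" "rel_interior P \<subseteq> frontier \<Omega>" "z \<in> rel_interior P"
  obtains \<rho> where "\<rho> > 0" "ball z \<rho> \<inter> frontier \<Omega> \<subseteq> rel_interior P"
proof -
  have z: "z \<in> frontier \<Omega>" using P by blast
  have disj: "x \<notin> frontier \<Omega>" if "x \<in> \<Omega>" for x using \<Omega>(1) that by (simp add: frontier_def interior_open)
  obtain a b where a: "a \<noteq> 0" and hull: "affine hull P = {x. a \<bullet> x = b}"
    using P(1) aff_dim_eq_hyperplane[of P] by auto
  obtain \<epsilon> where \<epsilon>: "\<epsilon> > 0" "ball z \<epsilon> \<inter> affine hull P \<subseteq> rel_interior P"
    using openin_rel_interior[of P] P(3) unfolding openin_contains_ball by blast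
  have az: "a \<bullet> z = b" using P(3) rel_interior_subset hull_subset[of P affine] hull by blast
  obtain r e where r: "r > 0" "norm e = 1" and chart:
    "\<And>y t. y \<in> closure \<Omega> \<Longrightarrow> y \<in> ball z r \<Longrightarrow> 0 < t \<Longrightarrow> y + t *\<^sub>R e \<in> ball z r \<Longrightarrow> y + t *\<^sub>R e \<in> \<Omega>"
    using lipschitz_boundary_chart[OF \<Omega>(2) z] by blast
  \<comment> \<open>Were \<open>e\<close> tangential, a short move along it would stay in the flat
    piece, yet the chart puts the moved point into \<open>\<Omega>\<close>.\<close>
  have ae: "a \<bullet> e \<noteq> 0"
  proof
    assume 0: "a \<bullet> e = 0"
    define t where "t = min r \<epsilon> / 2"
    have t: "0 < t" "t < r" "t < \<epsilon>" using r \<epsilon> by (auto simp: t_def)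
    have "z + t *\<^sub>R e \<in> ball z \<epsilon> \<inter> affine hull P"
      using t r(2) 0 az by (simp add: hull dist_norm inner_add_right)
    then have "z + t *\<^sub>R e \<in> frontier \<Omega>" using \<epsilon> P(2) by blast
    moreover have "z + t *\<^sub>R e \<in> \<Omega>"
      using z t r by (intro chart) (auto simp: frontier_def dist_norm)
    ultimately show False using disj by blast
  qed
  \<comment> \<open>Controls the slide:
    \<open>norm (y - z) + \<bar>\<tau>\<bar> \<le> c * norm (y - z)\<close>, so that
    \<open>\<rho>\<close> keeps both ends in the two balls.\<close>
  define c where "c = 1 + norm a / \<bar>a \<bullet> e\<bar>"
  define \<rho> where "\<rho> = min r \<epsilon> / c"
  have c: "c \<ge> 1" by (simp add: c_def)
  have \<rho>: "\<rho> > 0" "c * \<rho> \<le> r" "c * \<rho> \<le> \<epsilon>" using r \<epsilon> c by (auto simp: \<rho>_def)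
  show thesis
  proof
    show "\<rho> > 0" by fact
    show "ball z \<rho> \<inter> frontier \<Omega> \<subseteq> rel_interior P"
    proof
      fix y assume y: "y \<in> ball z \<rho> \<inter> frontier \<Omega>"
      define \<tau> where "\<tau> = (a \<bullet> (y - z)) / (a \<bullet> e)"
      define y' where "y' = y - \<tau> *\<^sub>R e"
      have "\<bar>\<tau>\<bar> \<le> norm a * norm (y - z) / \<bar>a \<bullet> e\<bar>"
        unfolding \<tau>_def abs_divide by (intro divide_right_mono Cauchy_Schwarz_ineq2) simp
      then have "norm (y - z) + \<bar>\<tau>\<bar> \<le> c * norm (y - z)" by (simp add: c_def algebra_simps)
      also have "\<dots> < c * \<rho>" using y c by (simp add: dist_norm norm_minus_commute)
      finally have small: "norm (y - z) + \<bar>\<tau>\<bar> < c * \<rho>" .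
      have y'z: "norm (y' - z) \<le> norm (y - z) + \<bar>\<tau>\<bar>"
        using norm_triangle_ineq4[of "y - z" "\<tau> *\<^sub>R e"] r(2) by (simp add: y'_def algebra_simps)
      then have balls: "y \<in> ball z r" "y' \<in> ball z r" "y' \<in> ball z \<epsilon>"
        using small \<rho> by (auto simp: dist_norm norm_minus_commute[of z])
      have "a \<bullet> y' = b" using ae az by (simp add: y'_def \<tau>_def inner_diff_right)
      then have y'P: "y' \<in> rel_interior P" using balls \<epsilon>(2) hull by blast
      then have y'f: "y' \<in> frontier \<Omega>" using P(2) by blast
      have "\<not> \<tau> > 0"
      proof
        assume "\<tau> > 0"
        then have "y' + \<tau> *\<^sub>R e \<in> \<Omega>"
          using balls y'f by (intro chart) (auto simp: frontier_def y'_def)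
        then show False using y disj by (auto simp: y'_def)
      qed
      moreover have "\<not> \<tau> < 0"
      proof
        assume "\<tau> < 0"
        then have "y + (- \<tau>) *\<^sub>R e \<in> \<Omega>"
          using balls y by (intro chart) (auto simp: frontier_def y'_def)
        then show False using y'f disj by (auto simp: y'_def)
      qed
      ultimately show "y \<in> rel_interior P" using y'P by (simp add: y'_def)
    qed
  qed
qed

text \<open>Nonoverlapping segments may share points, for instance along edges, hence the closure.
  The Poincare inequality will be applied to functions supported off this closure; by the ball they
  vanish on a whole patch of the frontier.\<close>

lemma segment_near_point:
  fixes \<Omega> \<Gamma> \<Gamma>' :: "(real^'d) set"
  assumes \<Omega>: "open \<Omega>" "lipschitz_boundary \<Omega>" and d: "CARD('d) \<ge> 2"
    and \<Gamma>: "boundary_segment \<Omega> \<Gamma>" "\<Gamma> \<noteq> {}" and non: "nonoverlapping \<Omega> \<Gamma> \<Gamma>'"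
  obtains z \<rho> where "z \<in> frontier \<Omega>" "\<rho> > 0" "ball z \<rho> \<inter> frontier \<Omega> \<subseteq> closure (frontier \<Omega> - \<Gamma>')"
proof -
  obtain \<F> where pieces: "\<forall>P\<in>\<F>. polytope P \<and> aff_dim P = int CARD('d) - 1"
    and \<F>: "(\<Union>P\<in>\<F>. rel_interior P) \<subseteq> \<Gamma>" "\<Gamma> \<subseteq> \<Union>\<F>"
    using \<Gamma>(1)[unfolded boundary_segment_def] by (elim exE conjE) (rule that)
  have \<Gamma>f: "\<Gamma> \<subseteq> frontier \<Omega>" using \<Gamma>(1) by (simp add: boundary_segment_def)
  obtain P where P: "P \<in> \<F>" using \<Gamma>(2) \<F>(2) by blast
  have poly: "polytope P" and dim: "aff_dim P = int CARD('d) - 1" using bspec[OF pieces P] by auto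
  \<comment> \<open>The empty set has affine dimension -1, so the piece is nonempty.\<close>
  have "aff_dim P \<ge> 0" using dim d by simp
  then have "P \<noteq> {}" by auto
  then have "rel_interior P \<noteq> {}"
    using poly by (simp add: rel_interior_eq_empty polytope_imp_convex)
  then obtain z where z: "z \<in> rel_interior P" by blast
  have sub: "rel_interior P \<subseteq> \<Gamma>" using \<F>(1) P by blast
  obtain \<rho> where \<rho>: "\<rho> > 0" "ball z \<rho> \<inter> frontier \<Omega> \<subseteq> rel_interior P"
    using flat_piece_open_in_frontier[OF \<Omega> dim order_trans[OF sub \<Gamma>f] z] by blast
  show thesis
  proof
    show "z \<in> frontier \<Omega>" using z sub \<Gamma>f by blast
    show "\<rho> > 0" by fact
    show "ball z \<rho> \<inter> frontier \<Omega> \<subseteq> closure (frontier \<Omega> - \<Gamma>')"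
    proof
      fix y assume y: "y \<in> ball z \<rho> \<inter> frontier \<Omega>"
      show "y \<in> closure (frontier \<Omega> - \<Gamma>')"
      proof (rule ccontr)
        \<comment> \<open>For \<open>y\<close> outside the closure, \<open>T\<close> would be a
          relatively open part of the frontier that contains \<open>y\<close> and lies in both
          segments.\<close>
        define T where "T = frontier \<Omega> \<inter> (ball z \<rho> - closure (frontier \<Omega> - \<Gamma>'))"
        assume "y \<notin> closure (frontier \<Omega> - \<Gamma>')"
        then have "y \<in> T" using y by (simp add: T_def)
        moreover have "openin (top_of_set (frontier \<Omega>)) T"
          unfolding T_def by (intro openin_open_Int open_Diff) auto
        moreover have "T \<subseteq> \<Gamma> \<inter> \<Gamma>'"
          using \<rho>(2) sub closure_subset[of "frontier \<Omega> - \<Gamma>'"] by (auto simp: T_def)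
        ultimately have "y \<in> top_of_set (frontier \<Omega>) interior_of (\<Gamma> \<inter> \<Gamma>')"
          by (auto simp: interior_of_def)
        then show False using non by (simp add: nonoverlapping_def)
      qed
    qed
  qed
qed

section \<open>Weak derivatives\<close>

lemma L2_eq_sqint: "L2 \<Omega> = sqint (lebesgue_on \<Omega>)"
  by (simp add: L2_def sqint_def)

lemma L2_norm_eq_ip: "L2_norm \<Omega> u = sqrt (ip (lebesgue_on \<Omega>) u u)"
  by (simp add: L2_norm_def ip_def power2_norm_eq_inner)

lemma test_sqint:
  assumes "open \<Omega>" "bounded \<Omega>" "\<phi> \<in> test_functions U"
  shows "\<phi> \<in> sqint (lebesgue_on \<Omega>)" "grad \<phi> \<in> sqint (lebesgue_on \<Omega>)"
  using assms test_functionsD(3,4)[OF assms(3)] by (auto intro: continuous_sqint)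

lemma sqint_integrable_scaleR:
  fixes u :: "'a \<Rightarrow> real" and G :: "'a \<Rightarrow> 'b::euclidean_space"
  assumes u: "u \<in> sqint M" and G: "G \<in> sqint M"
  shows "integrable M (\<lambda>x. u x *\<^sub>R G x)"
proof (rule Bochner_Integration.integrable_bound)
  show "integrable M (\<lambda>x. (norm (u x))\<^sup>2 + (norm (G x))\<^sup>2)" using assms by (simp add: sqint_def)
  show "(\<lambda>x. u x *\<^sub>R G x) \<in> borel_measurable M" using assms by measurable
  show "AE x in M. norm (u x *\<^sub>R G x) \<le> norm ((norm (u x))\<^sup>2 + (norm (G x))\<^sup>2)"
  proof (intro AE_I2)
    fix x
    have "2 * (\<bar>u x\<bar> * norm (G x)) \<le> \<bar>u x\<bar>\<^sup>2 + (norm (G x))\<^sup>2"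
      using sum_squares_bound[of "\<bar>u x\<bar>" "norm (G x)"] by simp
    moreover have "0 \<le> \<bar>u x\<bar> * norm (G x)" by simp
    ultimately have "\<bar>u x\<bar> * norm (G x) \<le> \<bar>u x\<bar>\<^sup>2 + (norm (G x))\<^sup>2" by linarith
    then show "norm (u x *\<^sub>R G x) \<le> norm ((norm (u x))\<^sup>2 + (norm (G x))\<^sup>2)" by simp
  qed
qed

lemma AE_eq_if_same_moments:
  fixes g h :: "real^'d \<Rightarrow> real"
  assumes \<Omega>: "open \<Omega>" "bounded \<Omega>" and g: "g \<in> sqint (lebesgue_on \<Omega>)" "h \<in> sqint (lebesgue_on \<Omega>)"
    and eq: "\<And>\<phi>. \<phi> \<in> test_functions \<Omega> \<Longrightarrow> ip (lebesgue_on \<Omega>) g \<phi> = ip (lebesgue_on \<Omega>) h \<phi>"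
  shows "AE x in lebesgue_on \<Omega>. g x = h x"
proof -
  have gh: "(\<lambda>x. g x - h x) \<in> sqint (lebesgue_on \<Omega>)" using g by (rule sqint_diff)
  \<comment> \<open>Constants are square integrable on a bounded domain, so pairing with 1 yields
    integrability.\<close>
  have one: "(\<lambda>x. 1 :: real) \<in> sqint (lebesgue_on \<Omega>)" using \<Omega> by (intro continuous_sqint) auto
  have "integrable (lebesgue_on \<Omega>) (\<lambda>x. g x - h x)" using ip_integrable[OF gh one] by simp
  moreover have "integral\<^sup>L (lebesgue_on \<Omega>) (\<lambda>x. (g x - h x) * \<phi> x) = 0" if \<phi>: "\<phi> \<in> test_functions \<Omega>" for \<phi>
    using L2.B_diff[OF g test_sqint(1)[OF \<Omega> \<phi>]] eq[OF \<phi>] by (simp add: ip_def)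
  ultimately have "AE x in lebesgue_on \<Omega>. g x - h x = 0" by (rule fundamental_lemma[OF \<Omega>(1)])
  then show ?thesis by simp
qed

lemma is_weak_div_iff:
  "is_weak_div \<Omega> v g \<longleftrightarrow>
     (\<forall>\<phi>\<in>test_functions \<Omega>. ip (lebesgue_on \<Omega>) v (grad \<phi>) + ip (lebesgue_on \<Omega>) g \<phi> = 0)"
  unfolding is_weak_div_def ip_def inner_real_def eq_neg_iff_add_eq_0 ..

lemma weak_div_unique:
  assumes \<Omega>: "open \<Omega>" "bounded \<Omega>" and g: "g \<in> L2 \<Omega>" "h \<in> L2 \<Omega>"
    and "is_weak_div \<Omega> v g" "is_weak_div \<Omega> v h"
  shows "AE x in lebesgue_on \<Omega>. g x = h x"
proof (rule AE_eq_if_same_moments[OF \<Omega>])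
  fix \<phi> assume "\<phi> \<in> test_functions \<Omega>"
  then have "ip (lebesgue_on \<Omega>) v (grad \<phi>) + ip (lebesgue_on \<Omega>) g \<phi> = 0"
    "ip (lebesgue_on \<Omega>) v (grad \<phi>) + ip (lebesgue_on \<Omega>) h \<phi> = 0"
    using assms(5,6) by (auto simp: is_weak_div_iff)
  then show "ip (lebesgue_on \<Omega>) g \<phi> = ip (lebesgue_on \<Omega>) h \<phi>" by simp
qed (use g in \<open>auto simp: L2_eq_sqint\<close>)

lemma weak_grad_unique:
  fixes u :: "real^'d \<Rightarrow> real"
  assumes \<Omega>: "open \<Omega>" "bounded \<Omega>" and g: "G \<in> L2 \<Omega>" "H \<in> L2 \<Omega>"
    and w: "is_weak_grad \<Omega> u G" "is_weak_grad \<Omega> u H"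
  shows "AE x in lebesgue_on \<Omega>. G x = H x"
proof -
  have sq: "G \<in> sqint (lebesgue_on \<Omega>)" "H \<in> sqint (lebesgue_on \<Omega>)" using g by (auto simp: L2_eq_sqint)
  have comp: "(\<lambda>x. v x $ i) \<in> sqint (lebesgue_on \<Omega>)"
    if "v \<in> sqint (lebesgue_on \<Omega>)" for v :: "real^'d \<Rightarrow> real^'d" and i
    using that by (rule sqint_linear[OF bounded_linear_vec_nth])
  have "AE x in lebesgue_on \<Omega>. G x $ i = H x $ i" for i
  proof (rule AE_eq_if_same_moments[OF \<Omega> comp comp])
    fix \<phi> assume \<phi>: "\<phi> \<in> test_functions \<Omega>"
    have "integral\<^sup>L (lebesgue_on \<Omega>) (\<lambda>x. \<phi> x *\<^sub>R G x) = integral\<^sup>L (lebesgue_on \<Omega>) (\<lambda>x. \<phi> x *\<^sub>R H x)"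
      using w \<phi> by (auto simp: is_weak_grad_def)
    moreover have "ip (lebesgue_on \<Omega>) (\<lambda>x. v x $ i) \<phi> = integral\<^sup>L (lebesgue_on \<Omega>) (\<lambda>x. \<phi> x *\<^sub>R v x) $ i"
      if "v \<in> sqint (lebesgue_on \<Omega>)" for v :: "real^'d \<Rightarrow> real^'d"
      using integral_bounded_linear[OF bounded_linear_vec_nth[of i] sqint_integrable_scaleR[OF test_sqint(1)[OF \<Omega> \<phi>] that]]
      by (simp add: ip_def mult.commute)
    ultimately show "ip (lebesgue_on \<Omega>) (\<lambda>x. G x $ i) \<phi> = ip (lebesgue_on \<Omega>) (\<lambda>x. H x $ i) \<phi>"
      using sq by simp
  qed (use sq in auto)
  then have "AE x in lebesgue_on \<Omega>. \<forall>i\<in>UNIV. G x $ i = H x $ i"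
    by (subst AE_ball_countable) (auto simp: uncountable_infinite countable_finite)
  then show ?thesis by (simp add: vec_eq_iff)
qed

lemma weak_grad_diff:
  assumes \<Omega>: "open \<Omega>" "bounded \<Omega>"
    and sq: "u \<in> L2 \<Omega>" "w \<in> L2 \<Omega>" "G \<in> L2 \<Omega>" "H \<in> L2 \<Omega>"
    and "is_weak_grad \<Omega> u G" "is_weak_grad \<Omega> w H"
  shows "is_weak_grad \<Omega> (\<lambda>x. u x - w x) (\<lambda>x. G x - H x)"
  unfolding is_weak_grad_def
proof
  fix \<phi> assume \<phi>: "\<phi> \<in> test_functions \<Omega>"
  note t = test_sqint[OF \<Omega> \<phi>]
  show "integral\<^sup>L (lebesgue_on \<Omega>) (\<lambda>x. (u x - w x) *\<^sub>R grad \<phi> x) =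
      - integral\<^sup>L (lebesgue_on \<Omega>) (\<lambda>x. \<phi> x *\<^sub>R (G x - H x))"
    using assms(7,8) \<phi> sq[unfolded L2_eq_sqint] t
    by (simp add: is_weak_grad_def scaleR_diff_left scaleR_diff_right sqint_integrable_scaleR)
qed

lemma wgrad_props:
  assumes "u \<in> H1 \<Omega>"
  shows "wgrad \<Omega> u \<in> L2 \<Omega>" "is_weak_grad \<Omega> u (wgrad \<Omega> u)"
proof -
  have "\<exists>G. G \<in> L2 \<Omega> \<and> is_weak_grad \<Omega> u G" using assms by (auto simp: H1_def)
  then have "wgrad \<Omega> u \<in> L2 \<Omega> \<and> is_weak_grad \<Omega> u (wgrad \<Omega> u)"
    unfolding wgrad_def by (rule someI_ex)
  then show "wgrad \<Omega> u \<in> L2 \<Omega>" "is_weak_grad \<Omega> u (wgrad \<Omega> u)" by auto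
qed

lemma wdiv_props:
  assumes "v \<in> Hdiv \<Omega>"
  shows "wdiv \<Omega> v \<in> L2 \<Omega>" "is_weak_div \<Omega> v (wdiv \<Omega> v)"
proof -
  have "\<exists>g. g \<in> L2 \<Omega> \<and> is_weak_div \<Omega> v g" using assms by (auto simp: Hdiv_def)
  then have "wdiv \<Omega> v \<in> L2 \<Omega> \<and> is_weak_div \<Omega> v (wdiv \<Omega> v)"
    unfolding wdiv_def by (rule someI_ex)
  then show "wdiv \<Omega> v \<in> L2 \<Omega>" "is_weak_div \<Omega> v (wdiv \<Omega> v)" by auto
qed

section \<open>The graph of the divergence\<close>

text \<open>Both conditions on \<open>(v, g)\<close> are orthogonality to pairs (gradient,
  function). Functions with compact support in \<open>\<Omega>\<close> make \<open>g\<close> the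
  weak divergence; functions that are zero on the rest of the frontier make the normal trace vanish
  on \<open>\<Gamma>\<close>, by the Green formula that defines it.\<close>

definition div_tests :: "(real^'d) set \<Rightarrow> (real^'d) set \<Rightarrow> (real^'d \<Rightarrow> (real^'d) \<times> real) set" where
  "div_tests \<Omega> \<Gamma> = (\<lambda>\<phi> x. (grad \<phi> x, \<phi> x)) ` test_functions \<Omega> \<union>
     (\<lambda>w x. (wgrad \<Omega> w x, w x)) ` H1_zero_on \<Omega> (frontier \<Omega> - \<Gamma>)"

lemma H1_zero_on_sqint:
  assumes "w \<in> H1_zero_on \<Omega> D"
  shows "w \<in> sqint (lebesgue_on \<Omega>)" "wgrad \<Omega> w \<in> sqint (lebesgue_on \<Omega>)"
  using assms wgrad_props(1)[of w \<Omega>] by (auto simp: H1_zero_on_def H1_def L2_eq_sqint)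

lemma div_tests_sqint:
  assumes "open \<Omega>" "bounded \<Omega>"
  shows "div_tests \<Omega> \<Gamma> \<subseteq> sqint (lebesgue_on \<Omega>)"
  unfolding div_tests_def
  by (auto intro!: sqint_Pair dest: H1_zero_on_sqint test_sqint[OF assms])

lemma orth_div_tests_iff:
  assumes \<Omega>: "open \<Omega>" "bounded \<Omega>"
  shows "(\<lambda>x. (v x, g x)) \<in> orth (lebesgue_on \<Omega>) (div_tests \<Omega> \<Gamma>) \<longleftrightarrow>
    v \<in> L2 \<Omega> \<and> g \<in> L2 \<Omega> \<and> is_weak_div \<Omega> v g \<and>
    (\<forall>w\<in>H1_zero_on \<Omega> (frontier \<Omega> - \<Gamma>). ip (lebesgue_on \<Omega>) v (wgrad \<Omega> w) + ip (lebesgue_on \<Omega>) g w = 0)"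
    (is "?L \<longleftrightarrow> ?R")
proof -
  have sq: "(\<lambda>x. (v x, g x)) \<in> sqint (lebesgue_on \<Omega>) \<longleftrightarrow> v \<in> L2 \<Omega> \<and> g \<in> L2 \<Omega>"
    using sqint_fst[of "\<lambda>x. (v x, g x)"] sqint_snd[of "\<lambda>x. (v x, g x)"] sqint_Pair[of v _ g]
    by (auto simp: L2_eq_sqint)
  show ?thesis
  proof (cases "v \<in> L2 \<Omega> \<and> g \<in> L2 \<Omega>")
    case True
    then have vg: "v \<in> sqint (lebesgue_on \<Omega>)" "g \<in> sqint (lebesgue_on \<Omega>)" by (auto simp: L2_eq_sqint)
    have 1: "ip (lebesgue_on \<Omega>) (\<lambda>x. (v x, g x)) (\<lambda>x. (grad \<phi> x, \<phi> x)) =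
        ip (lebesgue_on \<Omega>) v (grad \<phi>) + ip (lebesgue_on \<Omega>) g \<phi>" if "\<phi> \<in> test_functions \<Omega>" for \<phi>
      using vg test_sqint[OF \<Omega> that] by (simp add: ip_Pair)
    have 2: "ip (lebesgue_on \<Omega>) (\<lambda>x. (v x, g x)) (\<lambda>x. (wgrad \<Omega> w x, w x)) =
        ip (lebesgue_on \<Omega>) v (wgrad \<Omega> w) + ip (lebesgue_on \<Omega>) g w"
      if "w \<in> H1_zero_on \<Omega> (frontier \<Omega> - \<Gamma>)" for w
      using vg H1_zero_on_sqint[OF that] by (simp add: ip_Pair)
    show ?thesis
      unfolding orth_def div_tests_def is_weak_div_iff using True sq
      by (simp add: ball_Un 1 2)
  next
    case False
    then show ?thesis using sq by (auto simp: orth_def)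
  qed
qed

lemma normal_trace_eq:
  assumes "v \<in> Hdiv \<Omega>" "w \<in> H1_zero_on \<Omega> D"
  shows "normal_trace \<Omega> v w = ip (lebesgue_on \<Omega>) v (wgrad \<Omega> w) + ip (lebesgue_on \<Omega>) (wdiv \<Omega> v) w"
  using ip_integrable[of v "lebesgue_on \<Omega>" "wgrad \<Omega> w"] ip_integrable[of "wdiv \<Omega> v" "lebesgue_on \<Omega>" w]
    assms H1_zero_on_sqint[OF assms(2)] wdiv_props(1)[OF assms(1)]
  by (simp add: normal_trace_def ip_def L2_eq_sqint Hdiv_def)

lemma Hdiv_zero_on_graph:
  assumes "open \<Omega>" "bounded \<Omega>" "v \<in> Hdiv_zero_on \<Omega> \<Gamma>"
  shows "(\<lambda>x. (v x, wdiv \<Omega> v x)) \<in> orth (lebesgue_on \<Omega>) (div_tests \<Omega> \<Gamma>)"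
  using assms wdiv_props[of v \<Omega>] normal_trace_eq[of v \<Omega>]
  by (auto simp: orth_div_tests_iff Hdiv_zero_on_def Hdiv_def)

text \<open>\<open>wdiv\<close> is one fixed choice, whereas \<open>g\<close> is any representative.
  Uniqueness of the weak divergence identifies them almost everywhere, and the normal trace does not
  see the difference.\<close>

lemma graph_Hdiv_zero_on:
  fixes v :: "real^'d \<Rightarrow> real^'d"
  assumes \<Omega>: "open \<Omega>" "bounded \<Omega>"
    and vg: "(\<lambda>x. (v x, g x)) \<in> orth (lebesgue_on \<Omega>) (div_tests \<Omega> \<Gamma>)"
  shows "v \<in> Hdiv_zero_on \<Omega> \<Gamma>" "AE x in lebesgue_on \<Omega>. g x = wdiv \<Omega> v x"
proof -
  have vg': "v \<in> L2 \<Omega>" "g \<in> L2 \<Omega>" "is_weak_div \<Omega> v g"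
    "\<And>w. w \<in> H1_zero_on \<Omega> (frontier \<Omega> - \<Gamma>) \<Longrightarrow>
      ip (lebesgue_on \<Omega>) v (wgrad \<Omega> w) + ip (lebesgue_on \<Omega>) g w = 0"
    using vg by (auto simp: orth_div_tests_iff[OF \<Omega>])
  then have v: "v \<in> Hdiv \<Omega>" by (auto simp: Hdiv_def)
  show AE: "AE x in lebesgue_on \<Omega>. g x = wdiv \<Omega> v x"
    by (rule weak_div_unique[OF \<Omega> vg'(2) wdiv_props(1)[OF v] vg'(3) wdiv_props(2)[OF v]])
  have "normal_trace \<Omega> v w = 0" if w: "w \<in> H1_zero_on \<Omega> (frontier \<Omega> - \<Gamma>)" for w
  proof -
    have "ip (lebesgue_on \<Omega>) (wdiv \<Omega> v) w = ip (lebesgue_on \<Omega>) g w"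
      using AE vg'(2) wdiv_props(1)[OF v] H1_zero_on_sqint(1)[OF w]
      by (intro ip_cong_AE) (auto simp: L2_eq_sqint sqint_measurable)
    then show ?thesis using vg'(4)[OF w] normal_trace_eq[OF v w] by simp
  qed
  then show "v \<in> Hdiv_zero_on \<Omega> \<Gamma>" using v by (simp add: Hdiv_zero_on_def)
qed

text \<open>\<open>H1_norm\<close> of a difference refers to the weak gradient chosen for that
  difference. Uniqueness replaces it by \<open>wgrad \<Omega> w\<close> minus the classical gradient
  of \<open>\<phi>\<close>.\<close>

lemma H1_zero_on_approx:
  assumes \<Omega>: "open \<Omega>" "bounded \<Omega>" and w: "w \<in> H1_zero_on \<Omega> D" and "\<epsilon> > 0"
  obtains \<phi> where "\<phi> \<in> test_functions (- closure D)"
    "sqrt (ip (lebesgue_on \<Omega>) (\<lambda>x. w x - \<phi> x) (\<lambda>x. w x - \<phi> x)) < \<epsilon>"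
    "sqrt (ip (lebesgue_on \<Omega>) (\<lambda>x. wgrad \<Omega> w x - grad \<phi> x) (\<lambda>x. wgrad \<Omega> w x - grad \<phi> x)) < \<epsilon>"
proof -
  have wH: "w \<in> H1 \<Omega>" using w by (simp add: H1_zero_on_def)
  obtain \<phi> where \<phi>: "\<phi> \<in> test_functions (- closure D)" and small: "H1_norm \<Omega> (\<lambda>x. w x - \<phi> x) < \<epsilon>"
    using w \<open>\<epsilon> > 0\<close> by (auto simp: H1_zero_on_def)
  note t = test_sqint[OF \<Omega> \<phi>] and ws = H1_zero_on_sqint[OF w]
  have G: "is_weak_grad \<Omega> (\<lambda>x. w x - \<phi> x) (\<lambda>x. wgrad \<Omega> w x - grad \<phi> x)"
    using t ws by (intro weak_grad_diff[OF \<Omega>] wgrad_props(2)[OF wH] weak_grad_test[OF \<Omega>(1) \<phi> \<Omega>(2)])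
      (auto simp: L2_eq_sqint)
  have Gs: "(\<lambda>x. wgrad \<Omega> w x - grad \<phi> x) \<in> L2 \<Omega>" using t ws by (simp add: L2_eq_sqint sqint_diff)
  have H: "(\<lambda>x. w x - \<phi> x) \<in> H1 \<Omega>"
    using t ws G Gs unfolding H1_def by (auto simp: L2_eq_sqint sqint_diff)
  have "AE x in lebesgue_on \<Omega>. wgrad \<Omega> (\<lambda>x. w x - \<phi> x) x = wgrad \<Omega> w x - grad \<phi> x"
    by (rule weak_grad_unique[OF \<Omega> wgrad_props(1)[OF H] Gs wgrad_props(2)[OF H] G])
  then have eq: "ip (lebesgue_on \<Omega>) (wgrad \<Omega> (\<lambda>x. w x - \<phi> x)) (wgrad \<Omega> (\<lambda>x. w x - \<phi> x)) =
      ip (lebesgue_on \<Omega>) (\<lambda>x. wgrad \<Omega> w x - grad \<phi> x) (\<lambda>x. wgrad \<Omega> w x - grad \<phi> x)"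
    using wgrad_props(1)[OF H] Gs by (intro ip_cong_AE) (auto simp: L2_eq_sqint sqint_measurable)
  have "sqrt (ip (lebesgue_on \<Omega>) (\<lambda>x. w x - \<phi> x) (\<lambda>x. w x - \<phi> x) +
      ip (lebesgue_on \<Omega>) (\<lambda>x. wgrad \<Omega> w x - grad \<phi> x) (\<lambda>x. wgrad \<Omega> w x - grad \<phi> x)) < \<epsilon>"
    using small by (simp add: H1_norm_def L2_norm_eq_ip eq ip_nonneg)
  then show thesis
    using \<phi> by (intro that[of \<phi>]) (auto simp: ip_nonneg intro: le_less_trans[rotated])
qed

text \<open>The field is the \<open>L2\<close> limit of gradients of a minimizing sequence for the Dirichlet
  energy; the completeness of \<open>H1 \<Omega>\<close> is not needed.\<close>

lemma divergence_onto:
  fixes \<Omega> \<Gamma> :: "(real^'d) set"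
  assumes \<Omega>: "open \<Omega>" "bounded \<Omega>" and C: "C \<ge> 0"
    and Poin: "\<And>\<phi>. \<phi> \<in> test_functions (- closure (frontier \<Omega> - \<Gamma>)) \<Longrightarrow>
      ip (lebesgue_on \<Omega>) \<phi> \<phi> \<le> C * ip (lebesgue_on \<Omega>) (grad \<phi>) (grad \<phi>)"
    and u: "u \<in> sqint (lebesgue_on \<Omega>)"
  shows "\<exists>\<beta>. (\<lambda>x. (\<beta> x, u x)) \<in> orth (lebesgue_on \<Omega>) (div_tests \<Omega> \<Gamma>) \<and>
    ip (lebesgue_on \<Omega>) \<beta> \<beta> \<le> C * ip (lebesgue_on \<Omega>) u u"
proof -
  define M where "M = lebesgue_on \<Omega>"
  define U where "U = - closure (frontier \<Omega> - \<Gamma>)"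
  note u = u[folded M_def]
  have T: "\<phi> \<in> sqint M" "grad \<phi> \<in> sqint M" if "\<phi> \<in> test_functions U" for \<phi>
    using test_sqint[OF \<Omega> that] by (auto simp: M_def)
  have gadd: "grad (\<lambda>x. \<phi> x + \<psi> x) = (\<lambda>x. grad \<phi> x + grad \<psi> x)"
    if "\<phi> \<in> test_functions U" "\<psi> \<in> test_functions U" for \<phi> \<psi>
    using grad_add[OF test_functionsD(2)[OF that(1)] test_functionsD(2)[OF that(2)]] by auto
  have gscale: "grad (\<lambda>x. c * \<phi> x) = (\<lambda>x. c *\<^sub>R grad \<phi> x)" if "\<phi> \<in> test_functions U" for \<phi> c
    using grad_scale[OF test_functionsD(2)[OF that]] by auto
  interpret semi_inner "test_functions U" "\<lambda>\<phi> \<psi>. ip M (grad \<phi>) (grad \<psi>)"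
  proof
    show "(\<lambda>x. 0) \<in> test_functions U" by (rule test_zero)
    show "(\<lambda>x. \<phi> x + \<psi> x) \<in> test_functions U"
      if "\<phi> \<in> test_functions U" "\<psi> \<in> test_functions U" for \<phi> \<psi> using that by (rule test_add)
    show "(\<lambda>x. c *\<^sub>R \<phi> x) \<in> test_functions U" if "\<phi> \<in> test_functions U" for \<phi> c
      using test_scale[OF that] by simp
    show "ip M (grad (\<lambda>x. \<phi> x + \<psi> x)) (grad \<eta>) = ip M (grad \<phi>) (grad \<eta>) + ip M (grad \<psi>) (grad \<eta>)"
      if "\<phi> \<in> test_functions U" "\<psi> \<in> test_functions U" "\<eta> \<in> test_functions U" for \<phi> \<psi> \<eta>
      using that by (simp add: gadd ip_add T)
    show "ip M (grad (\<lambda>x. c *\<^sub>R \<phi> x)) (grad \<psi>) = c * ip M (grad \<phi>) (grad \<psi>)"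
      if "\<phi> \<in> test_functions U" for \<phi> \<psi> c
      using gscale[OF that, of c] by (simp add: ip_scale)
    show "ip M (grad \<phi>) (grad \<psi>) = ip M (grad \<psi>) (grad \<phi>)" for \<phi> \<psi> by (rule ip_commute)
    show "0 \<le> ip M (grad \<phi>) (grad \<phi>)" for \<phi> by (rule ip_nonneg)
  qed
  \<comment> \<open>The Poincare inequality makes this functional continuous for the Dirichlet
    seminorm.\<close>
  have bound: "\<bar>ip M u \<phi>\<bar> \<le> (sqrt (ip M u u) * sqrt C) * sqrt (ip M (grad \<phi>) (grad \<phi>))"
    if \<phi>: "\<phi> \<in> test_functions U" for \<phi>
  proof -
    have "\<bar>ip M u \<phi>\<bar> \<le> sqrt (ip M u u) * sqrt (ip M \<phi> \<phi>)"
      by (rule L2.Cauchy_Schwarz_abs[OF u T(1)[OF \<phi>]])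
    also have "\<dots> \<le> sqrt (ip M u u) * sqrt (C * ip M (grad \<phi>) (grad \<phi>))"
      using Poin \<phi> by (intro mult_left_mono real_sqrt_le_mono) (auto simp: M_def U_def ip_nonneg)
    finally show ?thesis by (simp add: real_sqrt_mult mult.assoc)
  qed
  \<comment> \<open>Minimizing sequence of the mixed problem with Laplacian \<open>u\<close>, value
    zero on \<open>frontier \<Omega> - \<Gamma>\<close> and zero flux through
    \<open>\<Gamma>\<close>; the minus sign is that of integration by parts.\<close>
  obtain z where z: "\<And>n. z n \<in> test_functions U"
    and Cau: "\<And>m n. ip M (grad (\<lambda>x. z m x - z n x)) (grad (\<lambda>x. z m x - z n x)) \<le> 2 / Suc m + 2 / Suc n"
    and lim: "\<And>\<phi>. \<phi> \<in> test_functions U \<Longrightarrow> (\<lambda>n. ip M (grad (z n)) (grad \<phi>)) \<longlonglongrightarrow> - ip M u \<phi>"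
  proof (rule Riesz_sequence[of "\<lambda>\<phi>. - ip M u \<phi>"])
    show "- ip M u (\<lambda>x. \<phi> x + \<psi> x) = - ip M u \<phi> + - ip M u \<psi>"
      if "\<phi> \<in> test_functions U" "\<psi> \<in> test_functions U" for \<phi> \<psi>
      using that u by (simp add: L2.B_add_right T)
    show "- ip M u (\<lambda>x. c *\<^sub>R \<phi> x) = c * - ip M u \<phi>" if "\<phi> \<in> test_functions U" for \<phi> c
      using L2.B_scale_right[OF T(1)[OF that] u, of c] by simp
    show "\<bar>- ip M u \<phi>\<bar> \<le> (sqrt (ip M u u) * sqrt C) * sqrt (ip M (grad \<phi>) (grad \<phi>))"
      if "\<phi> \<in> test_functions U" for \<phi> using bound[OF that] by simp
  qed (rule that)
  have gdiff: "grad (\<lambda>x. z m x - z n x) = (\<lambda>x. grad (z m) x - grad (z n) x)" for m n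
    using gadd[OF z test_scale[OF z], of m "-1" n] gscale[OF z, of "-1" n] by simp
  have "\<exists>N. \<forall>m\<ge>N. \<forall>n\<ge>N. ip M (\<lambda>x. grad (z m) x - grad (z n) x) (\<lambda>x. grad (z m) x - grad (z n) x) < e"
    if "e > 0" for e
  proof -
    have "0 < e / 4" using that by simp
    then obtain N where N: "inverse (real (Suc N)) < e / 4" using reals_Archimedean by blast
    have le: "2 / real (Suc k) \<le> 2 * inverse (real (Suc N))" if "k \<ge> N" for k
      using that by (simp add: divide_inverse)
    have "ip M (\<lambda>x. grad (z m) x - grad (z n) x) (\<lambda>x. grad (z m) x - grad (z n) x) < e"
      if "m \<ge> N" "n \<ge> N" for m n
      using Cau[of m n] le[OF that(1)] le[OF that(2)] N by (simp add: gdiff)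
    then show ?thesis by blast
  qed
  then obtain \<beta> where \<beta>: "\<beta> \<in> sqint M"
    and z\<beta>: "(\<lambda>n. ip M (\<lambda>x. grad (z n) x - \<beta> x) (\<lambda>x. grad (z n) x - \<beta> x)) \<longlonglongrightarrow> 0"
    using L2_complete[of "\<lambda>n. grad (z n)" M, OF T(2)[OF z]] by blast
  have \<beta>_eq: "ip M \<beta> (grad \<phi>) = - ip M u \<phi>" if "\<phi> \<in> test_functions U" for \<phi>
    using L2_limit_ip[OF T(2)[OF z] \<beta> T(2)[OF that] z\<beta>] lim[OF that] by (rule LIMSEQ_unique)
  \<comment> \<open>Makes every test function of the domain admissible, so the limit equation
    includes the weak divergence.\<close>
  have "\<Omega> \<subseteq> U"
  proof -
    have "closure (frontier \<Omega> - \<Gamma>) \<subseteq> frontier \<Omega>" by (rule closure_minimal) auto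
    then show ?thesis using \<Omega>(1) by (auto simp: U_def frontier_def interior_open)
  qed
  then have TU: "test_functions \<Omega> \<subseteq> test_functions U" by (auto simp: test_functions_def)
  \<comment> \<open>The equation extends from smooth functions to their H1 closure. \<open>A\<close>
    exceeds the sum of the two norms by 1, so approximation to within the defect divided by
    \<open>A\<close> would force the defect below itself.\<close>
  have "ip M \<beta> (wgrad \<Omega> w) + ip M u w = 0" if w: "w \<in> H1_zero_on \<Omega> (frontier \<Omega> - \<Gamma>)" for w
  proof (rule ccontr)
    define A where "A = sqrt (ip M \<beta> \<beta>) + sqrt (ip M u u) + 1"
    have A: "A > 0" by (simp add: A_def ip_nonneg add_nonneg_pos)
    note ws = H1_zero_on_sqint[OF w, folded M_def]
    assume "ip M \<beta> (wgrad \<Omega> w) + ip M u w \<noteq> 0"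
    then have "\<bar>ip M \<beta> (wgrad \<Omega> w) + ip M u w\<bar> / A > 0" using A by simp
    then obtain \<phi> where \<phi>: "\<phi> \<in> test_functions U"
      and s: "sqrt (ip M (\<lambda>x. w x - \<phi> x) (\<lambda>x. w x - \<phi> x)) < \<bar>ip M \<beta> (wgrad \<Omega> w) + ip M u w\<bar> / A"
       "sqrt (ip M (\<lambda>x. wgrad \<Omega> w x - grad \<phi> x) (\<lambda>x. wgrad \<Omega> w x - grad \<phi> x)) < \<bar>ip M \<beta> (wgrad \<Omega> w) + ip M u w\<bar> / A"
      using H1_zero_on_approx[OF \<Omega> w, folded M_def U_def] by blast
    note \<phi>s = T[OF \<phi>]
    have "ip M \<beta> (wgrad \<Omega> w) + ip M u w = ip M \<beta> (\<lambda>x. wgrad \<Omega> w x - grad \<phi> x) + ip M u (\<lambda>x. w x - \<phi> x)"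
      using \<beta>_eq[OF \<phi>] \<phi>s ws \<beta> u by (simp add: L2.B_diff_right)
    also have "\<bar>\<dots>\<bar> \<le> sqrt (ip M \<beta> \<beta>) * sqrt (ip M (\<lambda>x. wgrad \<Omega> w x - grad \<phi> x) (\<lambda>x. wgrad \<Omega> w x - grad \<phi> x)) +
        sqrt (ip M u u) * sqrt (ip M (\<lambda>x. w x - \<phi> x) (\<lambda>x. w x - \<phi> x))"
      using L2.Cauchy_Schwarz_abs[OF \<beta> L2.diff[OF ws(2) \<phi>s(2)]] L2.Cauchy_Schwarz_abs[OF u L2.diff[OF ws(1) \<phi>s(1)]]
      by linarith
    also have "\<dots> \<le> sqrt (ip M \<beta> \<beta>) * (\<bar>ip M \<beta> (wgrad \<Omega> w) + ip M u w\<bar> / A) +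
        sqrt (ip M u u) * (\<bar>ip M \<beta> (wgrad \<Omega> w) + ip M u w\<bar> / A)"
      using s by (intro add_mono mult_left_mono) (auto simp: ip_nonneg)
    also have "\<dots> = (A - 1) * (\<bar>ip M \<beta> (wgrad \<Omega> w) + ip M u w\<bar> / A)"
      by (simp only: A_def) (simp add: distrib_right add_divide_distrib)
    also have "\<dots> < A * (\<bar>ip M \<beta> (wgrad \<Omega> w) + ip M u w\<bar> / A)"
      using \<open>\<bar>ip M \<beta> (wgrad \<Omega> w) + ip M u w\<bar> / A > 0\<close> by (intro mult_strict_right_mono) auto
    also have "\<dots> = \<bar>ip M \<beta> (wgrad \<Omega> w) + ip M u w\<bar>" using A by simp
    finally show False by simp
  qed
  then have "(\<lambda>x. (\<beta> x, u x)) \<in> orth (lebesgue_on \<Omega>) (div_tests \<Omega> \<Gamma>)"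
    using \<beta> u \<beta>_eq TU unfolding orth_div_tests_iff[OF \<Omega>] is_weak_div_iff
    by (auto simp: M_def L2_eq_sqint subset_iff)
  moreover have "ip M \<beta> \<beta> \<le> C * ip M u u"
  proof -
    \<comment> \<open>Expanding the squared distance to the gradient of \<open>z n\<close> leaves
      \<open>2 * a * b - b\<^sup>2\<close>, which is at most \<open>a\<^sup>2\<close>. The Poincare
      constant itself thus becomes the stability constant.\<close>
    have est: "ip M \<beta> \<beta> \<le> C * ip M u u + ip M (\<lambda>x. grad (z n) x - \<beta> x) (\<lambda>x. grad (z n) x - \<beta> x)" for n
    proof -
      define a b where "a = sqrt (ip M u u) * sqrt C" "b = sqrt (ip M (grad (z n)) (grad (z n)))"
      have sq: "a\<^sup>2 = C * ip M u u" "b\<^sup>2 = ip M (grad (z n)) (grad (z n))"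
        using C by (simp_all add: a_b_def power_mult_distrib ip_nonneg)
      have "ip M \<beta> (grad (z n)) \<le> a * b"
        using \<beta>_eq[OF z] bound[OF z, of n] by (simp add: a_b_def)
      moreover have "2 * a * b \<le> a\<^sup>2 + b\<^sup>2" by (rule sum_squares_bound)
      moreover have "ip M (\<lambda>x. grad (z n) x - \<beta> x) (\<lambda>x. grad (z n) x - \<beta> x) =
          ip M (grad (z n)) (grad (z n)) - 2 * ip M \<beta> (grad (z n)) + ip M \<beta> \<beta>"
        using \<beta> T(2)[OF z[of n]] by (simp add: L2.B_diff L2.B_diff_right L2.diff ip_commute[of M "grad (z n)" \<beta>])
      ultimately show ?thesis using sq by linarith
    qed
    have "(\<lambda>n. C * ip M u u + ip M (\<lambda>x. grad (z n) x - \<beta> x) (\<lambda>x. grad (z n) x - \<beta> x)) \<longlonglongrightarrow> C * ip M u u + 0"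
      by (intro tendsto_intros z\<beta>)
    then show ?thesis using est by (intro LIMSEQ_le_const[of _ "C * ip M u u"]) auto
  qed
  ultimately show ?thesis by (auto simp: M_def)
qed

text \<open>L2 pairings do not distinguish the free divergences \<open>g\<close>,
  \<open>\<gamma>\<close>, \<open>\<delta>\<close> from the chosen \<open>wdiv\<close>, so the
  abstract and the concrete equations agree term by term.\<close>

lemma saddle_point_solution_iff:
  fixes \<Omega> \<Gamma> :: "(real^'d) set"
  assumes \<Omega>: "open \<Omega>" "bounded \<Omega>" and S: "saddle (lebesgue_on \<Omega>) (div_tests \<Omega> \<Gamma>) c0 c1"
  shows "saddle_point_solution \<Omega> \<Gamma> c0 c1 F u v \<alpha> \<longleftrightarrow>
    (\<exists>g \<gamma>. saddle.solution (lebesgue_on \<Omega>) (div_tests \<Omega> \<Gamma>) c0 c1 F u v g \<alpha> \<gamma>)"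
proof -
  interpret saddle "lebesgue_on \<Omega>" "div_tests \<Omega> \<Gamma>" c0 c1 by (rule S)
  let ?M = "lebesgue_on \<Omega>"
  have gr: "graph v (wdiv \<Omega> v)" if "v \<in> Hdiv_zero_on \<Omega> \<Gamma>" for v
    unfolding graph_def using \<Omega> that by (rule Hdiv_zero_on_graph)
  have Hz: "v \<in> Hdiv_zero_on \<Omega> \<Gamma>" "AE x in ?M. g x = wdiv \<Omega> v x" if "graph v g" for v g
    using graph_Hdiv_zero_on[OF \<Omega> that[unfolded graph_def]] by auto
  have ipD: "ip ?M w g = ip ?M w (wdiv \<Omega> v)" if "graph v g" "w \<in> sqint ?M" for v g w
    using Hz[OF that(1)] graph_sqint(2)[OF that(1)] graph_sqint(2)[OF gr[OF Hz(1)[OF that(1)]]] that(2)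
    by (intro ip_cong_AE) (auto simp: sqint_measurable)
  have ipD': "ip ?M g w = ip ?M (wdiv \<Omega> v) w" if "graph v g" "w \<in> sqint ?M" for v g w
    using ipD[OF that] by (simp add: ip_commute)
  have a: "form_a c0 c1 \<Omega> (u, v) (\<phi>, \<psi>) = c0 * ip ?M v \<psi> + ip ?M (wdiv \<Omega> v) (wdiv \<Omega> \<psi>) + c1 * ip ?M u \<phi>"
    for u \<phi> :: "real^'d \<Rightarrow> real" and v \<psi>
    by (simp add: form_a_def ip_def)
  have b: "form_b \<Omega> (\<phi>, \<psi>) \<beta> = ip ?M \<beta> \<psi> + ip ?M (wdiv \<Omega> \<beta>) \<phi>"
    if "\<phi> \<in> sqint ?M" "\<psi> \<in> sqint ?M" "\<beta> \<in> Hdiv_zero_on \<Omega> \<Gamma>" for \<phi> \<psi> \<beta>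
    using ip_integrable[OF graph_sqint(1)[OF gr[OF that(3)]] that(2)] ip_integrable[OF that(1) graph_sqint(2)[OF gr[OF that(3)]]]
    by (simp add: form_b_def ip_def mult.commute)
  show ?thesis
  proof
    assume s: "saddle_point_solution \<Omega> \<Gamma> c0 c1 F u v \<alpha>"
    then have u: "u \<in> sqint ?M" and v: "v \<in> Hdiv_zero_on \<Omega> \<Gamma>" and \<alpha>: "\<alpha> \<in> Hdiv_zero_on \<Omega> \<Gamma>"
      by (auto simp: saddle_point_solution_def L2_eq_sqint)
    have "solution F u v (wdiv \<Omega> v) \<alpha> (wdiv \<Omega> \<alpha>)"
      unfolding solution_def
    proof (intro conjI ballI allI impI)
      show "u \<in> sqint ?M" "graph v (wdiv \<Omega> v)" "graph \<alpha> (wdiv \<Omega> \<alpha>)" using u v \<alpha> gr by auto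
      fix \<phi> :: "real^'d \<Rightarrow> real" and \<psi> \<delta>
      assume \<phi>: "\<phi> \<in> sqint ?M" and \<psi>: "graph \<psi> \<delta>"
      have "form_a c0 c1 \<Omega> (u, v) (\<phi>, \<psi>) + form_b \<Omega> (\<phi>, \<psi>) \<alpha> = F \<phi>"
        using s \<phi> Hz(1)[OF \<psi>] by (simp add: saddle_point_solution_def L2_eq_sqint)
      then show "c0 * ip ?M v \<psi> + ip ?M (wdiv \<Omega> v) \<delta> + c1 * ip ?M u \<phi> + (ip ?M \<alpha> \<psi> + ip ?M (wdiv \<Omega> \<alpha>) \<phi>) = F \<phi>"
        using a b[OF \<phi> graph_sqint(1)[OF \<psi>] \<alpha>] ipD[OF \<psi> graph_sqint(2)[OF gr[OF v]]] by simp
    next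
      fix \<beta> \<delta> assume \<beta>: "graph \<beta> \<delta>"
      have "form_b \<Omega> (u, v) \<beta> = 0"
        using s Hz(1)[OF \<beta>] by (simp add: saddle_point_solution_def)
      then show "ip ?M v \<beta> + ip ?M u \<delta> = 0"
        using b[OF u graph_sqint(1)[OF gr[OF v]] Hz(1)[OF \<beta>]] ipD[OF \<beta> u] by (simp add: ip_commute)
    qed
    then show "\<exists>g \<gamma>. solution F u v g \<alpha> \<gamma>" by blast
  next
    assume "\<exists>g \<gamma>. solution F u v g \<alpha> \<gamma>"
    then obtain g \<gamma> where s: "solution F u v g \<alpha> \<gamma>" by blast
    then have u: "u \<in> sqint ?M" and v: "graph v g" and \<alpha>: "graph \<alpha> \<gamma>" by (auto simp: solution_def)
    show "saddle_point_solution \<Omega> \<Gamma> c0 c1 F u v \<alpha>"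
      unfolding saddle_point_solution_def L2_eq_sqint
    proof (intro conjI ballI)
      show "u \<in> sqint ?M" "v \<in> Hdiv_zero_on \<Omega> \<Gamma>" "\<alpha> \<in> Hdiv_zero_on \<Omega> \<Gamma>" using u Hz(1)[OF v] Hz(1)[OF \<alpha>] by auto
      fix \<phi> :: "real^'d \<Rightarrow> real" and \<psi>
      assume \<phi>: "\<phi> \<in> sqint ?M" and \<psi>: "\<psi> \<in> Hdiv_zero_on \<Omega> \<Gamma>"
      have "c0 * ip ?M v \<psi> + ip ?M g (wdiv \<Omega> \<psi>) + c1 * ip ?M u \<phi> + (ip ?M \<alpha> \<psi> + ip ?M \<gamma> \<phi>) = F \<phi>"
        using s \<phi> gr[OF \<psi>] by (simp add: solution_def)
      then show "form_a c0 c1 \<Omega> (u, v) (\<phi>, \<psi>) + form_b \<Omega> (\<phi>, \<psi>) \<alpha> = F \<phi>"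
        using a b[OF \<phi> graph_sqint(1)[OF gr[OF \<psi>]] Hz(1)[OF \<alpha>]] ipD'[OF v graph_sqint(2)[OF gr[OF \<psi>]]] ipD'[OF \<alpha> \<phi>]
        by simp
    next
      fix \<beta> assume \<beta>: "\<beta> \<in> Hdiv_zero_on \<Omega> \<Gamma>"
      have "ip ?M v \<beta> + ip ?M u (wdiv \<Omega> \<beta>) = 0" using s gr[OF \<beta>] by (simp add: solution_def)
      then show "form_b \<Omega> (u, v) \<beta> = 0"
        using b[OF u graph_sqint(1)[OF v] \<beta>] by (simp add: ip_commute)
    qed
  qed
qed

theorem theorem9:
  fixes \<Omega> \<Gamma>\<^sub>0 \<Gamma>\<^sub>3 :: "(real^'d) set"
    and c0 c1 :: real
    and f F :: "(real^'d \<Rightarrow> real) \<Rightarrow> real"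
  assumes dim: "CARD('d) = 2 \<or> CARD('d) = 3"
    and dom: "polytopal_domain \<Omega>"
    and seg: "boundary_segment \<Omega> \<Gamma>\<^sub>0" "boundary_segment \<Omega> \<Gamma>\<^sub>3" "nonoverlapping \<Omega> \<Gamma>\<^sub>0 \<Gamma>\<^sub>3"
    and cover: "frontier \<Omega> = \<Gamma>\<^sub>0 \<union> \<Gamma>\<^sub>3"
    and f: "f \<in> dual_space (V_space \<Omega>) (V_norm \<Omega>)"
    and F: "F \<in> dual_space (L2 \<Omega>) (L2_norm \<Omega>)" "\<forall>\<phi>\<in>V_space \<Omega>. F \<phi> = f \<phi>"
    and c0: "c0 \<ge> 0"
    and c1: "c1 > 0 \<or> (c1 \<ge> 0 \<and> \<Gamma>\<^sub>0 \<noteq> {})"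
  shows "\<exists>u v \<alpha>. saddle_point_solution \<Omega> \<Gamma>\<^sub>3 c0 c1 F u v \<alpha> \<and>
           (\<forall>u' v' \<alpha>'. saddle_point_solution \<Omega> \<Gamma>\<^sub>3 c0 c1 F u' v' \<alpha>' \<longrightarrow>
              ae_eq \<Omega> u' u \<and> ae_eq \<Omega> v' v \<and> ae_eq \<Omega> \<alpha>' \<alpha>)"
proof -
  let ?M = "lebesgue_on \<Omega>"
  have \<Omega>: "open \<Omega>" "bounded \<Omega>" "connected \<Omega>" "lipschitz_boundary \<Omega>"
    using dom by (auto simp: polytopal_domain_def)
  have S: "saddle ?M (div_tests \<Omega> \<Gamma>\<^sub>3) c0 c1"
  proof
    show "div_tests \<Omega> \<Gamma>\<^sub>3 \<subseteq> sqint ?M" using \<Omega>(1,2) by (rule div_tests_sqint)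
    show "0 \<le> c0" "0 \<le> c1" using c0 c1 by auto
    show "0 < c1 \<or> (\<exists>C. \<forall>u\<in>sqint ?M. \<exists>\<beta>. (\<lambda>x. (\<beta> x, u x)) \<in> orth ?M (div_tests \<Omega> \<Gamma>\<^sub>3) \<and> ip ?M \<beta> \<beta> \<le> C * ip ?M u u)"
      using c1
    proof
      assume "c1 \<ge> 0 \<and> \<Gamma>\<^sub>0 \<noteq> {}"
      moreover have "2 \<le> CARD('d)" using dim by auto
      ultimately obtain z \<rho> where z: "z \<in> frontier \<Omega>" "\<rho> > 0" "ball z \<rho> \<inter> frontier \<Omega> \<subseteq> closure (frontier \<Omega> - \<Gamma>\<^sub>3)"
        using segment_near_point[OF \<Omega>(1,4) _ seg(1) _ seg(3)] by blast
      \<comment> \<open>Smooth functions vanishing near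
        \<open>frontier \<Omega> - \<Gamma>\<^sub>3\<close> have their support in this open
        complement; a frontier patch that misses it is what \<open>Poincare\<close> asks
        for.\<close>
      then have "ball z \<rho> \<inter> frontier \<Omega> \<inter> - closure (frontier \<Omega> - \<Gamma>\<^sub>3) = {}" by blast
      then obtain C where "C \<ge> 0" "\<And>\<phi>. \<phi> \<in> test_functions (- closure (frontier \<Omega> - \<Gamma>\<^sub>3)) \<Longrightarrow>
          ip ?M \<phi> \<phi> \<le> C * ip ?M (grad \<phi>) (grad \<phi>)"
        using Poincare[OF \<Omega>(1,3,2,4) z(1,2)] by blast
      then show ?thesis using divergence_onto[OF \<Omega>(1,2)] by blast
    qed simp
  qed
  interpret saddle ?M "div_tests \<Omega> \<Gamma>\<^sub>3" c0 c1 by (rule S)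
  have "\<exists>C. \<forall>u\<in>sqint ?M. \<bar>F u\<bar> \<le> C * sqrt (ip ?M u u)"
    using F(1) by (simp add: dual_space_def L2_eq_sqint L2_norm_eq_ip)
  then obtain C where C: "\<And>u. u \<in> sqint ?M \<Longrightarrow> \<bar>F u\<bar> \<le> C * sqrt (ip ?M u u)" by blast
  obtain u v g \<alpha> \<gamma> where sol: "solution F u v g \<alpha> \<gamma>"
    by (rule solution_exists[of F, OF _ _ C])
      (use F(1) in \<open>auto simp: dual_space_def L2_eq_sqint\<close>)
  note iff = saddle_point_solution_iff[OF \<Omega>(1,2) S]
  show ?thesis
  proof (intro exI conjI allI impI)
    show "saddle_point_solution \<Omega> \<Gamma>\<^sub>3 c0 c1 F u v \<alpha>" using sol iff by blast
    fix u' v' \<alpha>' assume "saddle_point_solution \<Omega> \<Gamma>\<^sub>3 c0 c1 F u' v' \<alpha>'"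
    then obtain g' \<gamma>' where "solution F u' v' g' \<alpha>' \<gamma>'" using iff by blast
    from solution_unique[OF sol this]
    show "ae_eq \<Omega> u' u" "ae_eq \<Omega> v' v" "ae_eq \<Omega> \<alpha>' \<alpha>" by (auto simp: ae_eq_def)
  qed
qed

end
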